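(* Let $a\in\mathbb{C}\setminus\{0\}$ and let $(c_k)_{k\ge 1}$ be a sequence of independent standard complex Gaussian random variables. For each $N\ge 1$ let $U=U_N$ be an $N\times N$ Haar-distributed unitary matrix, let $v=v_N\in\mathbb{C}^N$ be a unit vector which is either deterministic, or random, independent of $U$ and distributed with a non-vanishing density on the unit sphere of $\mathbb{C}^N$, and let $A=A_N=I_N-(1-aN^{-1/2})vv^*$. Let $$\phi_a(z)=a-\sum_{k\ge 1}c_kz^k,\qquad z\in\mathbb{D}.$$ Then, as $N\to\infty$, the point process on $\mathbb{D}$ formed by the eigenvalues of $UA$ converges vaguely to the point process on $\mathbb{D}$ formed by the zeros of $\phi_a$: $$\sum_{\lambda\in \mathrm{Sp}(UA)}\delta_\lambda\ \xrightarrow[N\to\infty]{v}\ \sum_{w\in\mathcal{Z}_{\phi_a}}\delta_w .$$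
   Context: $\mathbb{D}$ is the open unit disk of $\mathbb{C}$. A standard complex Gaussian variable $c$ is centered and rotationally invariant with $\mathbb{E}|c|^2=1$ (so $|c|^2$ is exponential of parameter 1); the series $\phi_a$ almost surely defines an analytic function on $\mathbb{D}$. The density of a random $v$ is with respect to the uniform measure on the unit sphere. $\mathrm{Sp}$ denotes the spectrum, $\mathcal{Z}_f$ the zero set in $\mathbb{D}$ of an analytic function $f$; eigenvalues and zeros are repeated with multiplicity. The measures are viewed as measures on $\mathbb{D}$, i.e. only points in $\mathbb{D}$ are counted. A point process on $\mathbb{D}$ is a random integer-valued Radon measure on $\mathbb{D}$. Point processes $\mu_N$ converge vaguely to $\mu$ (written $\mu_N\xrightarrow{v}\mu$) if for every continuous compactly supported function $\varphi$ on $\mathbb{D}$, $\int\varphi\,d\mu_N$ converges in distribution to $\int\varphi\,d\mu$. *)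

theory Defs
  imports
    "HOL-Probability.Probability"
    "HOL-Complex_Analysis.Complex_Analysis"
    "Jordan_Normal_Form.Char_Poly"
    "Jordan_Normal_Form.Schur_Decomposition"
begin

hide_type (open) Finite_Cartesian_Product.vec
hide_const (open) Coset.order

abbreviation unit_disk :: "complex set" where
  "unit_disk \<equiv> ball 0 1"


subsection \<open>The unitary group and the unit sphere\<close>

definition unitary_mats :: "nat \<Rightarrow> complex mat set" where
  "unitary_mats N = {W \<in> carrier_mat N N.
     W * mat_adjoint W = 1\<^sub>m N \<and> mat_adjoint W * W = 1\<^sub>m N}"

definition unit_sphere :: "nat \<Rightarrow> complex vec set" where
  "unit_sphere N = {x \<in> carrier_vec N. x \<bullet>c x = 1}"

text \<open>The types of matrices and vectors carry no topology.  The Borel sigma-algebras of the unitary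
  group and of the sphere are the traces of the Borel sigma-algebras of the spaces of
  \<open>N \<times> N\<close> arrays and of \<open>N\<close>-tuples, i.e. they are generated by the entries.\<close>

definition unitary_space :: "nat \<Rightarrow> complex mat measure" where
  "unitary_space N = vimage_algebra (unitary_mats N)
     (\<lambda>W. restrict (\<lambda>p. W $$ p) ({..<N} \<times> {..<N})) (\<Pi>\<^sub>M p\<in>{..<N} \<times> {..<N}. borel)"

definition sphere_space :: "nat \<Rightarrow> complex vec measure" where
  "sphere_space N = vimage_algebra (unit_sphere N)
     (\<lambda>x. restrict (\<lambda>i. vec_index x i) {..<N}) (\<Pi>\<^sub>M i\<in>{..<N}. borel)"

text \<open>On a compact group the left-invariant probability measure is unique and also
  right-invariant.\<close>

definition haar_unitary :: "nat \<Rightarrow> complex mat measure \<Rightarrow> bool" where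
  "haar_unitary N \<mu> \<longleftrightarrow> prob_space \<mu> \<and> sets \<mu> = sets (unitary_space N) \<and>
     (\<forall>W\<in>unitary_mats N. distr \<mu> (unitary_space N) (\<lambda>V. W * V) = \<mu>)"

definition haar_distributed :: "'w measure \<Rightarrow> nat \<Rightarrow> ('w \<Rightarrow> complex mat) \<Rightarrow> bool" where
  "haar_distributed M N U \<longleftrightarrow> U \<in> measurable M (unitary_space N) \<and>
     haar_unitary N (distr M (unitary_space N) U)"

text \<open>The unitary group acts transitively on the sphere, so this determines the measure uniquely.\<close>

definition uniform_sphere :: "nat \<Rightarrow> complex vec measure \<Rightarrow> bool" where
  "uniform_sphere N \<sigma> \<longleftrightarrow> prob_space \<sigma> \<and> sets \<sigma> = sets (sphere_space N) \<and>
     (\<forall>W\<in>unitary_mats N. distr \<sigma> (sphere_space N) (\<lambda>x. W *\<^sub>v x) = \<sigma>)"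

definition nonvanishing_density_on_sphere ::
    "'w measure \<Rightarrow> nat \<Rightarrow> ('w \<Rightarrow> complex vec) \<Rightarrow> bool" where
  "nonvanishing_density_on_sphere M N v \<longleftrightarrow>
     (\<exists>\<sigma> f. uniform_sphere N \<sigma> \<and> distributed M \<sigma> v f \<and> (\<forall>x\<in>unit_sphere N. f x \<noteq> 0))"

text \<open>The constant \<open>prob_space.indep_var\<close> needs both variables to take values in the same type, so
  independence is expressed through the generated sigma-algebras.\<close>

definition independent_rvs ::
    "'w measure \<Rightarrow> 'b measure \<Rightarrow> ('w \<Rightarrow> 'b) \<Rightarrow> 'd measure \<Rightarrow> ('w \<Rightarrow> 'd) \<Rightarrow> bool" where
  "independent_rvs M S X T Y \<longleftrightarrow> X \<in> measurable M S \<and> Y \<in> measurable M T \<and>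
     prob_space.indep_set M (sets (vimage_algebra (space M) X S))
                            (sets (vimage_algebra (space M) Y T))"

definition admissible_vector ::
    "'w measure \<Rightarrow> nat \<Rightarrow> ('w \<Rightarrow> complex mat) \<Rightarrow> ('w \<Rightarrow> complex vec) \<Rightarrow> bool" where
  "admissible_vector M N U v \<longleftrightarrow>
     (\<exists>x\<in>unit_sphere N. \<forall>\<omega>\<in>space M. v \<omega> = x) \<or>
     (independent_rvs M (unitary_space N) U (sphere_space N) v \<and>
      nonvanishing_density_on_sphere M N v)"

definition outer_self :: "nat \<Rightarrow> complex vec \<Rightarrow> complex mat" where
  "outer_self N x = mat N N (\<lambda>(i, j). vec_index x i * cnj (vec_index x j))"

definition A_mat :: "complex \<Rightarrow> nat \<Rightarrow> complex vec \<Rightarrow> complex mat" where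
  "A_mat a N x = 1\<^sub>m N - (1 - a * of_real (real N powr (-1/2))) \<cdot>\<^sub>m outer_self N x"


subsection \<open>Gaussian power series\<close>

text \<open>Centred, rotationally invariant, of total variance 1: the real and imaginary parts are
  independent centred Gaussians of variance 1/2 each.\<close>

definition std_complex_gaussian :: "'q measure \<Rightarrow> ('q \<Rightarrow> complex) \<Rightarrow> bool" where
  "std_complex_gaussian M X \<longleftrightarrow> X \<in> borel_measurable M \<and>
     distributed M lborel (\<lambda>\<omega>. Re (X \<omega>)) (\<lambda>x. ennreal (normal_density 0 (1 / sqrt 2) x)) \<and>
     distributed M lborel (\<lambda>\<omega>. Im (X \<omega>)) (\<lambda>x. ennreal (normal_density 0 (1 / sqrt 2) x)) \<and>
     prob_space.indep_var M borel (\<lambda>\<omega>. Re (X \<omega>)) borel (\<lambda>\<omega>. Im (X \<omega>))"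

definition phi :: "complex \<Rightarrow> (nat \<Rightarrow> complex) \<Rightarrow> complex \<Rightarrow> complex" where
  "phi a c z = a - (\<Sum>k. c (Suc k) * z ^ Suc k)"


subsection \<open>Point processes on the disk\<close>

text \<open>For \<open>m :: complex \<Rightarrow> nat\<close> this is the Borel measure on the unit disk that puts mass \<open>m z\<close>
  at each point \<open>z\<close> of the disk, i.e. the sum of \<open>m z\<close> Dirac masses at \<open>z\<close> over all \<open>z\<close>.\<close>

definition multiplicity_measure :: "(complex \<Rightarrow> nat) \<Rightarrow> complex measure" where
  "multiplicity_measure m =
     distr (density (count_space unit_disk) (\<lambda>z. of_nat (m z))) (restrict_space borel unit_disk) (\<lambda>z. z)"

lemma space_multiplicity_measure [simp]: "space (multiplicity_measure m) = unit_disk"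
  by (simp add: multiplicity_measure_def space_restrict_space)

lemma sets_multiplicity_measure [simp]:
  "sets (multiplicity_measure m) = sets (restrict_space borel unit_disk)"
  by (simp add: multiplicity_measure_def)

lemma emeasure_multiplicity_measure:
  assumes "B \<in> sets borel" "B \<subseteq> unit_disk"
  shows "emeasure (multiplicity_measure m) B = (\<integral>\<^sup>+z. of_nat (m z) \<partial>count_space B)"
proof -
  have "B \<in> sets (restrict_space borel unit_disk)"
    using assms by (simp add: sets_restrict_space_iff)
  then have "emeasure (multiplicity_measure m) B =
      emeasure (density (count_space unit_disk) (\<lambda>z. of_nat (m z))) (B \<inter> unit_disk)"
    unfolding multiplicity_measure_def
    by (subst emeasure_distr) (auto simp: space_restrict_space vimage_def Int_def)
  also have "\<dots> = (\<integral>\<^sup>+z. of_nat (m z) * indicator B z \<partial>count_space unit_disk)"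
    using assms by (subst emeasure_density) (auto simp: Int_absorb2)
  also have "\<dots> = (\<integral>\<^sup>+z. of_nat (m z) \<partial>count_space B)"
    using assms by (subst (1 2) nn_integral_count_space_indicator)
      (auto intro!: nn_integral_cong simp: indicator_def)
  finally show ?thesis .
qed

definition eigenvalue_measure :: "complex mat \<Rightarrow> complex measure" where
  "eigenvalue_measure B = multiplicity_measure (\<lambda>z. Polynomial.order z (char_poly B))"

text \<open>Meaningful for functions that are analytic and not identically zero on the disk.  Functions
  that are not analytic on the disk are given the zero measure; the Gaussian series fails to be
  analytic only on a null event, and its value at 0 is \<open>a\<close>.\<close>

definition zero_measure :: "(complex \<Rightarrow> complex) \<Rightarrow> complex measure" where
  "zero_measure f = multiplicity_measure
     (\<lambda>z. if f holomorphic_on unit_disk \<and> f z = 0 then nat (zorder f z) else 0)"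

definition test_function :: "(complex \<Rightarrow> real) \<Rightarrow> bool" where
  "test_function \<phi> \<longleftrightarrow> continuous_on unit_disk \<phi> \<and>
     (\<exists>K. compact K \<and> K \<subseteq> unit_disk \<and> (\<forall>z\<in>unit_disk - K. \<phi> z = 0))"

text \<open>Convergence in distribution of real random variables that may live on different probability
  spaces.  Measurability is part of the notion, as \<open>distr\<close> is not meaningful without it.\<close>

definition converges_in_distribution ::
    "(nat \<Rightarrow> 'w measure) \<Rightarrow> (nat \<Rightarrow> 'w \<Rightarrow> real) \<Rightarrow> 'q measure \<Rightarrow> ('q \<Rightarrow> real) \<Rightarrow> bool" where
  "converges_in_distribution M X Q Y \<longleftrightarrow>
     (\<forall>\<^sub>F n in sequentially. X n \<in> borel_measurable (M n)) \<and> Y \<in> borel_measurable Q \<and>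
     weak_conv_m (\<lambda>n. distr (M n) borel (X n)) (distr Q borel Y)"

definition converges_vaguely ::
    "(nat \<Rightarrow> 'w measure) \<Rightarrow> (nat \<Rightarrow> 'w \<Rightarrow> complex measure) \<Rightarrow>
     'q measure \<Rightarrow> ('q \<Rightarrow> complex measure) \<Rightarrow> bool" where
  "converges_vaguely M \<mu> Q \<nu> \<longleftrightarrow>
     (\<forall>\<phi>. test_function \<phi> \<longrightarrow>
       converges_in_distribution M (\<lambda>n \<omega>. integral\<^sup>L (\<mu> n \<omega>) \<phi>) Q (\<lambda>\<omega>. integral\<^sup>L (\<nu> \<omega>) \<phi>))"

end

theory Submission
  imports Defs
begin

text \<open>
  Put \<open>w\<^sub>k = v\<^sup>* U\<^sup>k v\<close> and \<open>\<alpha> = a N\<^sup>-\<^sup>1\<^sup>/\<^sup>2\<close>.  Since \<open>UA\<close> is a rank one perturbation of \<open>U\<close>, on the disk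
  \<open>det (z - UA) = det (z - U) N\<^sup>-\<^sup>1\<^sup>/\<^sup>2 F\<^sub>N(z)\<close> where \<open>F\<^sub>N(z) = a - (1 - \<alpha>) \<Sum>\<^sub>k N\<^sup>1\<^sup>/\<^sup>2 cnj w\<^sub>k z\<^sup>k\<close>, and
  \<open>det (z - U)\<close> does not vanish there; so the eigenvalues of \<open>UA\<close> in the disk are the zeros of \<open>F\<^sub>N\<close>.

  Left invariance of the Haar measure, differentiated along the one-parameter groups of unitary
  matrices, gives Schwinger--Dyson equations: \<open>E[\<Sum>\<^bsub>l<k\<^esub> tr(U\<^sup>l) w\<^bsub>k-l\<^esub> \<Phi>]\<close> is expressed by the
  derivatives of \<open>\<Phi>\<close>, a function of the \<open>w\<^sub>m\<close>.  For \<open>\<Phi> = cnj w\<^sub>k\<close>, together with a positivity property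
  of the Toeplitz form of \<open>tr(U\<^sup>l)\<close>, this yields \<open>N E|w\<^sub>k|\<^sup>2 \<le> 2k\<^sup>2\<close>, hence also
  \<open>E|tr(U\<^sup>l)|\<^sup>2 \<le> 2l\<^sup>2N\<close>.  Then only the term \<open>l = 0\<close> matters, and for \<open>\<Phi> = exp(is Y)\<close> with \<open>Y\<close> a real
  linear form in the \<open>N\<^sup>1\<^sup>/\<^sup>2 w\<^sub>m\<close> the equation becomes the differential equation in \<open>s\<close> of the Gaussian
  characteristic function, up to \<open>O(N\<^sup>-\<^sup>1\<^sup>/\<^sup>2)\<close>.

  The bounds confine the coefficient sequences, up to small probability, to compact sets of the
  product space on which, by Hurwitz' theorem, the integral of a test function over the zeros is a
  continuous functional of the coefficients.  A Stone--Weierstrass approximation by trigonometric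
  polynomials transfers the convergence of characteristic functions to these functionals.
\<close>


subsection \<open>Linear algebra of unitary matrices\<close>

text \<open>The equation for a single k cannot be solved for E|w_k|^2: next to the term l = 0 it
  contains the products tr(U^l) w_{k-l} cnj w_k, and at that stage only |tr(U^l)| \<le> N is known.
  Summed over k \<le> n they make up a quadratic form whose real part is at least N/2 times the sum
  of the |w_k|^2, so no information on the traces is required. The trace bound comes afterwards: the
  diagonal entries of U^l are the moments w_l of the pairs (U, e_i), which have the same invariance.

  The growth in k matters as much as the decay in N. The second moments of N^(1/2) w_k are O(k^2)
  uniformly in N, so boxes |y_k| \<le> M (k+1)^2 capture the coefficient sequences with high
  probability, and they still force convergence of the power series in the whole disk. On the full
  product space the zeros do not depend continuously on the coefficients; this is why the functional
  is compared with polynomials in clipped coordinates and is used only along sequences inside one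
  box.\<close>

lemma mat_adjoint_index:
  assumes "i < dim_col A" "j < dim_row A"
  shows "mat_adjoint A $$ (i, j) = conjugate (A $$ (j, i))"
  using assms by (simp add: mat_adjoint_def mat_of_rows_def)

lemma dim_mat_adjoint [simp]:
  "dim_row (mat_adjoint A) = dim_col A" "dim_col (mat_adjoint A) = dim_row A"
  by (simp_all add: mat_adjoint_def mat_of_rows_def)

lemma mat_adjoint_carrier [simp]:
  "A \<in> carrier_mat n m \<Longrightarrow> mat_adjoint A \<in> carrier_mat m n"
  by (auto simp: mat_adjoint_def mat_of_rows_def)

lemma cscalar_prod_sum:
  fixes x y :: "complex vec"
  assumes "y \<in> carrier_vec n"
  shows "x \<bullet>c y = (\<Sum>i<n. vec_index x i * cnj (vec_index y i))"
  using assms by (simp add: scalar_prod_def lessThan_atLeast0)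

lemma mult_mat_vec_sum:
  fixes A :: "complex mat"
  assumes "A \<in> carrier_mat n m" "x \<in> carrier_vec m" "i < n"
  shows "vec_index (A *\<^sub>v x) i = (\<Sum>j<m. A $$ (i, j) * vec_index x j)"
  using assms by (simp add: scalar_prod_def lessThan_atLeast0)

lemma cscalar_prod_adjoint:
  fixes A :: "complex mat"
  assumes A: "A \<in> carrier_mat n n" and x: "x \<in> carrier_vec n" and y: "y \<in> carrier_vec n"
  shows "(A *\<^sub>v x) \<bullet>c y = x \<bullet>c (mat_adjoint A *\<^sub>v y)"
proof -
  have "(A *\<^sub>v x) \<bullet>c y = (\<Sum>i<n. \<Sum>j<n. A $$ (i, j) * vec_index x j * cnj (vec_index y i))"
    using mult_mat_vec_sum[OF A x] by (simp add: cscalar_prod_sum[OF y] sum_distrib_right)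
  also have "\<dots> = (\<Sum>j<n. \<Sum>i<n. A $$ (i, j) * vec_index x j * cnj (vec_index y i))"
    by (rule sum.swap)
  also have "\<dots> = (\<Sum>j<n. vec_index x j * cnj (vec_index (mat_adjoint A *\<^sub>v y) j))"
    using A by (intro sum.cong refl)
      (simp add: mult_mat_vec_sum[OF mat_adjoint_carrier[OF A] y] mat_adjoint_index
        sum_distrib_left mult_ac del: index_mult_mat_vec)
  also have "\<dots> = x \<bullet>c (mat_adjoint A *\<^sub>v y)"
    by (subst cscalar_prod_sum[of _ n]) (use A y in \<open>auto intro: mult_mat_vec_carrier[OF mat_adjoint_carrier]\<close>)
  finally show ?thesis .
qed

lemma cnj_cscalar_prod:
  fixes x y :: "complex vec"
  assumes "x \<in> carrier_vec n" "y \<in> carrier_vec n"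
  shows "cnj (x \<bullet>c y) = y \<bullet>c x"
  by (simp add: cscalar_prod_sum[OF assms(1)] cscalar_prod_sum[OF assms(2)] mult_ac)

lemma cscalar_prod_add_left:
  fixes x y z :: "complex vec"
  assumes "x \<in> carrier_vec n" "y \<in> carrier_vec n" "z \<in> carrier_vec n"
  shows "(x + y) \<bullet>c z = x \<bullet>c z + y \<bullet>c z"
  using assms by (simp add: cscalar_prod_sum algebra_simps sum.distrib)

lemma cscalar_prod_add_right:
  fixes x y z :: "complex vec"
  assumes "x \<in> carrier_vec n" "y \<in> carrier_vec n" "z \<in> carrier_vec n"
  shows "x \<bullet>c (y + z) = x \<bullet>c y + x \<bullet>c z"
  using assms by (simp add: cscalar_prod_sum[of _ n] algebra_simps sum.distrib)

lemma cscalar_prod_smult_left: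
  fixes x y :: "complex vec"
  assumes "x \<in> carrier_vec n" "y \<in> carrier_vec n"
  shows "(a \<cdot>\<^sub>v x) \<bullet>c y = a * (x \<bullet>c y)"
  using assms by (simp add: cscalar_prod_sum[of _ n] sum_distrib_left mult_ac)

lemma cscalar_prod_smult_right:
  fixes x y :: "complex vec"
  assumes "x \<in> carrier_vec n" "y \<in> carrier_vec n"
  shows "x \<bullet>c (a \<cdot>\<^sub>v y) = cnj a * (x \<bullet>c y)"
  using assms by (simp add: cscalar_prod_sum[of _ n] sum_distrib_left mult_ac)

lemma unitary_mats_carrier: "W \<in> unitary_mats N \<Longrightarrow> W \<in> carrier_mat N N"
  by (simp add: unitary_mats_def)

lemma mat_adjoint_mult:
  fixes V W :: "complex mat"
  assumes "V \<in> carrier_mat N N" "W \<in> carrier_mat N N"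
  shows "mat_adjoint (V * W) = mat_adjoint W * mat_adjoint V"
  using assms by (intro eq_matI) (auto simp: mat_adjoint_index scalar_prod_def mult.commute intro!: sum.cong)

lemma unitary_mult:
  assumes V: "V \<in> unitary_mats N" and W: "W \<in> unitary_mats N"
  shows "V * W \<in> unitary_mats N"
proof -
  have c: "V \<in> carrier_mat N N" "W \<in> carrier_mat N N" "mat_adjoint V \<in> carrier_mat N N"
     "mat_adjoint W \<in> carrier_mat N N"
    using assms by (auto intro: unitary_mats_carrier mat_adjoint_carrier)
  have "V * W * (mat_adjoint W * mat_adjoint V) = V * (W * mat_adjoint W) * mat_adjoint V"
    using c by (simp add: assoc_mult_mat[of _ N N _ N _ N] mult_carrier_mat[of _ N N _ N])
  moreover have "(mat_adjoint W * mat_adjoint V) * (V * W) = mat_adjoint W * (mat_adjoint V * V) * W"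
    using c by (simp add: assoc_mult_mat[of _ N N _ N _ N] mult_carrier_mat[of _ N N _ N])
  ultimately show ?thesis
    using assms c by (auto simp: unitary_mats_def mat_adjoint_mult[of _ N])
qed

lemma unitary_cscalar_prod:
  assumes W: "W \<in> unitary_mats N" and x: "x \<in> carrier_vec N" and y: "y \<in> carrier_vec N"
  shows "(W *\<^sub>v x) \<bullet>c (W *\<^sub>v y) = x \<bullet>c y"
proof -
  have c: "W \<in> carrier_mat N N" "mat_adjoint W \<in> carrier_mat N N"
    using W by (auto intro: unitary_mats_carrier mat_adjoint_carrier)
  have "(W *\<^sub>v x) \<bullet>c (W *\<^sub>v y) = x \<bullet>c ((mat_adjoint W * W) *\<^sub>v y)"
    using c x y by (simp add: cscalar_prod_adjoint[of W N] assoc_mult_mat_vec[of _ N N _ N])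
  then show ?thesis
    using W y by (simp add: unitary_mats_def)
qed

lemma outer_self_carrier [simp]: "outer_self N u \<in> carrier_mat N N"
  by (simp add: outer_self_def)

lemma dim_outer_self [simp]: "dim_row (outer_self N u) = N" "dim_col (outer_self N u) = N"
  by (simp_all add: outer_self_def)

lemma outer_self_mult_vec:
  assumes "u \<in> carrier_vec N" "x \<in> carrier_vec N"
  shows "outer_self N u *\<^sub>v x = (x \<bullet>c u) \<cdot>\<^sub>v u"
proof (rule eq_vecI)
  fix i assume "i < dim_vec ((x \<bullet>c u) \<cdot>\<^sub>v u)"
  with assms have i: "i < N" by simp
  have "vec_index (outer_self N u *\<^sub>v x) i = (\<Sum>j<N. outer_self N u $$ (i, j) * vec_index x j)"
    using assms i by (intro mult_mat_vec_sum[of _ N N]) auto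
  also have "\<dots> = vec_index ((x \<bullet>c u) \<cdot>\<^sub>v u) i"
    using assms i by (simp add: outer_self_def cscalar_prod_sum[of u N] sum_distrib_left sum_distrib_right mult_ac)
  finally show "vec_index (outer_self N u *\<^sub>v x) i = vec_index ((x \<bullet>c u) \<cdot>\<^sub>v u) i" .
qed (use assms in simp_all)

lemma smult_mat_mult_vec:
  fixes A :: "complex mat"
  assumes "A \<in> carrier_mat n m" "x \<in> carrier_vec m"
  shows "(a \<cdot>\<^sub>m A) *\<^sub>v x = a \<cdot>\<^sub>v (A *\<^sub>v x)"
  using assms by (intro eq_vecI) auto

section \<open>Rank one perturbations of the identity, powers, and rotations\<close>

definition rank_one_pert :: "nat \<Rightarrow> complex vec \<Rightarrow> complex \<Rightarrow> complex mat" where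
  "rank_one_pert N u \<beta> = 1\<^sub>m N + \<beta> \<cdot>\<^sub>m outer_self N u"

lemma rank_one_pert_carrier [simp]: "rank_one_pert N u \<beta> \<in> carrier_mat N N"
  by (simp add: rank_one_pert_def)

lemma rank_one_pert_mult_vec:
  assumes "u \<in> carrier_vec N" "x \<in> carrier_vec N"
  shows "rank_one_pert N u \<beta> *\<^sub>v x = x + (\<beta> * (x \<bullet>c u)) \<cdot>\<^sub>v u"
  using assms outer_self_mult_vec[OF assms]
  by (simp add: rank_one_pert_def add_mult_distrib_mat_vec[of _ N N] smult_mat_mult_vec[of _ N N] smult_smult_assoc)

lemma mat_adjoint_rank_one_pert: "mat_adjoint (rank_one_pert N u \<beta>) = rank_one_pert N u (cnj \<beta>)"
  by (intro eq_matI) (auto simp: mat_adjoint_index rank_one_pert_def outer_self_def mult_ac)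

text \<open>The product of the perturbations with coefficients b and c has coefficient b + c + b c
  |u|^2, and the adjoint has the conjugate coefficient. The hypothesis thus says that both products
  with the adjoint are the identity.\<close>

lemma rank_one_pert_unitary:
  assumes u: "u \<in> carrier_vec N" and \<beta>: "\<beta> + cnj \<beta> + \<beta> * cnj \<beta> * (u \<bullet>c u) = 0"
  shows "rank_one_pert N u \<beta> \<in> unitary_mats N"
proof -
  have prod: "rank_one_pert N u \<beta>1 * rank_one_pert N u \<beta>2 = 1\<^sub>m N"
    if "\<beta>1 + \<beta>2 + \<beta>1 * \<beta>2 * (u \<bullet>c u) = 0" for \<beta>1 \<beta>2
  proof (rule eq_matI)
    fix i j assume ij: "i < dim_row (1\<^sub>m N :: complex mat)" "j < dim_col (1\<^sub>m N :: complex mat)"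
    let ?e = "\<lambda>i k. if k = i then 1 else 0 :: complex" and ?u = "vec_index u"
    have "(rank_one_pert N u \<beta>1 * rank_one_pert N u \<beta>2) $$ (i, j)
        = (\<Sum>k<N. (?e i k + \<beta>1 * (?u i * cnj (?u k))) * (?e j k + \<beta>2 * (?u k * cnj (?u j))))"
      using ij by (simp add: rank_one_pert_def outer_self_def scalar_prod_def lessThan_atLeast0)
    also have "\<dots> = (\<Sum>k<N. ?e i k * ?e j k) + (\<Sum>k<N. ?e i k * (\<beta>2 * (?u k * cnj (?u j))))
        + (\<Sum>k<N. \<beta>1 * (?u i * cnj (?u k)) * ?e j k)
        + \<beta>1 * \<beta>2 * ?u i * cnj (?u j) * (\<Sum>k<N. ?u k * cnj (?u k))"
      by (simp only: ring_distribs sum.distrib sum_distrib_left) (simp add: mult_ac)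
    also have "\<dots> = ?e j i + (\<beta>1 + \<beta>2 + \<beta>1 * \<beta>2 * (u \<bullet>c u)) * (?u i * cnj (?u j))"
      using ij by (simp add: cscalar_prod_sum[OF u] if_distrib[of "\<lambda>x. x * _"] if_distrib[of "\<lambda>x. _ * x"] ring_distribs
          cong: if_cong)
    also have "\<dots> = 1\<^sub>m N $$ (i, j)"
      using that ij by simp
    finally show "(rank_one_pert N u \<beta>1 * rank_one_pert N u \<beta>2) $$ (i, j) = 1\<^sub>m N $$ (i, j)" .
  qed (simp_all add: rank_one_pert_def)
  show ?thesis
    using \<beta> by (auto simp: unitary_mats_def mat_adjoint_rank_one_pert intro!: prod) (simp_all add: algebra_simps)
qed

text \<open>The vector U^k x, encoded by iterating the action on vectors so that no matrix powers
  are needed; \<open>power_form\<close> below is y* U^k x, linear in x and conjugate-linear in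
  y.\<close>

definition krylov :: "complex mat \<Rightarrow> complex vec \<Rightarrow> nat \<Rightarrow> complex vec" where
  "krylov U x k = ((\<lambda>y. U *\<^sub>v y) ^^ k) x"

definition power_form :: "complex mat \<Rightarrow> nat \<Rightarrow> complex vec \<Rightarrow> complex vec \<Rightarrow> complex" where
  "power_form U k x y = krylov U x k \<bullet>c y"

lemma krylov_0 [simp]: "krylov U x 0 = x"
  and krylov_Suc: "krylov U x (Suc k) = U *\<^sub>v krylov U x k"
  by (simp_all add: krylov_def)

lemma power_form_0: "power_form U 0 x y = x \<bullet>c y"
  by (simp add: power_form_def)

lemma krylov_krylov: "krylov U (krylov U x k) l = krylov U x (l + k)"
  by (simp add: krylov_def funpow_add)

lemma krylov_carrier [simp]:
  "U \<in> carrier_mat N N \<Longrightarrow> x \<in> carrier_vec N \<Longrightarrow> krylov U x k \<in> carrier_vec N"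
  by (induction k) (auto simp: krylov_Suc)

lemma krylov_carrier_unitary [simp]:
  "U \<in> unitary_mats N \<Longrightarrow> x \<in> carrier_vec N \<Longrightarrow> krylov U x k \<in> carrier_vec N"
  by (simp add: unitary_mats_carrier)

lemma krylov_isometry:
  assumes "U \<in> unitary_mats N" "x \<in> carrier_vec N" "y \<in> carrier_vec N"
  shows "krylov U x k \<bullet>c krylov U y k = x \<bullet>c y"
  using assms by (induction k) (simp_all add: krylov_Suc unitary_cscalar_prod)

lemma power_form_Suc_adjoint:
  assumes "U \<in> carrier_mat N N" "x \<in> carrier_vec N" "y \<in> carrier_vec N"
  shows "power_form U (Suc k) x y = power_form U k x (mat_adjoint U *\<^sub>v y)"
  using assms by (simp add: power_form_def krylov_Suc cscalar_prod_adjoint[of _ N])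

lemma krylov_add:
  assumes "U \<in> carrier_mat N N" "x \<in> carrier_vec N" "y \<in> carrier_vec N"
  shows "krylov U (x + y) k = krylov U x k + krylov U y k"
  using assms by (induction k) (simp_all add: krylov_Suc mult_add_distrib_mat_vec[of _ N N])

lemma krylov_smult:
  assumes "U \<in> carrier_mat N N" "x \<in> carrier_vec N"
  shows "krylov U (a \<cdot>\<^sub>v x) k = a \<cdot>\<^sub>v krylov U x k"
  using assms by (induction k) (simp_all add: krylov_Suc mult_mat_vec[of _ N N])

lemma power_form_add_smult_left:
  assumes "U \<in> carrier_mat N N" "x \<in> carrier_vec N" "x' \<in> carrier_vec N" "y \<in> carrier_vec N"
  shows "power_form U k (x + a \<cdot>\<^sub>v x') y = power_form U k x y + a * power_form U k x' y"
  using assms by (simp add: power_form_def krylov_add[of _ N] krylov_smult[of _ N]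
      cscalar_prod_add_left[of _ N] cscalar_prod_smult_left[of _ N])

lemma power_form_add_smult_right:
  assumes "U \<in> carrier_mat N N" "x \<in> carrier_vec N" "y \<in> carrier_vec N" "y' \<in> carrier_vec N"
  shows "power_form U k x (y + a \<cdot>\<^sub>v y') = power_form U k x y + cnj a * power_form U k x y'"
  using assms by (simp add: power_form_def cscalar_prod_add_right[of _ N] cscalar_prod_smult_right[of _ N])

definition rotation_coeff :: "complex vec \<Rightarrow> real \<Rightarrow> complex" where
  "rotation_coeff u t = (exp (\<i> * of_real t * (u \<bullet>c u)) - 1) / (u \<bullet>c u)"

text \<open>The unitary one-parameter group generated by \<open>\<i> u u\<^sup>*\<close>.\<close>

definition rotation :: "nat \<Rightarrow> complex vec \<Rightarrow> real \<Rightarrow> complex mat" where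
  "rotation N u t = rank_one_pert N u (rotation_coeff u t)"

lemma rotation_carrier [simp]: "rotation N u t \<in> carrier_mat N N"
  by (simp add: rotation_def)

lemma cscalar_prod_self_real:
  fixes u :: "complex vec"
  assumes "u \<in> carrier_vec N"
  shows "u \<bullet>c u = of_real (\<Sum>i<N. (cmod (vec_index u i))\<^sup>2)"
  using assms by (simp add: cscalar_prod_sum complex_norm_square[symmetric])

lemma rotation_unitary:
  assumes u: "u \<in> carrier_vec N"
  shows "rotation N u t \<in> unitary_mats N"
proof -
  obtain s where s: "u \<bullet>c u = of_real s"
    using cscalar_prod_self_real[OF u] by blast
  have "rotation_coeff u t + cnj (rotation_coeff u t)
      + rotation_coeff u t * cnj (rotation_coeff u t) * (u \<bullet>c u) = 0"
  proof (cases "s = 0")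
    case False
    define z where "z = exp (\<i> * of_real t * of_real s)"
    have z: "z * cnj z = 1"
      by (simp add: z_def exp_cnj flip: exp_add)
    have c: "rotation_coeff u t = (z - 1) / of_real s" "cnj (rotation_coeff u t) = (cnj z - 1) / of_real s"
      by (simp_all add: rotation_coeff_def s z_def)
    have "rotation_coeff u t + cnj (rotation_coeff u t)
      + rotation_coeff u t * cnj (rotation_coeff u t) * (u \<bullet>c u) = (z * cnj z - 1) / of_real s"
      unfolding c s using False by (simp add: field_simps)
    then show ?thesis by (simp add: z)
  qed (simp add: rotation_coeff_def s)
  then show ?thesis
    unfolding rotation_def by (intro rank_one_pert_unitary u)
qed

lemma rotation_coeff_deriv:
  assumes "u \<bullet>c u \<noteq> 0"
  shows "(rotation_coeff u has_vector_derivative \<i> * (1 + rotation_coeff u t * (u \<bullet>c u))) (at t)"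
proof -
  have "((\<lambda>t. exp (of_real t * (\<i> * (u \<bullet>c u)))) has_vector_derivative
      (\<i> * (u \<bullet>c u)) * exp (of_real t * (\<i> * (u \<bullet>c u)))) (at t)"
    using exp_scaleR_has_vector_derivative_left[of "\<i> * (u \<bullet>c u)" t]
    by (simp add: scaleR_conv_of_real)
  then have "((\<lambda>t. (exp (of_real t * (\<i> * (u \<bullet>c u))) - 1) / (u \<bullet>c u)) has_vector_derivative
      ((\<i> * (u \<bullet>c u)) * exp (of_real t * (\<i> * (u \<bullet>c u)))) / (u \<bullet>c u)) (at t)"
    by (auto intro!: derivative_eq_intros)
  moreover have "rotation_coeff u = (\<lambda>t. (exp (of_real t * (\<i> * (u \<bullet>c u))) - 1) / (u \<bullet>c u))"
    by (simp add: rotation_coeff_def mult_ac fun_eq_iff)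
  ultimately show ?thesis
    using assms by (simp add: rotation_coeff_def mult_ac)
qed

text \<open>Moving the outermost factor W to the right argument replaces y by W* y, which is U* y
  plus a multiple of U* u. The perturbation then enters through a scalar and a lower power, so
  derivatives in it can be taken by induction on k.\<close>

lemma power_form_rank_one_pert_Suc:
  fixes \<beta> :: complex
  assumes U: "U \<in> carrier_mat N N" and x: "x \<in> carrier_vec N" and y: "y \<in> carrier_vec N"
    and u: "u \<in> carrier_vec N"
  defines "W \<equiv> rank_one_pert N u \<beta> * U"
  shows "power_form W (Suc k) x y = power_form W k x (mat_adjoint U *\<^sub>v y)
     + \<beta> * (u \<bullet>c y) * power_form W k x (mat_adjoint U *\<^sub>v u)"
proof -
  have W: "W \<in> carrier_mat N N" and U': "mat_adjoint U \<in> carrier_mat N N"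
    using U by (auto simp: W_def intro: mult_carrier_mat[of _ N N] mat_adjoint_carrier)
  have "mat_adjoint W *\<^sub>v y = mat_adjoint U *\<^sub>v (rank_one_pert N u (cnj \<beta>) *\<^sub>v y)"
    using U U' y by (simp add: W_def mat_adjoint_mult[of _ N] mat_adjoint_rank_one_pert assoc_mult_mat_vec[of _ N N _ N])
  also have "\<dots> = mat_adjoint U *\<^sub>v y + (cnj \<beta> * (y \<bullet>c u)) \<cdot>\<^sub>v (mat_adjoint U *\<^sub>v u)"
    using U' u y by (simp add: rank_one_pert_mult_vec mult_add_distrib_mat_vec[of _ N N] mult_mat_vec[of _ N N])
  finally show ?thesis
    using W U' u x y by (simp add: power_form_Suc_adjoint[of _ N] power_form_add_smult_right[of _ N]
        mult_mat_vec_carrier[of _ N N] cnj_cscalar_prod[of _ N])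
qed

text \<open>Leibniz rule for W^k: the derivative of W is i u u* W, and inserting it at each of the k
  factors splits the form into one that starts at u and one that ends at u.\<close>

lemma power_form_rotation_deriv:
  assumes U: "U \<in> unitary_mats N" and x: "x \<in> carrier_vec N" and y: "y \<in> carrier_vec N"
    and u: "u \<in> carrier_vec N"
  defines "W \<equiv> \<lambda>t. rotation N u t * U"
  shows "((\<lambda>t. power_form (W t) k x y) has_vector_derivative
     \<i> * (\<Sum>l<k. power_form (W t) l u y * power_form (W t) (k - l) x u)) (at t)"
proof (cases "u \<bullet>c u = 0")
  case True
  \<comment> \<open>\<open>rotation_coeff_deriv\<close> divides by |u|^2; for u = 0 both sides
    vanish.\<close>
  then have "\<And>i. i < N \<Longrightarrow> vec_index u i = 0"
    using cscalar_prod_self_real[OF u] by (simp add: sum_nonneg_eq_0_iff del: of_real_sum)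
  then have "z \<bullet>c u = 0" for z
    by (simp add: cscalar_prod_sum[OF u])
  moreover have "(\<lambda>t. power_form (W t) k x y) = (\<lambda>_. power_form (W 0) k x y)"
    by (simp add: W_def rotation_def rotation_coeff_def True)
  ultimately show ?thesis
    by (simp add: power_form_def)
next
  case False
  have c: "U \<in> carrier_mat N N" "mat_adjoint U \<in> carrier_mat N N"
    using U by (auto intro: unitary_mats_carrier mat_adjoint_carrier)
  have step: "power_form (W t) (Suc k) z y = power_form (W t) k z (mat_adjoint U *\<^sub>v y)
     + rotation_coeff u t * (u \<bullet>c y) * power_form (W t) k z (mat_adjoint U *\<^sub>v u)"
    if "y \<in> carrier_vec N" "z \<in> carrier_vec N" for k z y t
    unfolding W_def rotation_def using c u that by (intro power_form_rank_one_pert_Suc)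
  show ?thesis
    using y
  proof (induction k arbitrary: y)
    case 0
    then show ?case by (simp add: power_form_def)
  next
    case (Suc k)
    let ?Uy = "mat_adjoint U *\<^sub>v y" and ?Uu = "mat_adjoint U *\<^sub>v u" and ?b = "rotation_coeff u t"
    let ?q = "power_form (W t)"
    have cUy: "?Uy \<in> carrier_vec N" "?Uu \<in> carrier_vec N"
      using mult_mat_vec_carrier[OF c(2)] u Suc.prems by auto
    have "((\<lambda>t. power_form (W t) k x ?Uy + rotation_coeff u t * (u \<bullet>c y) * power_form (W t) k x ?Uu)
      has_vector_derivative
      \<i> * (\<Sum>l<k. ?q l u ?Uy * ?q (k - l) x u)
      + (?b * (u \<bullet>c y) * (\<i> * (\<Sum>l<k. ?q l u ?Uu * ?q (k - l) x u))
         + \<i> * (1 + ?b * (u \<bullet>c u)) * (u \<bullet>c y) * ?q k x ?Uu)) (at t)"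
      by (intro has_vector_derivative_add has_vector_derivative_mult Suc.IH cUy
          has_vector_derivative_mult_left rotation_coeff_deriv False)
    moreover have "\<i> * (\<Sum>l<k. ?q l u ?Uy * ?q (k - l) x u)
      + (?b * (u \<bullet>c y) * (\<i> * (\<Sum>l<k. ?q l u ?Uu * ?q (k - l) x u))
         + \<i> * (1 + ?b * (u \<bullet>c u)) * (u \<bullet>c y) * ?q k x ?Uu)
       = \<i> * ((\<Sum>l<k. (?q l u ?Uy + ?b * (u \<bullet>c y) * ?q l u ?Uu) * ?q (k - l) x u)
         + (u \<bullet>c y) * (?q k x ?Uu + ?b * (u \<bullet>c u) * ?q k x ?Uu))"
      by (simp add: algebra_simps sum.distrib sum_distrib_left)
    \<comment> \<open>The recursion \<open>step\<close> is read backwards, at z = u inside the sum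
      and at z = x for the remaining pair, which becomes the term l = 0.\<close>
    also have "\<dots> = \<i> * ((\<Sum>l<k. ?q (Suc l) u y * ?q (k - l) x u) + ?q 0 u y * ?q (Suc k) x u)"
      using u x Suc.prems by (simp add: step power_form_0)
    also have "\<dots> = \<i> * (\<Sum>l<Suc k. ?q l u y * ?q (Suc k - l) x u)"
      by (subst sum.lessThan_Suc_shift) simp
    ultimately show ?case
      using Suc.prems x by (simp only: step)
  qed
qed

lemma cscalar_prod_Cauchy_Schwarz:
  fixes x y :: "complex vec"
  assumes "x \<in> carrier_vec N" "y \<in> carrier_vec N"
  shows "cmod (x \<bullet>c y) \<le> sqrt (Re (x \<bullet>c x)) * sqrt (Re (y \<bullet>c y))"
proof -
  have "cmod (x \<bullet>c y) \<le> (\<Sum>i<N. \<bar>cmod (vec_index x i)\<bar> * \<bar>cmod (vec_index y i)\<bar>)"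
    unfolding cscalar_prod_sum[OF assms(2)] by (rule norm_sum[THEN order_trans]) (simp add: norm_mult)
  also have "\<dots> \<le> L2_set (\<lambda>i. cmod (vec_index x i)) {..<N} * L2_set (\<lambda>i. cmod (vec_index y i)) {..<N}"
    by (rule L2_set_mult_ineq)
  finally show ?thesis
    by (simp add: L2_set_def cscalar_prod_self_real[OF assms(1)] cscalar_prod_self_real[OF assms(2)] del: of_real_sum of_real_power)
qed

lemma power_form_bound:
  assumes "U \<in> unitary_mats N" "x \<in> carrier_vec N" "y \<in> carrier_vec N"
  shows "cmod (power_form U k x y) \<le> sqrt (Re (x \<bullet>c x)) * sqrt (Re (y \<bullet>c y))"
  using cscalar_prod_Cauchy_Schwarz[of "krylov U x k" N y] assms
  by (simp add: power_form_def krylov_isometry)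

text \<open>The number \<open>w\<^sub>k\<close> of the overview as a function of a pair (matrix,
  vector): the k-th moment of the spectral measure of the matrix at the vector.\<close>

definition pmoment :: "nat \<Rightarrow> complex mat \<times> complex vec \<Rightarrow> complex" where
  "pmoment k p = power_form (fst p) k (snd p) (snd p)"


subsection \<open>The Schwinger--Dyson equation\<close>

lemma measurable_iexp [measurable]: "(\<lambda>x::real. iexp x) \<in> borel_measurable borel"
  by (intro borel_measurable_continuous_onI continuous_intros)

lemma has_vector_derivative_at_0_quotient:
  assumes "(f has_vector_derivative D) (at 0)"
  shows "((\<lambda>t. (f t - f 0) /\<^sub>R t) \<longlongrightarrow> D) (at 0)"
proof -
  have "((\<lambda>t. norm (f t - f 0 - t *\<^sub>R D) / norm t) \<longlongrightarrow> 0) (at 0)"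
    using assms by (simp add: has_vector_derivative_def has_derivative_iff_norm)
  moreover have "\<forall>\<^sub>F t in at 0. norm (f t - f 0 - t *\<^sub>R D) / norm t = norm ((f t - f 0) /\<^sub>R t - D)"
    unfolding eventually_at_filter
  proof (rule always_eventually, intro allI impI)
    fix t :: real assume "t \<noteq> 0"
    then have "(f t - f 0) /\<^sub>R t - D = (f t - f 0 - t *\<^sub>R D) /\<^sub>R t"
      by (simp add: scaleR_diff_right)
    then show "norm (f t - f 0 - t *\<^sub>R D) / norm t = norm ((f t - f 0) /\<^sub>R t - D)"
      by (simp add: divide_inverse mult.commute)
  qed
  ultimately have "((\<lambda>t. norm ((f t - f 0) /\<^sub>R t - D)) \<longlongrightarrow> 0) (at 0)"
    using tendsto_cong by fast
  then show ?thesis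
    using Lim_null tendsto_norm_zero_iff by blast
qed

section \<open>Random pairs of a unitary matrix and a unit vector\<close>

definition pair_space :: "nat \<Rightarrow> (complex mat \<times> complex vec) measure" where
  "pair_space N = unitary_space N \<Otimes>\<^sub>M sphere_space N"

lemma space_unitary_space [simp]: "space (unitary_space N) = unitary_mats N"
  by (simp add: unitary_space_def)

lemma space_sphere_space [simp]: "space (sphere_space N) = unit_sphere N"
  by (simp add: sphere_space_def)

lemma space_pair_space [simp]: "space (pair_space N) = unitary_mats N \<times> unit_sphere N"
  by (simp add: pair_space_def space_pair_measure)

lemma unit_sphere_carrier: "x \<in> unit_sphere N \<Longrightarrow> x \<in> carrier_vec N"
  by (simp add: unit_sphere_def)

lemma measurable_unitary_space_entry:
  assumes "i < N" "j < N"
  shows "(\<lambda>W. W $$ (i, j)) \<in> borel_measurable (unitary_space N)"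
proof -
  have "(\<lambda>W. restrict (\<lambda>p. W $$ p) ({..<N} \<times> {..<N})) \<in> unitary_space N \<rightarrow>\<^sub>M (\<Pi>\<^sub>M p\<in>{..<N} \<times> {..<N}. borel)"
    unfolding unitary_space_def by (rule measurable_vimage_algebra1) (auto simp: space_PiM)
  from measurable_compose[OF this measurable_component_singleton[of "(i, j)"]] assms
  show ?thesis by simp
qed

lemma measurable_sphere_space_entry:
  assumes "i < N"
  shows "(\<lambda>x. vec_index x i) \<in> borel_measurable (sphere_space N)"
proof -
  have "(\<lambda>x. restrict (\<lambda>i. vec_index x i) {..<N}) \<in> sphere_space N \<rightarrow>\<^sub>M (\<Pi>\<^sub>M i\<in>{..<N}. borel)"
    unfolding sphere_space_def by (rule measurable_vimage_algebra1) (auto simp: space_PiM)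
  from measurable_compose[OF this measurable_component_singleton[of i]] assms
  show ?thesis by simp
qed

lemma measurable_unitary_spaceI:
  assumes "\<And>\<omega>. \<omega> \<in> space M \<Longrightarrow> f \<omega> \<in> unitary_mats N"
    and "\<And>i j. i < N \<Longrightarrow> j < N \<Longrightarrow> (\<lambda>\<omega>. f \<omega> $$ (i, j)) \<in> borel_measurable M"
  shows "f \<in> M \<rightarrow>\<^sub>M unitary_space N"
  unfolding unitary_space_def
  by (rule measurable_vimage_algebra2) (use assms in \<open>auto intro!: measurable_restrict\<close>)

lemma measurable_unitary_mult:
  assumes W: "W \<in> unitary_mats N"
  shows "(\<lambda>V. W * V) \<in> unitary_space N \<rightarrow>\<^sub>M unitary_space N"
proof (rule measurable_unitary_spaceI)
  fix i j assume ij: "i < N" "j < N"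
  have "(\<lambda>V. \<Sum>k<N. W $$ (i, k) * V $$ (k, j)) \<in> borel_measurable (unitary_space N)"
    using ij by (intro borel_measurable_sum borel_measurable_times borel_measurable_const
        measurable_unitary_space_entry) auto
  also have "?this \<longleftrightarrow> (\<lambda>V. (W * V) $$ (i, j)) \<in> borel_measurable (unitary_space N)"
    using ij unitary_mats_carrier[OF W]
    by (intro measurable_cong) (auto simp: scalar_prod_def lessThan_atLeast0 dest!: unitary_mats_carrier)
  finally show "(\<lambda>V. (W * V) $$ (i, j)) \<in> borel_measurable (unitary_space N)" .
qed (use W in \<open>auto intro: unitary_mult\<close>)

lemma measurable_pair_unitary_mult:
  assumes W: "W \<in> unitary_mats N"
  shows "(\<lambda>p. (W * fst p, snd p)) \<in> pair_space N \<rightarrow>\<^sub>M pair_space N"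
  unfolding pair_space_def
  by (intro measurable_Pair measurable_compose[OF measurable_fst measurable_unitary_mult[OF W]] measurable_snd)

text \<open>Covers both the deterministic and the independent random vectors.\<close>

locale invariant_pair = prob_space \<nu> for N :: nat and \<nu> :: "(complex mat \<times> complex vec) measure" +
  assumes sets_eq: "sets \<nu> = sets (pair_space N)"
    and invariant: "\<And>W. W \<in> unitary_mats N \<Longrightarrow> distr \<nu> (pair_space N) (\<lambda>p. (W * fst p, snd p)) = \<nu>"
begin

lemma space_eq: "space \<nu> = unitary_mats N \<times> unit_sphere N"
  using sets_eq_imp_space_eq[OF sets_eq] by simp

text \<open>Power forms of unit vectors are bounded, so nearly all integrands below are; this class
  is closed under the algebraic operations and settles their integrability.\<close>

definition bounded_rv :: "(complex mat \<times> complex vec \<Rightarrow> complex) \<Rightarrow> bool" where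
  "bounded_rv f \<longleftrightarrow> f \<in> borel_measurable \<nu> \<and> (\<exists>C. \<forall>p\<in>space \<nu>. cmod (f p) \<le> C)"

lemma bounded_rv_integrable: "bounded_rv f \<Longrightarrow> integrable \<nu> f"
  unfolding bounded_rv_def by (elim conjE exE, rule integrable_const_bound) (auto intro: AE_I2)

lemma bounded_rv_const [simp]: "bounded_rv (\<lambda>_. c)"
  by (auto simp: bounded_rv_def)

lemma bounded_rv_add: assumes "bounded_rv f" "bounded_rv g" shows "bounded_rv (\<lambda>p. f p + g p)"
proof -
  obtain A B where "\<forall>p\<in>space \<nu>. cmod (f p) \<le> A" "\<forall>p\<in>space \<nu>. cmod (g p) \<le> B"
    using assms by (auto simp: bounded_rv_def)
  then have "\<forall>p\<in>space \<nu>. cmod (f p + g p) \<le> A + B"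
    by (meson add_mono norm_triangle_le)
  then show ?thesis using assms by (auto simp: bounded_rv_def)
qed

lemma bounded_rv_mult: assumes "bounded_rv f" "bounded_rv g" shows "bounded_rv (\<lambda>p. f p * g p)"
proof -
  obtain A B where "\<forall>p\<in>space \<nu>. cmod (f p) \<le> A" "\<forall>p\<in>space \<nu>. cmod (g p) \<le> B"
    using assms by (auto simp: bounded_rv_def)
  then have "\<forall>p\<in>space \<nu>. cmod (f p * g p) \<le> \<bar>A\<bar> * \<bar>B\<bar>"
    by (auto simp: norm_mult intro!: mult_mono intro: order_trans)
  then show ?thesis using assms by (auto simp: bounded_rv_def)
qed

lemma bounded_rv_cnj: "bounded_rv f \<Longrightarrow> bounded_rv (\<lambda>p. cnj (f p))"
  using measurable_compose[of f \<nu> borel cnj borel]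
  by (simp add: bounded_rv_def borel_measurable_continuous_onI continuous_intros)

lemma bounded_rv_minus: "bounded_rv f \<Longrightarrow> bounded_rv (\<lambda>p. - f p)"
  by (auto simp: bounded_rv_def)

lemma bounded_rv_diff: "bounded_rv f \<Longrightarrow> bounded_rv g \<Longrightarrow> bounded_rv (\<lambda>p. f p - g p)"
  using bounded_rv_add[OF _ bounded_rv_minus, of f g] by simp

lemma bounded_rv_sum: "(\<And>i. i \<in> I \<Longrightarrow> bounded_rv (f i)) \<Longrightarrow> bounded_rv (\<lambda>p. \<Sum>i\<in>I. f i p)"
  by (induction I rule: infinite_finite_induct) (auto intro: bounded_rv_add)

text \<open>Measurability is required of the coordinates, as vectors carry no topology; the bound is
  on the squared norm, which \<open>krylov\<close> preserves.\<close>

definition bounded_field :: "(complex mat \<times> complex vec \<Rightarrow> complex vec) \<Rightarrow> bool" where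
  "bounded_field \<xi> \<longleftrightarrow> (\<forall>p\<in>space \<nu>. \<xi> p \<in> carrier_vec N) \<and>
     (\<forall>i<N. (\<lambda>p. vec_index (\<xi> p) i) \<in> borel_measurable \<nu>) \<and>
     (\<exists>C. \<forall>p\<in>space \<nu>. Re (\<xi> p \<bullet>c \<xi> p) \<le> C)"

lemma bounded_field_const: "u \<in> carrier_vec N \<Longrightarrow> bounded_field (\<lambda>_. u)"
  by (auto simp: bounded_field_def)

lemma bounded_field_snd: "bounded_field snd"
  using measurable_sphere_space_entry[of _ N]
  by (auto simp: bounded_field_def space_eq unit_sphere_def measurable_cong_sets[OF sets_eq refl] pair_space_def
      intro!: measurable_compose[OF measurable_snd] exI[of _ 1])

lemma bounded_field_krylov:
  assumes "bounded_field \<xi>"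
  shows "bounded_field (\<lambda>p. krylov (fst p) (\<xi> p) k)"
proof -
  have c: "\<xi> p \<in> carrier_vec N" "fst p \<in> unitary_mats N" "fst p \<in> carrier_mat N N" if "p \<in> space \<nu>" for p
    using assms that by (auto simp: bounded_field_def space_eq unitary_mats_carrier)
  have "\<forall>i<N. (\<lambda>p. vec_index (krylov (fst p) (\<xi> p) k) i) \<in> borel_measurable \<nu>"
  proof (induction k)
    case 0
    then show ?case using assms by (simp add: bounded_field_def)
  next
    case (Suc k)
    show ?case
    proof (intro allI impI)
      fix i assume i: "i < N"
      have "(\<lambda>p. fst p $$ (i, j)) \<in> borel_measurable \<nu>" if "j < N" for j
        unfolding measurable_cong_sets[OF sets_eq refl] pair_space_def
        by (intro measurable_compose[OF measurable_fst] measurable_unitary_space_entry i that)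
      then have "(\<lambda>p. \<Sum>j<N. fst p $$ (i, j) * vec_index (krylov (fst p) (\<xi> p) k) j) \<in> borel_measurable \<nu>"
        using Suc by (intro borel_measurable_sum borel_measurable_times) simp_all
      also have "?this \<longleftrightarrow> (\<lambda>p. vec_index (krylov (fst p) (\<xi> p) (Suc k)) i) \<in> borel_measurable \<nu>"
        using i c by (intro measurable_cong) (simp add: krylov_Suc mult_mat_vec_sum[of _ N N] del: index_mult_mat_vec)
      finally show "(\<lambda>p. vec_index (krylov (fst p) (\<xi> p) (Suc k)) i) \<in> borel_measurable \<nu>" .
    qed
  qed
  moreover obtain C where "\<forall>p\<in>space \<nu>. Re (\<xi> p \<bullet>c \<xi> p) \<le> C"
    using assms by (auto simp: bounded_field_def)
  then have "\<forall>p\<in>space \<nu>. Re (krylov (fst p) (\<xi> p) k \<bullet>c krylov (fst p) (\<xi> p) k) \<le> C"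
    by (simp add: krylov_isometry[OF c(2) c(1) c(1)])
  ultimately show ?thesis
    using c unfolding bounded_field_def by (auto intro!: krylov_carrier)
qed

lemma bounded_rv_cscalar_prod:
  assumes "bounded_field \<xi>" "bounded_field \<eta>"
  shows "bounded_rv (\<lambda>p. \<xi> p \<bullet>c \<eta> p)"
proof -
  have c: "\<xi> p \<in> carrier_vec N" "\<eta> p \<in> carrier_vec N" if "p \<in> space \<nu>" for p
    using assms that by (auto simp: bounded_field_def)
  obtain A B where AB: "\<forall>p\<in>space \<nu>. Re (\<xi> p \<bullet>c \<xi> p) \<le> A" "\<forall>p\<in>space \<nu>. Re (\<eta> p \<bullet>c \<eta> p) \<le> B"
    using assms by (auto simp: bounded_field_def)
  have nonneg: "0 \<le> Re (x \<bullet>c x)" if "x \<in> carrier_vec N" for x :: "complex vec"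
    by (simp add: cscalar_prod_self_real[OF that] sum_nonneg del: of_real_sum of_real_power)
  have "cmod (\<xi> p \<bullet>c \<eta> p) \<le> sqrt A * sqrt B" if p: "p \<in> space \<nu>" for p
    using c[OF p] AB p by (intro cscalar_prod_Cauchy_Schwarz[THEN order_trans] mult_mono)
      (auto intro!: nonneg order_trans[OF nonneg])
  moreover have [measurable]: "(\<lambda>p. vec_index (\<xi> p) i) \<in> borel_measurable \<nu>" "(\<lambda>p. vec_index (\<eta> p) i) \<in> borel_measurable \<nu>" if "i < N" for i
    using assms that by (auto simp: bounded_field_def)
  have [measurable]: "cnj \<in> borel_measurable borel"
    by (intro borel_measurable_continuous_onI continuous_intros)
  have "(\<lambda>p. \<Sum>i<N. vec_index (\<xi> p) i * cnj (vec_index (\<eta> p) i)) \<in> borel_measurable \<nu>"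
    by (intro borel_measurable_sum borel_measurable_times) simp_all
  then have "(\<lambda>p. \<xi> p \<bullet>c \<eta> p) \<in> borel_measurable \<nu>"
    by (subst measurable_cong[where g="\<lambda>p. \<Sum>i<N. vec_index (\<xi> p) i * cnj (vec_index (\<eta> p) i)"])
      (auto simp: cscalar_prod_sum[of _ N] c)
  ultimately show ?thesis unfolding bounded_rv_def by blast
qed

lemma bounded_rv_power_form:
  "bounded_field \<xi> \<Longrightarrow> bounded_field \<eta> \<Longrightarrow> bounded_rv (\<lambda>p. power_form (fst p) k (\<xi> p) (\<eta> p))"
  unfolding power_form_def by (intro bounded_rv_cscalar_prod bounded_field_krylov)

lemmas bounded_rv_intros = bounded_rv_const bounded_rv_add bounded_rv_mult bounded_rv_cnj bounded_rv_minus
  bounded_rv_diff bounded_rv_sum bounded_rv_power_form bounded_field_const bounded_field_snd bounded_rv_cscalar_prod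
  bounded_field_krylov

lemma integral_invariant:
  assumes "W \<in> unitary_mats N" "f \<in> borel_measurable \<nu>"
  shows "(\<integral>p. f (W * fst p, snd p) \<partial>\<nu>) = (\<integral>p. f p \<partial>\<nu> :: complex)"
proof -
  have "(\<integral>p. f p \<partial>\<nu>) = (\<integral>p. f p \<partial>distr \<nu> (pair_space N) (\<lambda>p. (W * fst p, snd p)))"
    using invariant[OF assms(1)] by simp
  also have "\<dots> = (\<integral>p. f (W * fst p, snd p) \<partial>\<nu>)"
    using assms(2) measurable_pair_unitary_mult[OF assms(1)]
    by (intro integral_distr) (simp_all add: measurable_cong_sets[OF sets_eq refl])
  finally show ?thesis by simp
qed

text \<open>By invariance the mean of F along the rotation does not depend on t, so its derivative
  at 0 vanishes. Differentiation under the integral is by dominated convergence: the derivative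
  formula holds along the whole orbit, so the mean value inequality bounds all difference quotients
  by the supremum of |D|.\<close>

lemma integral_rotation_derivative:
  assumes u: "u \<in> carrier_vec N" and F: "bounded_rv F" and D: "bounded_rv D"
    and deriv: "\<And>p t. p \<in> space \<nu> \<Longrightarrow>
      ((\<lambda>t. F (rotation N u t * fst p, snd p)) has_vector_derivative D (rotation N u t * fst p, snd p)) (at t)"
  shows "(\<integral>p. D p \<partial>\<nu>) = 0"
proof -
  obtain C where C: "\<And>p. p \<in> space \<nu> \<Longrightarrow> cmod (D p) \<le> C"
    using D by (auto simp: bounded_rv_def)
  define G where "G t p = F (rotation N u t * fst p, snd p)" for t p
  have rot0: "rotation N u 0 * V = V" if "V \<in> carrier_mat N N" for V
  proof -
    have "0 \<cdot>\<^sub>m outer_self N u = 0\<^sub>m N N"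
      by (intro eq_matI) (auto simp: outer_self_def)
    then have "rotation N u 0 = 1\<^sub>m N"
      by (simp add: rotation_def rotation_coeff_def rank_one_pert_def)
    then show ?thesis using that by simp
  qed
  have spc: "(rotation N u t * fst p, snd p) \<in> space \<nu>" if "p \<in> space \<nu>" for p t
    using that rotation_unitary[OF u] by (auto simp: space_eq intro: unitary_mult)
  have G0: "G 0 p = F p" if "p \<in> space \<nu>" for p
    using that by (auto simp: G_def rot0 space_eq unitary_mats_carrier)
  have Gm: "G t \<in> borel_measurable \<nu>" for t
    unfolding G_def using F measurable_pair_unitary_mult[OF rotation_unitary[OF u]]
    by (auto simp: bounded_rv_def measurable_cong_sets[OF sets_eq refl] intro: measurable_compose)
  have Gi: "integrable \<nu> (G t)" for t
  proof -
    obtain B where "\<And>p. p \<in> space \<nu> \<Longrightarrow> cmod (F p) \<le> B"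
      using F by (auto simp: bounded_rv_def)
    then show ?thesis
      using Gm spc by (intro integrable_const_bound[of _ B]) (auto simp: G_def intro!: AE_I2)
  qed
  have int: "integral\<^sup>L \<nu> (G t) = integral\<^sup>L \<nu> F" for t
    unfolding G_def using F by (intro integral_invariant rotation_unitary u) (auto simp: bounded_rv_def)
  define h where "h n = 1 / real (Suc n)" for n
  have h: "h n > 0" for n by (simp add: h_def)
  define Q where "Q n p = (G (h n) p - G 0 p) / of_real (h n)" for n p
  have "(\<lambda>n. integral\<^sup>L \<nu> (Q n)) \<longlonglongrightarrow> (\<integral>p. D p \<partial>\<nu>)"
  proof (rule integral_dominated_convergence[where w="\<lambda>_. C"])
    show "D \<in> borel_measurable \<nu>" using D by (simp add: bounded_rv_def)
    show "Q n \<in> borel_measurable \<nu>" for n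
      unfolding Q_def using Gm by simp
    show "AE p in \<nu>. (\<lambda>n. Q n p) \<longlonglongrightarrow> D p"
    proof (rule AE_I2)
      fix p assume p: "p \<in> space \<nu>"
      have "((\<lambda>t. G t p) has_vector_derivative D p) (at 0)"
        using deriv[OF p, of 0] p by (auto simp: G_def rot0 space_eq unitary_mats_carrier)
      then have "((\<lambda>t. (G t p - G 0 p) /\<^sub>R t) \<longlongrightarrow> D p) (at 0)"
        by (rule has_vector_derivative_at_0_quotient)
      moreover have "filterlim h (at 0) sequentially"
        unfolding h_def by (rule filterlim_atI) (use LIMSEQ_inverse_real_of_nat in \<open>auto simp: field_simps\<close>)
      ultimately have "(\<lambda>n. (G (h n) p - G 0 p) /\<^sub>R h n) \<longlonglongrightarrow> D p"
        by (rule filterlim_compose)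
      then show "(\<lambda>n. Q n p) \<longlonglongrightarrow> D p"
        by (simp add: Q_def scaleR_conv_of_real field_simps)
    qed
    show "AE p in \<nu>. norm (Q n p) \<le> C" for n
    proof (rule AE_I2)
      fix p assume p: "p \<in> space \<nu>"
      have "norm (G (h n) p - G 0 p) \<le> C * norm (h n - 0)"
      proof (rule differentiable_bound[where S=UNIV])
        fix t :: real
        show "((\<lambda>t. G t p) has_derivative (\<lambda>s. s *\<^sub>R D (rotation N u t * fst p, snd p))) (at t within UNIV)"
          using deriv[OF p] by (simp add: G_def has_vector_derivative_def)
        show "onorm (\<lambda>s. s *\<^sub>R D (rotation N u t * fst p, snd p)) \<le> C"
          using C[OF spc[OF p]] by (intro onorm_bound) (auto simp: mult.commute[of C] intro!: mult_left_mono intro: order_trans[OF norm_ge_zero])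
      qed auto
      then show "norm (Q n p) \<le> C"
        using h[of n] by (simp add: Q_def norm_divide field_simps)
    qed
  qed simp
  moreover have "integral\<^sup>L \<nu> (Q n) = 0" for n
    unfolding Q_def using Gi by (simp add: int)
  ultimately show ?thesis
    by (simp add: LIMSEQ_const_iff)
qed

end

text \<open>The weights are the fourth roots of unity a: the sums of a and of a^2 vanish and |a| =
  1, so only the \<open>B x y\<close> term of the expansion survives.\<close>

lemma polarization:
  fixes B :: "complex vec \<Rightarrow> complex vec \<Rightarrow> complex"
  assumes left: "\<And>a z. z \<in> carrier_vec N \<Longrightarrow> B (x + a \<cdot>\<^sub>v y) z = B x z + a * B y z"
    and right: "\<And>a z. z \<in> carrier_vec N \<Longrightarrow> B z (x + a \<cdot>\<^sub>v y) = B z x + cnj a * B z y"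
    and x: "x \<in> carrier_vec N" and y: "y \<in> carrier_vec N"
  shows "B x y = (\<Sum>a\<in>{1, \<i>, -1, -\<i>}. a * B (x + a \<cdot>\<^sub>v y) (x + a \<cdot>\<^sub>v y)) / 4"
proof -
  have "B (x + a \<cdot>\<^sub>v y) (x + a \<cdot>\<^sub>v y) = B x x + cnj a * B x y + a * (B y x + cnj a * B y y)" for a
    using x y by (subst left) (simp_all add: right)
  then have "(\<Sum>a\<in>{1, \<i>, -1, -\<i>}. a * B (x + a \<cdot>\<^sub>v y) (x + a \<cdot>\<^sub>v y)) =
      (\<Sum>a\<in>{1, \<i>, -1, -\<i>}. a * (B x x + cnj a * B x y + a * (B y x + cnj a * B y y)))"
    by (simp only:)
  then show ?thesis
    by (simp add: algebra_simps complex_eq_iff)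
qed

lemma unit_vec_carrier_complex [simp]: "(unit_vec N i :: complex vec) \<in> carrier_vec N"
  by simp

lemma cscalar_prod_unit_vec_right:
  assumes "x \<in> carrier_vec N" "i < N"
  shows "x \<bullet>c (unit_vec N i :: complex vec) = vec_index x i"
  using assms by (simp add: cscalar_prod_sum[of _ N] if_distrib if_distribR cong: if_cong)

lemma cscalar_prod_unit_vec_left:
  assumes "x \<in> carrier_vec N" "i < N"
  shows "(unit_vec N i :: complex vec) \<bullet>c x = cnj (vec_index x i)"
  using cnj_cscalar_prod[of x N "unit_vec N i"] cscalar_prod_unit_vec_right[OF assms] assms by simp

lemma power_form_expand_left:
  assumes U: "U \<in> carrier_mat N N" and x: "x \<in> carrier_vec N" and "y \<in> carrier_vec N"
  shows "power_form U k x y = (\<Sum>i<N. vec_index x i * power_form U k (unit_vec N i) y)"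
  using assms(3)
proof (induction k arbitrary: y)
  case 0
  then show ?case
    unfolding power_form_0 by (subst cscalar_prod_sum) (auto simp: cscalar_prod_unit_vec_left)
next
  case (Suc k)
  then show ?case
    using U x mult_mat_vec_carrier[OF mat_adjoint_carrier[OF U] Suc.prems] by (simp add: power_form_Suc_adjoint[of _ N])
qed

lemma sum_swap_inner:
  fixes c :: "'a \<Rightarrow> complex"
  shows "(\<Sum>j\<in>J. c j * (\<Sum>l\<in>L. f l * r l j)) = (\<Sum>l\<in>L. f l * (\<Sum>j\<in>J. c j * r l j))"
  by (simp only: sum_distrib_left, subst sum.swap) (simp only: mult_ac)

text \<open>Pulls a weighted sum through the nested sums that come from the derivative of \<Phi> in
  \<open>schwinger_dyson\<close>; applied there once to the sum over j and once to the sum over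
  i.\<close>

lemma sum_swap_inner_diff:
  fixes c :: "'a \<Rightarrow> complex"
  shows "(\<Sum>j\<in>J. c j * (\<Sum>m\<in>M. g m * (\<Sum>l\<in>L m. f l m * r l m j) - h m * (\<Sum>l\<in>L m. f' l m * s l m j)))
     = (\<Sum>m\<in>M. g m * (\<Sum>l\<in>L m. f l m * (\<Sum>j\<in>J. c j * r l m j)) - h m * (\<Sum>l\<in>L m. f' l m * (\<Sum>j\<in>J. c j * s l m j)))"
proof -
  have "(\<Sum>j\<in>J. c j * (\<Sum>m\<in>M. g m * (\<Sum>l\<in>L m. f l m * r l m j) - h m * (\<Sum>l\<in>L m. f' l m * s l m j)))
     = (\<Sum>m\<in>M. \<Sum>j\<in>J. c j * (g m * (\<Sum>l\<in>L m. f l m * r l m j) - h m * (\<Sum>l\<in>L m. f' l m * s l m j)))"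
    by (simp only: sum_distrib_left, rule sum.swap)
  also have "\<dots> = (\<Sum>m\<in>M. g m * (\<Sum>j\<in>J. c j * (\<Sum>l\<in>L m. f l m * r l m j)) - h m * (\<Sum>j\<in>J. c j * (\<Sum>l\<in>L m. f' l m * s l m j)))"
    by (intro sum.cong refl) (simp add: right_diff_distrib sum_subtractf sum_distrib_left mult_ac)
  finally show ?thesis
    by (simp only: sum_swap_inner[where J=J])
qed

abbreviation rotated :: "nat \<Rightarrow> complex vec \<Rightarrow> real \<Rightarrow> complex mat \<times> complex vec \<Rightarrow> complex mat \<times> complex vec" where
  "rotated N u t p \<equiv> (rotation N u t * fst p, snd p)"

definition pmoment_deriv :: "nat \<Rightarrow> complex vec \<Rightarrow> complex mat \<times> complex vec \<Rightarrow> complex" where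
  "pmoment_deriv m u p = \<i> * (\<Sum>l<m. power_form (fst p) l u (snd p) * power_form (fst p) (m - l) (snd p) u)"

definition trace_power :: "nat \<Rightarrow> nat \<Rightarrow> complex mat \<times> complex vec \<Rightarrow> complex" where
  "trace_power N k p = (\<Sum>i<N. power_form (fst p) k (unit_vec N i) (unit_vec N i))"

text \<open>Stands for the moment of order k - m, which may be negative: see \<open>gram_ge\<close>
  and \<open>gram_le\<close>.\<close>

definition gram :: "nat \<Rightarrow> nat \<Rightarrow> complex mat \<times> complex vec \<Rightarrow> complex" where
  "gram k m p = krylov (fst p) (snd p) k \<bullet>c krylov (fst p) (snd p) m"

context invariant_pair
begin

lemma bounded_rv_pmoment: "bounded_rv (pmoment k)"
  unfolding pmoment_def by (intro bounded_rv_intros)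

lemma bounded_rv_gram: "bounded_rv (gram k m)"
  unfolding gram_def by (intro bounded_rv_intros)

lemma bounded_rv_trace_power: "bounded_rv (trace_power N k)"
  unfolding trace_power_def by (intro bounded_rv_intros unit_vec_carrier_complex)

lemma bounded_rv_entry: "i < N \<Longrightarrow> bounded_rv (\<lambda>p. vec_index (snd p) i)"
proof -
  assume i: "i < N"
  have "bounded_rv (\<lambda>p. snd p \<bullet>c unit_vec N i)"
    by (intro bounded_rv_intros unit_vec_carrier_complex)
  moreover have "snd p \<bullet>c unit_vec N i = vec_index (snd p) i" if "p \<in> space \<nu>" for p
    using i that by (simp add: cscalar_prod_unit_vec_right space_eq unit_sphere_carrier mem_Times_iff)
  ultimately show ?thesis
    unfolding bounded_rv_def by (metis (mono_tags, lifting) measurable_cong)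
qed

text \<open>For \<open>F\<^sub>i\<^sub>j = (V\<^sup>k x)\<^sub>i cnj x\<^sub>j \<Phi>\<close> the derivative along the rotation generated by \<open>\<i> u u\<^sup>*\<close> is
  \<open>\<i> B\<^sub>i\<^sub>j(u, u)\<close> with \<open>B\<^sub>i\<^sub>j\<close> sesquilinear, because \<open>V\<^sup>*\<close> may be differentiated as \<open>V\<^sup>-\<^sup>1\<close>.  By
  polarization the means of \<open>B\<^sub>i\<^sub>j(e\<^sub>i, e\<^sub>j)\<close> vanish, and the equation is their sum over \<open>i, j\<close>.\<close>

theorem schwinger_dyson:
  assumes \<Phi>: "bounded_rv \<Phi>" and g: "\<And>m. m < n \<Longrightarrow> bounded_rv (g m)"
    and h: "\<And>m. m < n \<Longrightarrow> bounded_rv (h m)"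
    and deriv: "\<And>u p t. u \<in> carrier_vec N \<Longrightarrow> p \<in> space \<nu> \<Longrightarrow>
      ((\<lambda>t. \<Phi> (rotated N u t p)) has_vector_derivative
        (\<Sum>m<n. g m (rotated N u t p) * pmoment_deriv m u (rotated N u t p)
           + h m (rotated N u t p) * cnj (pmoment_deriv m u (rotated N u t p)))) (at t)"
  shows "(\<integral>p. (\<Sum>l<k. trace_power N l p * pmoment (k - l) p) * \<Phi> p \<partial>\<nu>)
    = (\<integral>p. (\<Sum>m<n. h m p * (\<Sum>l<m. cnj (pmoment l p) * gram k (m - l) p)
              - g m p * (\<Sum>l<m. pmoment (l + k) p * pmoment (m - l) p)) \<partial>\<nu>)"
proof -
  let ?e = "\<lambda>i. unit_vec N i :: complex vec"
  define P where "P p l x y = power_form (fst p) l x y" for p :: "complex mat \<times> complex vec" and l x y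
  \<comment> \<open>The derivative along u, split into a form linear in y and conjugate-linear in z,
    with u in both places. In the terms with h, which come from the conjugate derivative,
    conjugation exchanges the two slots, and the minus sign comes from conjugating
    \<open>\<i>\<close>.\<close>
  define B where "B i j p y z =
      (\<Sum>l<k. P p l y (?e i) * P p (k - l) (snd p) z) * cnj (vec_index (snd p) j) * \<Phi> p
    + P p k (snd p) (?e i) * cnj (vec_index (snd p) j) *
       (\<Sum>m<n. g m p * (\<Sum>l<m. P p l y (snd p) * P p (m - l) (snd p) z)
             - h m p * (\<Sum>l<m. cnj (P p (m - l) (snd p) y) * cnj (P p l z (snd p))))" for i j p y z
  have Bb: "bounded_rv (\<lambda>p. B i j p y z)" if "i < N" "j < N" "y \<in> carrier_vec N" "z \<in> carrier_vec N" for i j y z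
    unfolding B_def P_def using that by (intro bounded_rv_intros bounded_rv_entry \<Phi> g h) auto
  have factor: "A * (c * S) + \<i> * T * (c * X) = \<i> * (T * c * X + A * c * S')" if "S = \<i> * S'" for A c S T X S' :: complex
    using that by (simp add: algebra_simps)
  have factor3: "G * (\<i> * S) + H * - (\<i> * T) = \<i> * (G * S - H * T)" for G H S T :: complex
    by (simp add: algebra_simps)
  have cnj_i_sum: "cnj (\<i> * (\<Sum>l<m. a l * b l)) = - (\<i> * (\<Sum>l<m. cnj (b l) * cnj (a l)))" for m :: nat and a b
    by (simp add: mult.commute)
  have B0: "(\<integral>p. B i j p u u \<partial>\<nu>) = 0" if ij: "i < N" "j < N" and u: "u \<in> carrier_vec N" for i j u
  proof -
    define F where "F p = P p k (snd p) (?e i) * (cnj (vec_index (snd p) j) * \<Phi> p)" for p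
    have "(\<integral>p. \<i> * B i j p u u \<partial>\<nu>) = 0"
    proof (rule integral_rotation_derivative[OF u, of F])
      show "bounded_rv F"
        unfolding F_def P_def using ij by (intro bounded_rv_intros bounded_rv_entry \<Phi>) auto
      show "bounded_rv (\<lambda>p. \<i> * B i j p u u)"
        by (intro bounded_rv_intros Bb ij u)
      fix p t assume p: "p \<in> space \<nu>"
      let ?q = "\<lambda>t. rotated N u t p"
      have c: "fst p \<in> unitary_mats N" "snd p \<in> carrier_vec N"
        using p by (auto simp: space_eq unit_sphere_carrier)
      have "((\<lambda>t. P (?q t) k (snd p) (?e i)) has_vector_derivative
         \<i> * (\<Sum>l<k. P (?q t) l u (?e i) * P (?q t) (k - l) (snd p) u)) (at t)"
        unfolding P_def fst_conv using c u by (intro power_form_rotation_deriv) auto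
      from has_vector_derivative_mult[OF this has_vector_derivative_mult_right[OF deriv[OF u p, of t], of "cnj (vec_index (snd p) j)"]]
      have "((\<lambda>t. F (?q t)) has_vector_derivative
         P (?q t) k (snd p) (?e i) * (cnj (vec_index (snd p) j) *
            (\<Sum>m<n. g m (?q t) * (\<i> * (\<Sum>l<m. P (?q t) l u (snd p) * P (?q t) (m - l) (snd p) u))
                + h m (?q t) * cnj (\<i> * (\<Sum>l<m. P (?q t) l u (snd p) * P (?q t) (m - l) (snd p) u))))
         + \<i> * (\<Sum>l<k. P (?q t) l u (?e i) * P (?q t) (k - l) (snd p) u) * (cnj (vec_index (snd p) j) * \<Phi> (?q t))) (at t)"
        by (simp only: F_def P_def pmoment_deriv_def fst_conv snd_conv)
      also have "P (?q t) k (snd p) (?e i) * (cnj (vec_index (snd p) j) *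
            (\<Sum>m<n. g m (?q t) * (\<i> * (\<Sum>l<m. P (?q t) l u (snd p) * P (?q t) (m - l) (snd p) u))
                + h m (?q t) * cnj (\<i> * (\<Sum>l<m. P (?q t) l u (snd p) * P (?q t) (m - l) (snd p) u))))
         + \<i> * (\<Sum>l<k. P (?q t) l u (?e i) * P (?q t) (k - l) (snd p) u) * (cnj (vec_index (snd p) j) * \<Phi> (?q t))
         = \<i> * B i j (?q t) u u"
        unfolding B_def snd_conv
      proof (rule factor)
        show "(\<Sum>m<n. g m (?q t) * (\<i> * (\<Sum>l<m. P (?q t) l u (snd p) * P (?q t) (m - l) (snd p) u))
                + h m (?q t) * cnj (\<i> * (\<Sum>l<m. P (?q t) l u (snd p) * P (?q t) (m - l) (snd p) u)))
            = \<i> * (\<Sum>m<n. g m (?q t) * (\<Sum>l<m. P (?q t) l u (snd p) * P (?q t) (m - l) (snd p) u)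
             - h m (?q t) * (\<Sum>l<m. cnj (P (?q t) (m - l) (snd p) u) * cnj (P (?q t) l u (snd p))))"
          unfolding cnj_i_sum sum_distrib_left[of \<i> _ "{..<n}"]
          by (intro sum.cong refl factor3)
      qed
      finally show "((\<lambda>t. F (?q t)) has_vector_derivative \<i> * B i j (?q t) u u) (at t)" .
    qed
    then show ?thesis by simp
  qed
  have Bij: "(\<integral>p. B i j p (?e i) (?e j) \<partial>\<nu>) = 0" if ij: "i < N" "j < N" for i j
  proof -
    let ?u = "\<lambda>a. ?e i + a \<cdot>\<^sub>v ?e j"
    have "(\<integral>p. B i j p (?e i) (?e j) \<partial>\<nu>) = (\<integral>p. (\<Sum>a\<in>{1, \<i>, -1, -\<i>}. a * B i j p (?u a) (?u a)) / 4 \<partial>\<nu>)"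
    proof (intro Bochner_Integration.integral_cong refl polarization)
      fix p and a :: complex and z :: "complex vec"
      assume p: "p \<in> space \<nu>" and z: "z \<in> carrier_vec N"
      have c: "fst p \<in> carrier_mat N N" "snd p \<in> carrier_vec N"
        using p by (auto simp: space_eq unit_sphere_carrier unitary_mats_carrier)
      note lin = power_form_add_smult_left[OF c(1)] power_form_add_smult_right[OF c(1)]
      show "B i j p (?u a) z = B i j p (?e i) z + a * B i j p (?e j) z"
        using c z by (simp add: B_def P_def lin ring_distribs sum.distrib sum_subtractf sum_distrib_left sum_distrib_right mult_ac)
      show "B i j p z (?u a) = B i j p z (?e i) + cnj a * B i j p z (?e j)"
        using c z by (simp add: B_def P_def lin ring_distribs sum.distrib sum_subtractf sum_distrib_left sum_distrib_right mult_ac)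
    qed (use ij in auto)
    also have "\<dots> = (\<Sum>a\<in>{1, \<i>, -1, -\<i>}. a * (\<integral>p. B i j p (?u a) (?u a) \<partial>\<nu>)) / 4"
      using ij by (subst integral_divide_zero, subst Bochner_Integration.integral_sum)
        (auto intro!: bounded_rv_integrable bounded_rv_intros Bb)
    also have "\<dots> = 0"
      using ij by (simp add: B0)
    finally show ?thesis .
  qed
  define L where "L p = (\<Sum>l<k. trace_power N l p * pmoment (k - l) p) * \<Phi> p" for p
  define R where "R p = (\<Sum>m<n. h m p * (\<Sum>l<m. cnj (pmoment l p) * gram k (m - l) p)
              - g m p * (\<Sum>l<m. pmoment (l + k) p * pmoment (m - l) p))" for p
  have "0 = (\<Sum>i<N. \<Sum>j<N. \<integral>p. B i j p (?e i) (?e j) \<partial>\<nu>)"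
    by (simp add: Bij)
  also have "\<dots> = (\<integral>p. (\<Sum>i<N. \<Sum>j<N. B i j p (?e i) (?e j)) \<partial>\<nu>)"
    by (subst Bochner_Integration.integral_sum)
      (auto intro!: bounded_rv_integrable bounded_rv_sum Bb sum.cong Bochner_Integration.integral_sum[symmetric])
  also have "\<dots> = (\<integral>p. L p - R p \<partial>\<nu>)"
  proof (intro Bochner_Integration.integral_cong refl)
    fix p assume p: "p \<in> space \<nu>"
    have c: "fst p \<in> carrier_mat N N" "fst p \<in> unitary_mats N" "snd p \<in> carrier_vec N"
      using p by (auto simp: space_eq unit_sphere_carrier unitary_mats_carrier)
    let ?x = "\<lambda>j. vec_index (snd p) j"
    \<comment> \<open>Contraction identities: sums over j against the conjugate coordinates of x,
      and sums over i against the coordinates of V^k x, reassemble the forms at unit vectors into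
      moments.\<close>
    have a: "(\<Sum>j<N. cnj (?x j) * P p l (snd p) (?e j)) = pmoment l p" for l
      using c by (simp add: P_def pmoment_def power_form_def cscalar_prod_unit_vec_right cscalar_prod_sum mult.commute)
    have b: "(\<Sum>i<N. P p k (snd p) (?e i) * P p l (?e i) (snd p)) = pmoment (l + k) p" for l
    proof -
      have "pmoment (l + k) p = power_form (fst p) l (krylov (fst p) (snd p) k) (snd p)"
        by (simp add: pmoment_def power_form_def krylov_krylov)
      also have "\<dots> = (\<Sum>i<N. P p k (snd p) (?e i) * P p l (?e i) (snd p))"
        using c by (subst power_form_expand_left[of _ N]) (simp_all add: P_def power_form_def cscalar_prod_unit_vec_right)
      finally show ?thesis by simp
    qed
    have d: "(\<Sum>i<N. P p k (snd p) (?e i) * cnj (P p l (snd p) (?e i))) = gram k l p" for l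
    proof -
      have "gram k l p = (\<Sum>i<N. vec_index (krylov (fst p) (snd p) k) i * cnj (vec_index (krylov (fst p) (snd p) l) i))"
        using c by (simp add: gram_def cscalar_prod_sum[of _ N])
      also have "\<dots> = (\<Sum>i<N. P p k (snd p) (?e i) * cnj (P p l (snd p) (?e i)))"
        using c by (intro sum.cong refl) (simp add: P_def power_form_def cscalar_prod_unit_vec_right[of _ N])
      finally show ?thesis by simp
    qed
    have e: "(\<Sum>j<N. cnj (?x j) * cnj (P p l (?e j) (snd p))) = cnj (pmoment l p)" for l
      unfolding pmoment_def P_def using c by (subst power_form_expand_left[of _ N]) simp_all
    have factor2: "(\<Sum>j<N. X j * c j * f + A * c j * Y j) = (\<Sum>j<N. c j * X j) * f + A * (\<Sum>j<N. c j * Y j)"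
      for X Y c and f A :: complex
      by (simp add: sum.distrib sum_distrib_left sum_distrib_right mult_ac)
    let ?G = "\<lambda>i. \<Sum>m<n. g m p * (\<Sum>l<m. P p l (?e i) (snd p) * pmoment (m - l) p)
             - h m p * (\<Sum>l<m. cnj (P p (m - l) (snd p) (?e i)) * cnj (pmoment l p))"
    have "(\<Sum>i<N. \<Sum>j<N. B i j p (?e i) (?e j)) =
      (\<Sum>i<N. (\<Sum>j<N. cnj (?x j) * (\<Sum>l<k. P p l (?e i) (?e i) * P p (k - l) (snd p) (?e j))) * \<Phi> p
         + P p k (snd p) (?e i) * (\<Sum>j<N. cnj (?x j) *
             (\<Sum>m<n. g m p * (\<Sum>l<m. P p l (?e i) (snd p) * P p (m - l) (snd p) (?e j))
             - h m p * (\<Sum>l<m. cnj (P p (m - l) (snd p) (?e i)) * cnj (P p l (?e j) (snd p))))))"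
      unfolding B_def factor2 by (rule refl)
    also have "\<dots> = (\<Sum>i<N. (\<Sum>l<k. P p l (?e i) (?e i) * pmoment (k - l) p) * \<Phi> p + P p k (snd p) (?e i) * ?G i)"
      by (simp only: sum_swap_inner[where J="{..<N}"] sum_swap_inner_diff[where J="{..<N}"] a e)
    also have "\<dots> = (\<Sum>i<N. 1 * (\<Sum>l<k. pmoment (k - l) p * P p l (?e i) (?e i))) * \<Phi> p
        + (\<Sum>i<N. P p k (snd p) (?e i) * (\<Sum>m<n. g m p * (\<Sum>l<m. pmoment (m - l) p * P p l (?e i) (snd p))
             - h m p * (\<Sum>l<m. cnj (pmoment l p) * cnj (P p (m - l) (snd p) (?e i)))))"
      by (simp only: sum.distrib sum_distrib_right mult_1_left) (simp only: mult.commute)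
    also have "\<dots> = L p - R p"
      by (simp only: sum_swap_inner[where J="{..<N}"] sum_swap_inner_diff[where J="{..<N}"] b d)
        (simp add: L_def R_def trace_power_def P_def sum_subtractf mult.commute)
    finally show "(\<Sum>i<N. \<Sum>j<N. B i j p (?e i) (?e j)) = L p - R p" .
  qed
  also have "\<dots> = (\<integral>p. L p \<partial>\<nu>) - (\<integral>p. R p \<partial>\<nu>)"
    unfolding L_def R_def
    by (intro Bochner_Integration.integral_diff bounded_rv_integrable bounded_rv_intros bounded_rv_trace_power
        bounded_rv_pmoment bounded_rv_gram \<Phi> g h) auto
  finally show ?thesis
    by (simp add: L_def R_def)
qed

end


subsection \<open>Bounds and the central limit theorem for the moments\<close>

lemma gram_ge:
  assumes "p \<in> unitary_mats N \<times> unit_sphere N" "m \<le> k"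
  shows "gram k m p = pmoment (k - m) p"
proof -
  have "gram k m p = krylov (fst p) (krylov (fst p) (snd p) (k - m)) m \<bullet>c krylov (fst p) (snd p) m"
    using assms by (simp add: gram_def krylov_krylov)
  then show ?thesis
    using assms by (auto simp: krylov_isometry unit_sphere_carrier pmoment_def power_form_def)
qed

lemma gram_le:
  assumes "p \<in> unitary_mats N \<times> unit_sphere N" "k \<le> m"
  shows "gram k m p = cnj (pmoment (m - k) p)"
proof -
  have "krylov (fst p) (snd p) k \<in> carrier_vec N" "krylov (fst p) (snd p) m \<in> carrier_vec N"
    using assms(1) by (auto simp: unit_sphere_carrier)
  then have "gram k m p = cnj (gram m k p)"
    by (simp add: gram_def cnj_cscalar_prod[of _ N])
  then show ?thesis
    by (simp add: gram_ge[OF assms])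
qed

lemma pmoment_le_1: "p \<in> unitary_mats N \<times> unit_sphere N \<Longrightarrow> cmod (pmoment k p) \<le> 1"
  using power_form_bound[of "fst p" N "snd p" "snd p" k] by (auto simp: pmoment_def unit_sphere_def)

lemma pmoment_0: "p \<in> unitary_mats N \<times> unit_sphere N \<Longrightarrow> pmoment 0 p = 1"
  by (auto simp: pmoment_def power_form_def unit_sphere_def)

lemma gram_le_1: "p \<in> unitary_mats N \<times> unit_sphere N \<Longrightarrow> cmod (gram k m p) \<le> 1"
  by (cases "k \<le> m") (simp_all add: gram_le gram_ge pmoment_le_1)

text \<open>With \<open>p\<^sub>b = V p\<^sub>b\<^sub>-\<^sub>1 + y\<^sub>b e\<close>, unitarity gives
  \<open>2 Re \<langle>p\<^sub>b, y\<^sub>b e\<rangle> = |p\<^sub>b|\<^sup>2 - |p\<^sub>b\<^sub>-\<^sub>1|\<^sup>2 + |y\<^sub>b|\<^sup>2\<close>, which telescopes.\<close>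

lemma toeplitz_positivity:
  fixes y :: "nat \<Rightarrow> complex"
  assumes V: "V \<in> unitary_mats N" and e: "e \<in> unit_sphere N"
  shows "(\<Sum>b<n. (cmod (y (Suc b)))\<^sup>2)
    \<le> 2 * Re (\<Sum>b<n. (\<Sum>l<Suc b. power_form V l e e * y (Suc b - l)) * cnj (y (Suc b)))"
proof -
  have c: "V \<in> carrier_mat N N" "e \<in> carrier_vec N" "e \<bullet>c e = 1" "mat_adjoint V \<in> carrier_mat N N"
    using V e by (auto simp: unit_sphere_def unitary_mats_carrier intro!: mat_adjoint_carrier)
  define q where "q = rec_nat (0\<^sub>v N) (\<lambda>b z. V *\<^sub>v z + y (Suc b) \<cdot>\<^sub>v e)"
  have q0: "q 0 = 0\<^sub>v N" and qS: "q (Suc b) = V *\<^sub>v q b + y (Suc b) \<cdot>\<^sub>v e" for b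
    by (simp_all add: q_def)
  have qc: "q b \<in> carrier_vec N" for b
    by (induction b) (use c in \<open>auto simp: q0 qS\<close>)
  have Vqc: "V *\<^sub>v q b \<in> carrier_vec N" for b
    using c qc by auto
  \<comment> \<open>So \<open>q b\<close> is the sum of the vectors y_{b-l} V^l e over l < b, and at
    z = e the pairing is the inner sum of the claim.\<close>
  have qe: "q b \<bullet>c z = (\<Sum>l<b. power_form V l e z * y (b - l))" if "z \<in> carrier_vec N" for b z
    using that
  proof (induction b arbitrary: z)
    case 0
    then show ?case by (simp add: q0 cscalar_prod_sum[of _ N])
  next
    case (Suc b)
    have z': "mat_adjoint V *\<^sub>v z \<in> carrier_vec N"
      using mult_mat_vec_carrier[OF c(4) Suc.prems] .
    have "q (Suc b) \<bullet>c z = q b \<bullet>c (mat_adjoint V *\<^sub>v z) + y (Suc b) * (e \<bullet>c z)"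
      using c Suc.prems qc Vqc by (simp add: qS cscalar_prod_add_left[of _ N] cscalar_prod_smult_left[of _ N] cscalar_prod_adjoint[of _ N])
    also have "\<dots> = (\<Sum>l<Suc b. power_form V l e z * y (Suc b - l))"
      using c Suc.prems by (subst sum.lessThan_Suc_shift) (simp add: Suc.IH[OF z'] power_form_Suc_adjoint[of _ N] power_form_0)
    finally show ?case .
  qed
  have step: "2 * Re ((q (Suc b) \<bullet>c e) * cnj (y (Suc b)))
     = Re (q (Suc b) \<bullet>c q (Suc b)) - Re (q b \<bullet>c q b) + (cmod (y (Suc b)))\<^sup>2" for b
  proof -
    let ?s = "V *\<^sub>v q b" and ?r = "y (Suc b) \<cdot>\<^sub>v e"
    have r: "?r \<in> carrier_vec N" using c by simp
    have "q (Suc b) \<bullet>c q (Suc b) = ?s \<bullet>c ?s + ?s \<bullet>c ?r + cnj (?s \<bullet>c ?r) + ?r \<bullet>c ?r"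
      using r Vqc by (simp add: qS cscalar_prod_add_left[of _ N] cscalar_prod_add_right[of _ N] cnj_cscalar_prod[of _ N])
    moreover have "?s \<bullet>c ?s = q b \<bullet>c q b"
      by (rule unitary_cscalar_prod[OF V qc qc])
    moreover have "?r \<bullet>c ?r = of_real ((cmod (y (Suc b)))\<^sup>2)"
      using c by (simp add: cscalar_prod_smult_left[of _ N] cscalar_prod_smult_right[of _ N] complex_norm_square mult.commute del: of_real_power)
    moreover have "(q (Suc b) \<bullet>c e) * cnj (y (Suc b)) = ?s \<bullet>c ?r + ?r \<bullet>c ?r"
      using c Vqc r by (simp add: qS cscalar_prod_add_left[of _ N] cscalar_prod_smult_right[of _ N] algebra_simps)
    ultimately show ?thesis by simp
  qed
  have "2 * Re (\<Sum>b<n. (\<Sum>l<Suc b. power_form V l e e * y (Suc b - l)) * cnj (y (Suc b)))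
      = (\<Sum>b<n. 2 * Re ((q (Suc b) \<bullet>c e) * cnj (y (Suc b))))"
    using c by (simp only: qe Re_sum sum_distrib_left)
  also have "\<dots> = (\<Sum>b<n. Re (q (Suc b) \<bullet>c q (Suc b)) - Re (q b \<bullet>c q b)) + (\<Sum>b<n. (cmod (y (Suc b)))\<^sup>2)"
    by (simp only: step sum.distrib)
  also have "\<dots> = Re (q n \<bullet>c q n) + (\<Sum>b<n. (cmod (y (Suc b)))\<^sup>2)"
    by (subst sum_lessThan_telescope) (simp add: q0 cscalar_prod_sum[of _ N])
  finally show ?thesis
    by (simp add: cscalar_prod_self_real[OF qc] sum_nonneg del: of_real_sum of_real_power)
qed

section \<open>Second moment bounds\<close>

context invariant_pair
begin

lemma space_in: "p \<in> space \<nu> \<Longrightarrow> p \<in> unitary_mats N \<times> unit_sphere N"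
  by (simp add: space_eq)

lemma rotated_pmoment_deriv:
  assumes "u \<in> carrier_vec N" "p \<in> space \<nu>"
  shows "((\<lambda>t. pmoment k (rotated N u t p)) has_vector_derivative pmoment_deriv k u (rotated N u t p)) (at t)"
  using power_form_rotation_deriv[of "fst p" N "snd p" "snd p" u k t] assms
  by (auto simp: pmoment_def pmoment_deriv_def space_eq unit_sphere_carrier)

lemma integrable_pmoment_square: "integrable \<nu> (\<lambda>p. (cmod (pmoment k p))\<^sup>2)"
  using bounded_rv_pmoment[of k] by (intro integrable_const_bound[of _ 1])
   (auto simp: bounded_rv_def dest!: space_in intro!: AE_I2 power_le_one pmoment_le_1)

text \<open>For \<Phi> = cnj w_k only the conjugate derivative with m = k occurs, and
  \<open>gram k (k - l)\<close> is w_l; so each summand on the right is exactly |w_l|^2.\<close>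

lemma pmoment_square_recursion:
  "(\<integral>p. (\<Sum>l<k. trace_power N l p * pmoment (k - l) p) * cnj (pmoment k p) \<partial>\<nu>)
   = of_real (\<Sum>l<k. \<integral>p. (cmod (pmoment l p))\<^sup>2 \<partial>\<nu>)"
proof -
  have "(\<integral>p. (\<Sum>l<k. trace_power N l p * pmoment (k - l) p) * cnj (pmoment k p) \<partial>\<nu>)
    = (\<integral>p. (\<Sum>m<Suc k. (if m = k then 1 else 0) * (\<Sum>l<m. cnj (pmoment l p) * gram k (m - l) p)
              - 0 * (\<Sum>l<m. pmoment (l + k) p * pmoment (m - l) p)) \<partial>\<nu>)"
    by (rule schwinger_dyson, goal_cases)
      (auto intro!: bounded_rv_intros bounded_rv_pmoment has_vector_derivative_cnj[THEN has_vector_derivative_eq_rhs, OF rotated_pmoment_deriv])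
  also have "\<dots> = (\<integral>p. of_real (\<Sum>l<k. (cmod (pmoment l p))\<^sup>2) \<partial>\<nu>)"
    by (intro Bochner_Integration.integral_cong refl)
     (auto simp: gram_ge[OF space_in] complex_norm_square mult.commute of_real_sum intro!: sum.cong simp del: of_real_power)
  also have "\<dots> = of_real (\<Sum>l<k. \<integral>p. (cmod (pmoment l p))\<^sup>2 \<partial>\<nu>)"
    by (simp add: integrable_pmoment_square Bochner_Integration.integral_sum flip: of_real_sum)
  finally show ?thesis .
qed

text \<open>The recursions for k = 1, ..., n are added. The left side becomes the Toeplitz form,
  bounded below by \<open>toeplitz_positivity\<close> at each unit vector and summed over these to
  produce the traces. On the right there are at most n^2 squares of mean at most 1; the factor 2 is
  that of the positivity inequality.\<close>

lemma pmoment_square_bound: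
  assumes "n \<ge> 1"
  shows "N * (\<integral>p. (cmod (pmoment n p))\<^sup>2 \<partial>\<nu>) \<le> 2 * (real n)\<^sup>2"
proof -
  define S where "S p = (\<Sum>b<n. (\<Sum>l<Suc b. trace_power N l p * pmoment (Suc b - l) p) * cnj (pmoment (Suc b) p))" for p
  have Sb: "bounded_rv S"
    unfolding S_def by (intro bounded_rv_intros bounded_rv_pmoment bounded_rv_trace_power)
  have pos: "N * (\<Sum>b<n. (cmod (pmoment (Suc b) p))\<^sup>2) \<le> 2 * Re (S p)" if p: "p \<in> space \<nu>" for p
  proof -
    have "N * (\<Sum>b<n. (cmod (pmoment (Suc b) p))\<^sup>2) = (\<Sum>i<N. \<Sum>b<n. (cmod (pmoment (Suc b) p))\<^sup>2)"
      by simp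
    also have "\<dots> \<le> (\<Sum>i<N. 2 * Re (\<Sum>b<n. (\<Sum>l<Suc b. power_form (fst p) l (unit_vec N i) (unit_vec N i) * pmoment (Suc b - l) p) * cnj (pmoment (Suc b) p)))"
      using p by (intro sum_mono toeplitz_positivity) (auto simp: space_eq unit_sphere_def cscalar_prod_unit_vec_right)
    also have "\<dots> = 2 * Re (S p)"
      unfolding S_def trace_power_def sum_distrib_right Re_sum sum_distrib_left
      by (subst sum.swap, subst (2) sum.swap) simp
    finally show ?thesis .
  qed
  have "N * (\<Sum>b<n. \<integral>p. (cmod (pmoment (Suc b) p))\<^sup>2 \<partial>\<nu>) = (\<integral>p. N * (\<Sum>b<n. (cmod (pmoment (Suc b) p))\<^sup>2) \<partial>\<nu>)"
    by (simp add: integrable_pmoment_square Bochner_Integration.integral_sum)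
  also have "\<dots> \<le> (\<integral>p. 2 * Re (S p) \<partial>\<nu>)"
    using pos bounded_rv_integrable[OF Sb] integrable_pmoment_square by (intro integral_mono) auto
  also have "\<dots> = 2 * Re (\<integral>p. S p \<partial>\<nu>)"
    using bounded_rv_integrable[OF Sb] by simp
  also have "(\<integral>p. S p \<partial>\<nu>) = of_real (\<Sum>b<n. \<Sum>l<Suc b. \<integral>p. (cmod (pmoment l p))\<^sup>2 \<partial>\<nu>)"
    unfolding S_def of_real_sum[of _ "{..<n}"] pmoment_square_recursion[symmetric]
    by (intro Bochner_Integration.integral_sum bounded_rv_integrable bounded_rv_intros bounded_rv_pmoment bounded_rv_trace_power)
  also have "2 * Re \<dots> \<le> 2 * (\<Sum>b<n. \<Sum>l<Suc b. 1)"
  proof -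
    have "(\<integral>p. (cmod (pmoment l p))\<^sup>2 \<partial>\<nu>) \<le> (\<integral>p. 1 \<partial>\<nu>)" for l
      using space_in by (intro integral_mono integrable_pmoment_square) (auto intro!: power_le_one pmoment_le_1)
    then show ?thesis
      by (simp add: prob_space del: of_real_sum sum.lessThan_Suc sum_constant) (intro sum_mono, auto)
  qed
  also have "\<dots> \<le> 2 * (\<Sum>b<n. real n)"
    by (intro mult_left_mono sum_mono) auto
  finally have "N * (\<Sum>b<n. \<integral>p. (cmod (pmoment (Suc b) p))\<^sup>2 \<partial>\<nu>) \<le> 2 * (real n)\<^sup>2"
    by (simp add: power2_eq_square)
  moreover have "(\<integral>p. (cmod (pmoment n p))\<^sup>2 \<partial>\<nu>) \<le> (\<Sum>b<n. \<integral>p. (cmod (pmoment (Suc b) p))\<^sup>2 \<partial>\<nu>)"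
    using member_le_sum[of "n - 1" "{..<n}" "\<lambda>b. \<integral>p. (cmod (pmoment (Suc b) p))\<^sup>2 \<partial>\<nu>"] assms by simp
  ultimately show ?thesis
    by (meson mult_left_mono of_nat_0_le_iff order_trans)
qed

end

text \<open>Young's inequality with a free weight c, chosen later to balance second moments of
  different orders in N.\<close>

lemma two_mult_le_weighted:
  fixes x y c :: real
  assumes "c > 0"
  shows "x * y \<le> (c * x\<^sup>2 + y\<^sup>2 / c) / 2"
proof -
  have "0 \<le> (c * x - y)\<^sup>2 / c"
    using assms by simp
  also have "\<dots> = c * x\<^sup>2 + y\<^sup>2 / c - 2 * (x * y)"
    using assms by (simp add: power2_eq_square field_simps)
  finally show ?thesis by simp
qed

text \<open>A quadratic remainder, uniform in t, is the form in which the Taylor estimate for exp(i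
  t Y) survives integration.\<close>

lemma has_vector_derivativeI_quadratic:
  fixes f :: "real \<Rightarrow> complex"
  assumes "\<And>t. cmod (f t - f s - (t - s) *\<^sub>R D) \<le> C * (t - s)\<^sup>2"
  shows "(f has_vector_derivative D) (at s)"
  unfolding has_vector_derivative_def has_derivative_iff_norm
proof (intro conjI bounded_linear_scaleR_left)
  have "((\<lambda>t. \<bar>C\<bar> * \<bar>t - s\<bar>) \<longlongrightarrow> \<bar>C\<bar> * \<bar>s - s\<bar>) (at s)"
    by (intro tendsto_intros)
  then have lim: "((\<lambda>t. \<bar>C\<bar> * \<bar>t - s\<bar>) \<longlongrightarrow> 0) (at s)"
    by simp
  have bound: "norm (norm (f t - f s - (t - s) *\<^sub>R D) / norm (t - s)) \<le> \<bar>C\<bar> * \<bar>t - s\<bar>" for t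
  proof (cases "t = s")
    case False
    have "cmod (f t - f s - (t - s) *\<^sub>R D) \<le> \<bar>C\<bar> * (t - s)\<^sup>2"
      using assms[of t] by (rule order_trans) (intro mult_right_mono, auto)
    then show ?thesis
      using False by (simp add: field_simps power2_eq_square abs_mult)
  qed simp
  show "((\<lambda>t. norm (f t - f s - (t - s) *\<^sub>R D) / norm (t - s)) \<longlongrightarrow> 0) (at s)"
    by (rule Lim_null_comparison[OF always_eventually lim]) (use bound in blast)
qed

definition linear_stat :: "nat \<Rightarrow> nat \<Rightarrow> (nat \<Rightarrow> complex) \<Rightarrow> complex mat \<times> complex vec \<Rightarrow> real" where
  "linear_stat N n \<theta> p = sqrt N * (\<Sum>m<n. Re (cnj (\<theta> m) * pmoment m p))"

context invariant_pair
begin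

lemma N_pos: "N > 0"
proof (rule ccontr)
  assume "\<not> N > 0"
  then have "unit_sphere N = {}"
    by (auto simp: unit_sphere_def cscalar_prod_sum[of _ 0])
  then show False
    using not_empty by (simp add: space_eq)
qed

text \<open>Invariance concerns only the matrix component, so replacing the vector by a fixed one
  preserves it. This makes the bound on \<open>pmoment\<close> available for the diagonal entries of
  V^l.\<close>

lemma invariant_pair_unit_vec:
  assumes i: "i < N"
  shows "invariant_pair N (distr \<nu> (pair_space N) (\<lambda>p. (fst p, unit_vec N i)))"
proof -
  have e: "unit_vec N i \<in> unit_sphere N"
    using i by (auto simp: unit_sphere_def cscalar_prod_unit_vec_right)
  have m: "(\<lambda>p. (fst p, unit_vec N i)) \<in> \<nu> \<rightarrow>\<^sub>M pair_space N"
    unfolding pair_space_def measurable_cong_sets[OF sets_eq refl] using e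
    by (intro measurable_Pair measurable_fst) auto
  interpret D: prob_space "distr \<nu> (pair_space N) (\<lambda>p. (fst p, unit_vec N i))"
    by (rule prob_space_distr[OF m])
  show ?thesis
  proof unfold_locales
    fix W assume W: "W \<in> unitary_mats N"
    have mW: "(\<lambda>p. (W * fst p, snd p)) \<in> \<nu> \<rightarrow>\<^sub>M pair_space N"
      using measurable_pair_unitary_mult[OF W] by (simp add: measurable_cong_sets[OF sets_eq refl])
    have m': "(\<lambda>p. (fst p, unit_vec N i)) \<in> pair_space N \<rightarrow>\<^sub>M pair_space N"
      using m by (simp add: measurable_cong_sets[OF sets_eq refl])
    have "distr (distr \<nu> (pair_space N) (\<lambda>p. (fst p, unit_vec N i))) (pair_space N) (\<lambda>p. (W * fst p, snd p))
      = distr (distr \<nu> (pair_space N) (\<lambda>p. (W * fst p, snd p))) (pair_space N) (\<lambda>p. (fst p, unit_vec N i))"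
      by (simp add: distr_distr m mW m' measurable_pair_unitary_mult[OF W] comp_def)
    then show "distr (distr \<nu> (pair_space N) (\<lambda>p. (fst p, unit_vec N i))) (pair_space N) (\<lambda>p. (W * fst p, snd p))
       = distr \<nu> (pair_space N) (\<lambda>p. (fst p, unit_vec N i))"
      by (simp add: invariant[OF W])
  qed simp
qed

lemma integrable_trace_power_square: "integrable \<nu> (\<lambda>p. (cmod (trace_power N k p))\<^sup>2)"
proof -
  have "bounded_rv (\<lambda>p. trace_power N k p * cnj (trace_power N k p))"
    by (intro bounded_rv_intros bounded_rv_trace_power)
  from integrable_Re[OF bounded_rv_integrable[OF this]] show ?thesis
    by (simp add: complex_norm_square[symmetric])
qed

text \<open>Cauchy--Schwarz over the N diagonal entries, each of second moment at most 2 l^2 / N.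
  The remaining factor N is harmless because these traces are later multiplied by some w_j of second
  moment O(1/N).\<close>

lemma trace_power_square_bound:
  assumes "l \<ge> 1"
  shows "(\<integral>p. (cmod (trace_power N l p))\<^sup>2 \<partial>\<nu>) \<le> 2 * (real l)\<^sup>2 * N"
proof -
  let ?e = "\<lambda>i. unit_vec N i :: complex vec"
  let ?P = "\<lambda>i p. power_form (fst p) l (?e i) (?e i)"
  have int: "integrable \<nu> (\<lambda>p. (cmod (?P i p))\<^sup>2)" for i
  proof -
    have "bounded_rv (\<lambda>p. ?P i p * cnj (?P i p))"
      by (intro bounded_rv_intros unit_vec_carrier_complex)
    from integrable_Re[OF bounded_rv_integrable[OF this]] show ?thesis
      by (simp add: complex_norm_square[symmetric])
  qed
  have 1: "N * (\<integral>p. (cmod (?P i p))\<^sup>2 \<partial>\<nu>) \<le> 2 * (real l)\<^sup>2" if i: "i < N" for i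
  proof -
    let ?\<nu>' = "distr \<nu> (pair_space N) (\<lambda>p. (fst p, ?e i))"
    interpret E: invariant_pair N ?\<nu>' by (rule invariant_pair_unit_vec[OF i])
    have e: "?e i \<in> unit_sphere N"
      using i by (auto simp: unit_sphere_def cscalar_prod_unit_vec_right)
    have "(\<integral>p. (cmod (pmoment l p))\<^sup>2 \<partial>?\<nu>') = (\<integral>p. (cmod (?P i p))\<^sup>2 \<partial>\<nu>)"
    proof (subst integral_distr)
      show "(\<lambda>p. (fst p, ?e i)) \<in> \<nu> \<rightarrow>\<^sub>M pair_space N"
        unfolding pair_space_def measurable_cong_sets[OF sets_eq refl] using e
        by (intro measurable_Pair measurable_fst) auto
      show "(\<lambda>p. (cmod (pmoment l p))\<^sup>2) \<in> borel_measurable (pair_space N)"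
        using borel_measurable_integrable[OF integrable_pmoment_square] by (simp add: measurable_cong_sets[OF sets_eq refl])
    qed (simp add: pmoment_def)
    with E.pmoment_square_bound[OF assms] show ?thesis by simp
  qed
  have "(\<integral>p. (cmod (trace_power N l p))\<^sup>2 \<partial>\<nu>) \<le> (\<integral>p. N * (\<Sum>i<N. (cmod (?P i p))\<^sup>2) \<partial>\<nu>)"
  proof (intro integral_mono integrable_trace_power_square)
    fix p
    have "(cmod (trace_power N l p))\<^sup>2 \<le> (\<Sum>i<N. 1 * cmod (?P i p))\<^sup>2"
      unfolding trace_power_def by (intro power_mono) (auto intro!: norm_sum)
    also have "\<dots> \<le> (\<Sum>i<N. 1\<^sup>2) * (\<Sum>i<N. (cmod (?P i p))\<^sup>2)"
      by (rule Cauchy_Schwarz_ineq_sum)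
    finally show "(cmod (trace_power N l p))\<^sup>2 \<le> N * (\<Sum>i<N. (cmod (?P i p))\<^sup>2)" by simp
  qed (use int in auto)
  also have "\<dots> = (\<Sum>i<N. N * (\<integral>p. (cmod (?P i p))\<^sup>2 \<partial>\<nu>))"
    by (simp add: int Bochner_Integration.integral_sum sum_distrib_left)
  also have "\<dots> \<le> (\<Sum>i<N. 2 * (real l)\<^sup>2)"
    by (intro sum_mono 1) auto
  finally show ?thesis by (simp add: mult_ac)
qed

lemma pmoment_square_bound': "(\<integral>p. (cmod (pmoment n p))\<^sup>2 \<partial>\<nu>) \<le> 2 * (real n)\<^sup>2 / N" if "n \<ge> 1"
  using pmoment_square_bound[OF that] N_pos by (simp add: field_simps)

lemma integrable_pmoment: "integrable \<nu> (\<lambda>p. cmod (pmoment j p))"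
  using bounded_rv_integrable[OF bounded_rv_pmoment] by (rule integrable_norm)

lemma pmoment_norm_bound:
  assumes "j \<ge> 1"
  shows "(\<integral>p. cmod (pmoment j p) \<partial>\<nu>) \<le> 2 * real j / sqrt N"
proof -
  \<comment> \<open>This weight makes both terms multiples of j / sqrt N; the resulting factor 3/2
    is rounded up to 2.\<close>
  define c where "c = sqrt N / j"
  have c: "c > 0" using N_pos assms by (simp add: c_def)
  have "(\<integral>p. cmod (pmoment j p) \<partial>\<nu>) \<le> (\<integral>p. (c * (cmod (pmoment j p))\<^sup>2 + 1 / c) / 2 \<partial>\<nu>)"
    using two_mult_le_weighted[OF c, of "cmod (pmoment j _)" 1]
    by (intro integral_mono integrable_pmoment) (simp_all add: integrable_pmoment_square)
  also have "\<dots> = (c * (\<integral>p. (cmod (pmoment j p))\<^sup>2 \<partial>\<nu>) + 1 / c) / 2"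
    by (simp add: integrable_pmoment_square prob_space)
  also have "\<dots> \<le> (c * (2 * (real j)\<^sup>2 / N) + 1 / c) / 2"
    using c pmoment_square_bound'[OF assms] by (intro divide_right_mono add_right_mono mult_left_mono) auto
  also have "\<dots> = 3/2 * real j / sqrt N"
    using N_pos assms by (simp add: c_def field_simps power2_eq_square)
  also have "\<dots> \<le> 2 * real j / sqrt N"
    by (intro divide_right_mono) auto
  finally show ?thesis .
qed

lemma integrable_trace_pmoment: "integrable \<nu> (\<lambda>p. cmod (trace_power N l p) * cmod (pmoment j p))"
  using integrable_norm[OF bounded_rv_integrable[OF bounded_rv_mult[OF bounded_rv_trace_power bounded_rv_pmoment]]]
  by (simp add: norm_mult)

lemma trace_pmoment_bound:
  assumes "l \<ge> 1" "j \<ge> 1" "l \<le> n" "j \<le> n"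
  shows "(\<integral>p. cmod (trace_power N l p) * cmod (pmoment j p) \<partial>\<nu>) \<le> 2 * (real n)\<^sup>2"
proof -
  have N: "real N > 0" using N_pos by simp
  have "(\<integral>p. cmod (trace_power N l p) * cmod (pmoment j p) \<partial>\<nu>)
      \<le> (\<integral>p. (1 / N * (cmod (trace_power N l p))\<^sup>2 + (cmod (pmoment j p))\<^sup>2 / (1 / N)) / 2 \<partial>\<nu>)"
    using N by (intro integral_mono two_mult_le_weighted integrable_trace_pmoment)
      (simp_all add: integrable_pmoment_square integrable_trace_power_square)
  also have "\<dots> = (1 / N * (\<integral>p. (cmod (trace_power N l p))\<^sup>2 \<partial>\<nu>) + N * (\<integral>p. (cmod (pmoment j p))\<^sup>2 \<partial>\<nu>)) / 2"
    by (simp add: integrable_pmoment_square integrable_trace_power_square)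
  also have "\<dots> \<le> (1 / N * (2 * (real l)\<^sup>2 * N) + 2 * (real j)\<^sup>2) / 2"
    using N trace_power_square_bound[OF assms(1)] pmoment_square_bound[OF assms(2)]
    by (intro divide_right_mono add_mono mult_left_mono) auto
  also have "\<dots> = (real l)\<^sup>2 + (real j)\<^sup>2"
    using N by simp
  also have "\<dots> \<le> (real n)\<^sup>2 + (real n)\<^sup>2"
    using assms by (intro add_mono power_mono) auto
  finally show ?thesis by simp
qed

end

section \<open>The characteristic function of linear statistics\<close>

context invariant_pair
begin

abbreviation char_stat :: "nat \<Rightarrow> (nat \<Rightarrow> complex) \<Rightarrow> complex mat \<times> complex vec \<Rightarrow> complex" where
  "char_stat n \<theta> p \<equiv> iexp (linear_stat N n \<theta> p)"

lemma measurable_linear_stat: "linear_stat N n \<theta> \<in> borel_measurable \<nu>"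
proof -
  have [measurable]: "pmoment m \<in> borel_measurable \<nu>" for m
    using bounded_rv_pmoment by (simp add: bounded_rv_def)
  show ?thesis unfolding linear_stat_def by measurable
qed

lemma bounded_rv_char_stat: "bounded_rv (char_stat n \<theta>)"
  using measurable_compose[OF measurable_linear_stat measurable_iexp]
  by (auto simp: bounded_rv_def intro!: exI[of _ 1])

lemma trace_power_0: "trace_power N 0 p = of_nat N"
  by (simp add: trace_power_def power_form_0 cscalar_prod_unit_vec_right)

text \<open>For \<Phi> = exp(i Y) the only terms without a small factor are N w_k \<Phi> (l = 0) on
  the left and m = k, l = 0 on the right, where \<open>gram k k\<close> is 1. Division by sqrt N
  leaves the Gaussian integration by parts formula with variance 1/2 in each real direction, up to
  O(N^(-1/2)).\<close>

lemma char_stat_schwinger_dyson: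
  assumes k: "1 \<le> k" "k < n" and \<Lambda>: "\<And>m. m < n \<Longrightarrow> cmod (\<theta> m) \<le> \<Lambda>"
  shows "cmod ((\<integral>p. of_real (sqrt N) * pmoment k p * char_stat n \<theta> p \<partial>\<nu>) - \<i> / 2 * \<theta> k * (\<integral>p. char_stat n \<theta> p \<partial>\<nu>))
     \<le> (2 * \<Lambda> * real n ^ 4 + 2 * real n ^ 3) / sqrt N"
proof -
  let ?\<Phi> = "char_stat n \<theta>" and ?s = "of_real (sqrt N) :: complex"
  have s: "sqrt N > 0" "?s \<noteq> 0" "?s * ?s = of_nat N" using N_pos
    by (auto simp: simp flip: of_real_mult)
  have \<Lambda>0: "\<Lambda> \<ge> 0" using \<Lambda>[of k] k by (meson norm_ge_zero order_trans)
  have norm_\<Phi>: "cmod (?\<Phi> p) = 1" for p by simp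
  \<comment> \<open>Coefficients of the derivatives of w_m and of its conjugate; the factor 1/2
    comes from Re z = (z + cnj z) / 2.\<close>
  let ?g = "\<lambda>m p. \<i> / 2 * ?s * cnj (\<theta> m) * ?\<Phi> p" and ?h = "\<lambda>m p. \<i> / 2 * ?s * \<theta> m * ?\<Phi> p"
  have SD: "(\<integral>p. (\<Sum>l<k. trace_power N l p * pmoment (k - l) p) * ?\<Phi> p \<partial>\<nu>)
    = (\<integral>p. (\<Sum>m<n. ?h m p * (\<Sum>l<m. cnj (pmoment l p) * gram k (m - l) p)
              - ?g m p * (\<Sum>l<m. pmoment (l + k) p * pmoment (m - l) p)) \<partial>\<nu>)"
  proof (rule schwinger_dyson)
    fix u :: "complex vec" and p and t :: real assume up: "u \<in> carrier_vec N" "p \<in> space \<nu>"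
    let ?q = "\<lambda>t. rotated N u t p"
    let ?w = "\<lambda>m. pmoment_deriv m u (?q t)"
    have "((\<lambda>t. linear_stat N n \<theta> (?q t)) has_vector_derivative sqrt N * (\<Sum>m<n. Re (cnj (\<theta> m) * ?w m))) (at t)"
      unfolding linear_stat_def
      by (intro has_vector_derivative_mult_right has_vector_derivative_sum rotated_pmoment_deriv up
          bounded_linear.has_vector_derivative[OF bounded_linear_Re])
    then have "((\<lambda>t. \<i> * of_real (linear_stat N n \<theta> (?q t))) has_vector_derivative
        \<i> * of_real (sqrt N * (\<Sum>m<n. Re (cnj (\<theta> m) * ?w m)))) (at t)"
      by (intro has_vector_derivative_mult_right has_vector_derivative_of_real)
        (simp add: has_real_derivative_iff_has_vector_derivative)
    from field_vector_diff_chain_at[OF this DERIV_exp]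
    have "((\<lambda>t. ?\<Phi> (?q t)) has_vector_derivative
        \<i> * of_real (sqrt N * (\<Sum>m<n. Re (cnj (\<theta> m) * ?w m))) * ?\<Phi> (?q t)) (at t)"
      by (simp add: comp_def)
    moreover have "\<i> * of_real (sqrt N * (\<Sum>m<n. Re (cnj (\<theta> m) * w m))) * E
         = (\<Sum>m<n. \<i> / 2 * ?s * cnj (\<theta> m) * E * w m + \<i> / 2 * ?s * \<theta> m * E * cnj (w m))" for w E
    proof -
      have "of_real (Re z) = (z + cnj z) / 2" for z by (simp add: complex_add_cnj)
      then show ?thesis
        by (simp only: of_real_mult of_real_sum sum_distrib_left sum_distrib_right)
          (intro sum.cong refl, simp add: field_simps)
    qed
    ultimately show "((\<lambda>t. ?\<Phi> (?q t)) has_vector_derivative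
        (\<Sum>m<n. ?g m (?q t) * ?w m + ?h m (?q t) * cnj (?w m))) (at t)"
      by (simp only:)
  qed (intro bounded_rv_intros bounded_rv_char_stat)+
  define T where "T p = (\<Sum>l\<in>{1..<k}. trace_power N l p * pmoment (k - l) p)" for p
  \<comment> \<open>The right-hand side with its leading term m = k, l = 0 removed and the common
    factor (\<i>/2) sqrt N \<Phi> taken out.\<close>
  define Er where "Er p = (\<Sum>m<n. \<theta> m * (\<Sum>l<m. cnj (pmoment l p) * gram k (m - l) p - (if m = k \<and> l = 0 then 1 else 0))
       - cnj (\<theta> m) * (\<Sum>l<m. pmoment (l + k) p * pmoment (m - l) p))" for p
  have bT: "bounded_rv T" and bEr: "bounded_rv Er"
    unfolding T_def Er_def by (intro bounded_rv_intros bounded_rv_trace_power bounded_rv_pmoment bounded_rv_gram)+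
  note bi = bounded_rv_integrable bounded_rv_mult bounded_rv_add bounded_rv_const bounded_rv_char_stat bounded_rv_pmoment bT bEr
  have lhs: "(\<Sum>l<k. trace_power N l p * pmoment (k - l) p) * ?\<Phi> p = ?s * (?s * pmoment k p * ?\<Phi> p) + T p * ?\<Phi> p" for p
  proof -
    have "{..<k} = insert 0 {1..<k}" using k by auto
    then have "(\<Sum>l<k. trace_power N l p * pmoment (k - l) p) = of_nat N * pmoment k p + T p"
      by (simp add: trace_power_0 T_def)
    then show ?thesis
      by (simp add: s(3)[symmetric] algebra_simps)
  qed
  have rhs: "(\<Sum>m<n. ?h m p * (\<Sum>l<m. cnj (pmoment l p) * gram k (m - l) p)
              - ?g m p * (\<Sum>l<m. pmoment (l + k) p * pmoment (m - l) p))
      = ?s * (\<i> / 2 * \<theta> k * ?\<Phi> p + \<i> / 2 * (?\<Phi> p * Er p))" for p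
  proof -
    have "(\<Sum>m<n. \<theta> m * (\<Sum>l<m. if m = k \<and> l = 0 then 1 else 0)) = (\<Sum>m<n. if m = k then \<theta> k else 0)"
      by (intro sum.cong refl) (use k in auto)
    also have "\<dots> = \<theta> k" using k by simp
    finally have *: "(\<Sum>m<n. \<theta> m * (\<Sum>l<m. cnj (pmoment l p) * gram k (m - l) p)
       - cnj (\<theta> m) * (\<Sum>l<m. pmoment (l + k) p * pmoment (m - l) p)) = Er p + \<theta> k"
      by (simp add: Er_def sum_subtractf right_diff_distrib)
    have **: "(\<Sum>m<n. ?h m p * X m - ?g m p * Y m) = ?s * \<i> / 2 * ?\<Phi> p * (\<Sum>m<n. \<theta> m * X m - cnj (\<theta> m) * Y m)" for X Y
      unfolding sum_distrib_left by (intro sum.cong refl) (simp add: algebra_simps)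
    show ?thesis unfolding ** * by (simp add: algebra_simps)
  qed
  have "?s * (\<integral>p. ?s * pmoment k p * ?\<Phi> p \<partial>\<nu>) + (\<integral>p. T p * ?\<Phi> p \<partial>\<nu>)
     = ?s * (\<i> / 2 * \<theta> k * (\<integral>p. ?\<Phi> p \<partial>\<nu>) + \<i> / 2 * (\<integral>p. ?\<Phi> p * Er p \<partial>\<nu>))"
  proof -
    have "(\<integral>p. ?s * (?s * pmoment k p * ?\<Phi> p) + T p * ?\<Phi> p \<partial>\<nu>)
       = ?s * (\<integral>p. ?s * pmoment k p * ?\<Phi> p \<partial>\<nu>) + (\<integral>p. T p * ?\<Phi> p \<partial>\<nu>)"
      by (subst Bochner_Integration.integral_add) (intro bi, intro bi, simp)
    moreover have "(\<integral>p. ?s * (\<i> / 2 * \<theta> k * ?\<Phi> p + \<i> / 2 * (?\<Phi> p * Er p)) \<partial>\<nu>)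
       = ?s * (\<i> / 2 * \<theta> k * (\<integral>p. ?\<Phi> p \<partial>\<nu>) + \<i> / 2 * (\<integral>p. ?\<Phi> p * Er p \<partial>\<nu>))"
      by (subst integral_mult_right_zero, subst Bochner_Integration.integral_add) (intro bi, intro bi, simp)
    ultimately show ?thesis
      using SD unfolding lhs rhs by simp
  qed
  moreover have "A - C = D - B / c" if "c * A + B = c * (C + D)" "c \<noteq> 0" for A B C D c :: complex
  proof -
    have "c * (A - C) = c * (D - B / c)" using that by (simp add: algebra_simps)
    then show ?thesis using that(2) by simp
  qed
  ultimately have "(\<integral>p. ?s * pmoment k p * ?\<Phi> p \<partial>\<nu>) - \<i> / 2 * \<theta> k * (\<integral>p. ?\<Phi> p \<partial>\<nu>)
     = \<i> / 2 * (\<integral>p. ?\<Phi> p * Er p \<partial>\<nu>) - (\<integral>p. T p * ?\<Phi> p \<partial>\<nu>) / ?s"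
    using s(2) by blast
  then have "cmod ((\<integral>p. ?s * pmoment k p * ?\<Phi> p \<partial>\<nu>) - \<i> / 2 * \<theta> k * (\<integral>p. ?\<Phi> p \<partial>\<nu>))
     \<le> cmod (\<i> / 2 * (\<integral>p. ?\<Phi> p * Er p \<partial>\<nu>)) + cmod ((\<integral>p. T p * ?\<Phi> p \<partial>\<nu>) / ?s)"
    by (simp only: norm_triangle_ineq4)
  also have "cmod (\<i> / 2 * (\<integral>p. ?\<Phi> p * Er p \<partial>\<nu>)) \<le> (2 * \<Lambda> * real n ^ 4) / sqrt N"
  proof -
    \<comment> \<open>Each nonzero summand keeps one factor |w_j| with 1 \<le> j < n, its other
      factors being at most 1; for l = 0 and m \<noteq> k this factor is the Gram entry, with j = |k
      - m|.\<close>
    have W: "cmod (Er p) \<le> 2 * \<Lambda> * (real n)\<^sup>2 * (\<Sum>j\<in>{1..<n}. cmod (pmoment j p))" if p: "p \<in> space \<nu>" for p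
    proof -
      let ?W = "\<Sum>j\<in>{1..<n}. cmod (pmoment j p)"
      note p' = space_in[OF p]
      have mem: "cmod (pmoment j p) \<le> ?W" if "1 \<le> j" "j < n" for j
        using that by (intro member_le_sum) auto
      have W0: "?W \<ge> 0" by (intro sum_nonneg) auto
      have 1: "cmod (cnj (pmoment l p) * gram k (m - l) p - (if m = k \<and> l = 0 then 1 else 0)) \<le> ?W" if "l < m" "m < n" for l m
      proof (cases "l = 0")
        case False
        have "cmod (cnj (pmoment l p) * gram k (m - l) p) \<le> cmod (pmoment l p) * 1"
          unfolding norm_mult by (intro mult_mono) (auto intro: gram_le_1 p')
        then show ?thesis using False mem[of l] that by simp
      next
        case l: True
        consider "m = k" | "m < k" | "k < m" by linarith
        then show ?thesis
        proof cases
          case 1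
          then show ?thesis using l p' W0 by (simp add: pmoment_0 gram_ge)
        next
          case 2
          then show ?thesis using l p' mem[of "k - m"] k by (simp add: pmoment_0 gram_ge)
        next
          case 3
          then show ?thesis using l p' mem[of "m - k"] k that by (simp add: pmoment_0 gram_le)
        qed
      qed
      have 2: "cmod (pmoment (l + k) p * pmoment (m - l) p) \<le> ?W" if "l < m" "m < n" for l m
      proof -
        have "cmod (pmoment (l + k) p * pmoment (m - l) p) \<le> 1 * cmod (pmoment (m - l) p)"
          unfolding norm_mult by (intro mult_mono) (auto intro: pmoment_le_1 p')
        then show ?thesis using mem[of "m - l"] that by (simp add: less_imp_diff_less Suc_le_eq)
      qed
      have s1: "cmod (\<Sum>l<m. f l) \<le> real n * ?W" if "\<And>l. l < m \<Longrightarrow> cmod (f l) \<le> ?W" "m < n" for f m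
      proof -
        have "cmod (\<Sum>l<m. f l) \<le> (\<Sum>l<m. ?W)" using that by (intro sum_norm_le) auto
        also have "\<dots> \<le> real n * ?W" using that W0 by (auto intro!: mult_right_mono)
        finally show ?thesis .
      qed
      have "cmod (Er p) \<le> (\<Sum>m<n. \<Lambda> * (real n * ?W) + \<Lambda> * (real n * ?W))"
        unfolding Er_def
      proof (intro sum_norm_le order_trans[OF norm_triangle_ineq4] add_mono)
        fix m assume "m \<in> {..<n}"
        then have m: "m < n" by simp
        show "cmod (\<theta> m * (\<Sum>l<m. cnj (pmoment l p) * gram k (m - l) p - (if m = k \<and> l = 0 then 1 else 0))) \<le> \<Lambda> * (real n * ?W)"
          unfolding norm_mult using m \<Lambda>0 by (intro mult_mono \<Lambda> s1 1) auto
        show "cmod (cnj (\<theta> m) * (\<Sum>l<m. pmoment (l + k) p * pmoment (m - l) p)) \<le> \<Lambda> * (real n * ?W)"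
          unfolding norm_mult complex_mod_cnj using m \<Lambda>0 by (intro mult_mono \<Lambda> s1 2) auto
      qed
      also have "\<dots> = 2 * \<Lambda> * (real n)\<^sup>2 * ?W" by (simp add: power2_eq_square)
      finally show ?thesis .
    qed
    have "cmod (\<integral>p. ?\<Phi> p * Er p \<partial>\<nu>) \<le> (\<integral>p. cmod (?\<Phi> p * Er p) \<partial>\<nu>)"
      by (rule integral_norm_bound)
    also have "\<dots> \<le> (\<integral>p. 2 * \<Lambda> * (real n)\<^sup>2 * (\<Sum>j\<in>{1..<n}. cmod (pmoment j p)) \<partial>\<nu>)"
      using W by (intro integral_mono integrable_norm bi integrable_mult_right Bochner_Integration.integrable_sum integrable_pmoment)
        (simp add: norm_mult)
    also have "\<dots> = 2 * \<Lambda> * (real n)\<^sup>2 * (\<Sum>j\<in>{1..<n}. \<integral>p. cmod (pmoment j p) \<partial>\<nu>)"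
      by (simp add: Bochner_Integration.integral_sum integrable_pmoment)
    also have "\<dots> \<le> 2 * \<Lambda> * (real n)\<^sup>2 * (\<Sum>j\<in>{1..<n}. 2 * real n / sqrt N)"
      using \<Lambda>0 by (intro mult_left_mono sum_mono order_trans[OF pmoment_norm_bound] divide_right_mono) auto
    also have "\<dots> \<le> 2 * \<Lambda> * (real n)\<^sup>2 * (real n * (2 * real n / sqrt N))"
      using \<Lambda>0 by (intro mult_left_mono) (auto intro!: divide_right_mono mult_right_mono)
    also have "\<dots> = 4 * \<Lambda> * real n ^ 4 / sqrt N"
      by (simp add: eval_nat_numeral)
    finally show ?thesis by (simp add: norm_mult norm_divide)
  qed
  also have "cmod ((\<integral>p. T p * ?\<Phi> p \<partial>\<nu>) / ?s) \<le> (2 * real n ^ 3) / sqrt N"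
  proof -
    have "cmod (\<integral>p. T p * ?\<Phi> p \<partial>\<nu>) \<le> (\<integral>p. cmod (T p * ?\<Phi> p) \<partial>\<nu>)"
      by (rule integral_norm_bound)
    also have "\<dots> \<le> (\<integral>p. (\<Sum>l\<in>{1..<k}. cmod (trace_power N l p) * cmod (pmoment (k - l) p)) \<partial>\<nu>)"
    proof (intro integral_mono integrable_norm bi Bochner_Integration.integrable_sum integrable_trace_pmoment)
      show "cmod (T p * ?\<Phi> p) \<le> (\<Sum>l\<in>{1..<k}. cmod (trace_power N l p) * cmod (pmoment (k - l) p))" for p
        by (auto simp: T_def norm_mult intro!: sum_norm_le)
    qed
    also have "\<dots> = (\<Sum>l\<in>{1..<k}. \<integral>p. cmod (trace_power N l p) * cmod (pmoment (k - l) p) \<partial>\<nu>)"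
      by (simp add: integrable_trace_pmoment Bochner_Integration.integral_sum)
    also have "\<dots> \<le> (\<Sum>l\<in>{1..<k}. 2 * (real n)\<^sup>2)"
      using k by (intro sum_mono trace_pmoment_bound) auto
    also have "\<dots> \<le> real n * (2 * (real n)\<^sup>2)"
      using k by (auto intro!: mult_right_mono)
    finally have "cmod (\<integral>p. T p * ?\<Phi> p \<partial>\<nu>) \<le> 2 * real n ^ 3"
      by (simp add: eval_nat_numeral)
    then show ?thesis
      using s by (simp add: norm_divide divide_right_mono)
  qed
  finally show ?thesis by (simp add: add_divide_distrib)
qed

end

context invariant_pair
begin

lemma linear_stat_scale: "linear_stat N n (\<lambda>m. of_real s * \<theta> m) p = s * linear_stat N n \<theta> p"
  by (simp add: linear_stat_def sum_distrib_left algebra_simps)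

text \<open>The mean f(s) of exp(i s Y) satisfies f' = - (s \<sigma> / 2) f up to a uniform error,
  where \<sigma> is the squared norm of \<theta>. The integrating factor exp(s^2 \<sigma> / 4) and
  the mean value inequality on [0, 1] bring f(1) close to exp(- \<sigma> / 4). Index 0 is left out
  because w_0 = 1 is not random.\<close>

lemma char_stat_convergence:
  assumes \<Lambda>: "\<And>m. m < n \<Longrightarrow> cmod (\<theta> m) \<le> \<Lambda>" and \<theta>0: "\<theta> 0 = 0" and \<Lambda>0: "\<Lambda> \<ge> 0"
  shows "cmod ((\<integral>p. char_stat n \<theta> p \<partial>\<nu>) - of_real (exp (- (\<Sum>m<n. (cmod (\<theta> m))\<^sup>2) / 4)))
     \<le> real n * \<Lambda> * ((2 * \<Lambda> * real n ^ 4 + 2 * real n ^ 3) / sqrt N)"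
proof -
  define Y where "Y = linear_stat N n \<theta>"
  define \<epsilon> where "\<epsilon> = (2 * \<Lambda> * real n ^ 4 + 2 * real n ^ 3) / sqrt N"
  define \<sigma> where "\<sigma> = (\<Sum>m<n. (cmod (\<theta> m))\<^sup>2)"
  let ?\<theta> = "\<lambda>s m. of_real s * \<theta> m"
  define f where "f s = (\<integral>p. char_stat n (?\<theta> s) p \<partial>\<nu>)" for s
  define A where "A m s = (\<integral>p. of_real (sqrt N) * pmoment m p * char_stat n (?\<theta> s) p \<partial>\<nu>)" for m s
  \<comment> \<open>The derivative of f. Means of cnj w_m exp(i s Y) are written as conjugates of
    means at - s, so that the estimate for w_m covers them too.\<close>
  define D where "D s = (\<Sum>m<n. \<i> / 2 * (cnj (\<theta> m) * A m s + \<theta> m * cnj (A m (- s))))" for s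
  have \<epsilon>0: "\<epsilon> \<ge> 0" using \<Lambda>0 by (simp add: \<epsilon>_def)
  have cs: "char_stat n (?\<theta> s) p = iexp (s * Y p)" for s p
    by (simp add: linear_stat_scale Y_def)
  have cnj_iexp: "cnj (iexp (- s * x)) = iexp (s * x)" for s x :: real
    by (simp add: exp_cnj)
  have cnj_f: "cnj (f (- s)) = f s" for s
  proof -
    have "cnj (f (- s)) = (\<integral>p. cnj (iexp (- s * Y p)) \<partial>\<nu>)"
      unfolding f_def cs by (rule Bochner_Integration.integral_cnj[symmetric])
    then show ?thesis
      unfolding cnj_iexp by (simp add: f_def cs)
  qed
  \<comment> \<open>A bound on Y that grows with N; it serves to differentiate under the integral
    and does not enter the final estimate.\<close>
  define B where "B = sqrt N * (real n * \<Lambda>)"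
  have YB: "\<bar>Y p\<bar> \<le> B" if p: "p \<in> space \<nu>" for p
  proof -
    have "\<bar>Re (cnj (\<theta> m) * pmoment m p)\<bar> \<le> \<Lambda> * 1" if "m < n" for m
      using abs_Re_le_cmod[of "cnj (\<theta> m) * pmoment m p"] \<Lambda>[OF that] pmoment_le_1[OF space_in[OF p]] \<Lambda>0
      by (intro order_trans[OF abs_Re_le_cmod]) (simp only: norm_mult complex_mod_cnj, intro mult_mono, auto)
    then have "\<bar>\<Sum>m<n. Re (cnj (\<theta> m) * pmoment m p)\<bar> \<le> (\<Sum>m<n. \<Lambda>)"
      by (intro order_trans[OF sum_abs] sum_mono) auto
    then show ?thesis
      by (simp add: Y_def linear_stat_def abs_mult B_def mult_left_mono)
  qed
  have Ym [measurable]: "Y \<in> borel_measurable \<nu>"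
    unfolding Y_def by (rule measurable_linear_stat)
  have bY: "bounded_rv (\<lambda>p. of_real (Y p))"
    using YB unfolding bounded_rv_def by (intro conjI exI[of _ B]) auto
  have bI: "bounded_rv (\<lambda>p. iexp (s * Y p))" for s
    using bounded_rv_char_stat[of n "?\<theta> s"] by (simp add: cs)
  have D_eq: "D s = (\<integral>p. \<i> * of_real (Y p) * iexp (s * Y p) \<partial>\<nu>)" for s
  proof -
    let ?w = "\<lambda>m p. of_real (sqrt N) * pmoment m p * iexp (s * Y p)"
    let ?w' = "\<lambda>m p. of_real (sqrt N) * cnj (pmoment m p) * iexp (s * Y p)"
    have cnj_A: "cnj (A m (- s)) = (\<integral>p. ?w' m p \<partial>\<nu>)" for m
    proof -
      have "cnj (A m (- s)) = (\<integral>p. cnj (of_real (sqrt N) * pmoment m p * iexp (- s * Y p)) \<partial>\<nu>)"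
        unfolding A_def cs by (rule Bochner_Integration.integral_cnj[symmetric])
      then show ?thesis
        unfolding complex_cnj_mult cnj_iexp by simp
    qed
    have int: "integrable \<nu> (\<lambda>p. cnj (\<theta> m) * ?w m p)" "integrable \<nu> (\<lambda>p. \<theta> m * ?w' m p)" for m
      by (intro bounded_rv_integrable bounded_rv_intros bounded_rv_pmoment bI)+
    have "D s = (\<Sum>m<n. \<integral>p. \<i> / 2 * (cnj (\<theta> m) * ?w m p + \<theta> m * ?w' m p) \<partial>\<nu>)"
      unfolding D_def cnj_A
    proof (intro sum.cong refl)
      fix m
      show "\<i> / 2 * (cnj (\<theta> m) * A m s + \<theta> m * (\<integral>p. ?w' m p \<partial>\<nu>))
          = (\<integral>p. \<i> / 2 * (cnj (\<theta> m) * ?w m p + \<theta> m * ?w' m p) \<partial>\<nu>)"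
        unfolding A_def cs
        by (subst integral_mult_right_zero, subst Bochner_Integration.integral_add[OF int]) simp
    qed
    also have "\<dots> = (\<integral>p. (\<Sum>m<n. \<i> / 2 * (cnj (\<theta> m) * ?w m p + \<theta> m * ?w' m p)) \<partial>\<nu>)"
      by (intro Bochner_Integration.integral_sum[symmetric] bounded_rv_integrable bounded_rv_intros bounded_rv_pmoment bI)
    also have "\<dots> = (\<integral>p. \<i> * of_real (Y p) * iexp (s * Y p) \<partial>\<nu>)"
    proof (intro Bochner_Integration.integral_cong refl)
      fix p
      have "of_real (Re z) = (z + cnj z) / 2" for z by (simp add: complex_add_cnj)
      then have "\<i> * of_real (Y p) * E = (\<Sum>m<n. \<i> / 2 * (cnj (\<theta> m) * (of_real (sqrt N) * pmoment m p * E)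
        + \<theta> m * (of_real (sqrt N) * cnj (pmoment m p) * E)))" for E
        unfolding Y_def linear_stat_def
        by (simp only: of_real_mult of_real_sum sum_distrib_left sum_distrib_right)
          (intro sum.cong refl, simp add: field_simps)
      then show "(\<Sum>m<n. \<i> / 2 * (cnj (\<theta> m) * ?w m p + \<theta> m * ?w' m p)) = \<i> * of_real (Y p) * iexp (s * Y p)"
        by (rule sym)
    qed
    finally show ?thesis .
  qed
  have deriv: "(f has_vector_derivative D s) (at s)" for s
  proof (rule has_vector_derivativeI_quadratic)
    fix t
    let ?R = "\<lambda>p. iexp (t * Y p) - iexp (s * Y p) - of_real (t - s) * (\<i> * of_real (Y p) * iexp (s * Y p))"
    have eq: "f t - f s - (t - s) *\<^sub>R D s = (\<integral>p. ?R p \<partial>\<nu>)"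
    proof -
      have "integrable \<nu> (\<lambda>p. iexp (t * Y p))" "integrable \<nu> (\<lambda>p. iexp (s * Y p))"
        "integrable \<nu> (\<lambda>p. of_real (t - s) * (\<i> * of_real (Y p) * iexp (s * Y p)))"
        by (intro bounded_rv_integrable bounded_rv_intros bI bY)+
      then show ?thesis
        by (simp add: f_def cs D_eq scaleR_conv_of_real)
    qed
    have "cmod (f t - f s - (t - s) *\<^sub>R D s) \<le> (\<integral>p. cmod (?R p) \<partial>\<nu>)"
      unfolding eq by (rule integral_norm_bound)
    also have "\<dots> \<le> (\<integral>p. B\<^sup>2 * (t - s)\<^sup>2 \<partial>\<nu>)"
    proof (rule integral_mono)
      have "bounded_rv ?R"
        by (rule bounded_rv_diff bI bounded_rv_mult bounded_rv_const bY)+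
      then show "integrable \<nu> (\<lambda>p. cmod (?R p))"
        by (intro integrable_norm bounded_rv_integrable)
      fix p assume p: "p \<in> space \<nu>"
      let ?h = "(t - s) * Y p"
      have "t * Y p = s * Y p + ?h"
        by (simp add: algebra_simps)
      then have e: "iexp (t * Y p) = iexp (s * Y p) * iexp ?h"
        by (simp only: of_real_add distrib_left exp_add)
      have "?R p = iexp (s * Y p) * (iexp ?h - (\<Sum>k\<le>1. (\<i> * of_real ?h) ^ k / fact k))"
        unfolding e by (simp add: algebra_simps)
      then have "cmod (?R p) = cmod (iexp ?h - (\<Sum>k\<le>1. (\<i> * of_real ?h) ^ k / fact k))"
        by (simp add: norm_mult)
      also have "\<dots> \<le> \<bar>?h\<bar> ^ Suc 1 / fact (Suc 1)"
        by (rule iexp_approx1)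
      also have "\<dots> = ?h\<^sup>2 / 2"
        by (simp add: power2_eq_square)
      also have "\<dots> \<le> \<bar>Y p\<bar>\<^sup>2 * (t - s)\<^sup>2"
        by (simp add: power_mult_distrib mult.commute)
      also have "\<dots> \<le> B\<^sup>2 * (t - s)\<^sup>2"
        using YB[OF p] by (intro mult_right_mono power_mono) auto
      finally show "cmod (?R p) \<le> B\<^sup>2 * (t - s)\<^sup>2" .
    qed simp
    also have "\<dots> = B\<^sup>2 * (t - s)\<^sup>2"
      by (simp add: prob_space)
    finally show "cmod (f t - f s - (t - s) *\<^sub>R D s) \<le> B\<^sup>2 * (t - s)\<^sup>2" .
  qed
  have D_approx: "cmod (D s + of_real (s * \<sigma> / 2) * f s) \<le> real n * \<Lambda> * \<epsilon>" if s: "\<bar>s\<bar> \<le> 1" for s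
  proof -
    have A: "cmod (A m r - \<i> / 2 * (of_real r * \<theta> m) * f r) \<le> \<epsilon>" if m: "1 \<le> m" "m < n" and r: "\<bar>r\<bar> \<le> 1" for m r
      unfolding A_def f_def \<epsilon>_def
    proof (rule char_stat_schwinger_dyson[OF m])
      fix m assume "m < n"
      then show "cmod (of_real r * \<theta> m) \<le> \<Lambda>"
        using r \<Lambda>[of m] mult_mono[of "\<bar>r\<bar>" 1 "cmod (\<theta> m)" \<Lambda>] by (simp add: norm_mult)
    qed
    have eq: "D s + of_real (s * \<sigma> / 2) * f s
      = (\<Sum>m<n. \<i> / 2 * (cnj (\<theta> m) * (A m s - \<i> / 2 * (of_real s * \<theta> m) * f s)
             + \<theta> m * cnj (A m (- s) - \<i> / 2 * (of_real (- s) * \<theta> m) * f (- s))))"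
    proof -
      have *: "of_real (s * \<sigma> / 2) * f s = (\<Sum>m<n. of_real (s / 2) * (\<theta> m * cnj (\<theta> m)) * f s)"
        unfolding \<sigma>_def complex_norm_square[symmetric] by (simp add: sum_distrib_left sum_distrib_right sum_divide_distrib)
      have alg: "\<i> / 2 * (z' * a + z * b) + of_real (s / 2) * (z * z') * F
          = \<i> / 2 * (z' * (a - \<i> / 2 * (of_real s * z) * F) + z * (b - \<i> / 2 * (of_real s * z') * F))" for a b z z' F
        by (simp add: field_simps)
      have "cnj (A m (- s) - \<i> / 2 * (of_real (- s) * \<theta> m) * f (- s)) = cnj (A m (- s)) - \<i> / 2 * (of_real s * cnj (\<theta> m)) * f s" for m
        by (simp add: cnj_f)
      then show ?thesis
        unfolding D_def * sum.distrib[symmetric] by (simp only: alg)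
    qed
    have "cmod (D s + of_real (s * \<sigma> / 2) * f s) \<le> (\<Sum>m<n. \<Lambda> * \<epsilon>)"
      unfolding eq
    proof (rule sum_norm_le)
      fix m assume "m \<in> {..<n}"
      then have m: "m < n" by simp
      show "cmod (\<i> / 2 * (cnj (\<theta> m) * (A m s - \<i> / 2 * (of_real s * \<theta> m) * f s)
             + \<theta> m * cnj (A m (- s) - \<i> / 2 * (of_real (- s) * \<theta> m) * f (- s)))) \<le> \<Lambda> * \<epsilon>"
      proof (cases "m = 0")
        case True
        then show ?thesis using \<theta>0 \<Lambda>0 \<epsilon>0 by simp
      next
        case False
        let ?a = "A m s - \<i> / 2 * (of_real s * \<theta> m) * f s" and ?b = "A m (- s) - \<i> / 2 * (of_real (- s) * \<theta> m) * f (- s)"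
        have "cmod (cnj (\<theta> m) * ?a + \<theta> m * cnj ?b) \<le> cmod (\<theta> m) * cmod ?a + cmod (\<theta> m) * cmod ?b"
          by (rule norm_triangle_le) (simp only: norm_mult complex_mod_cnj order_refl)
        also have "\<dots> \<le> \<Lambda> * \<epsilon> + \<Lambda> * \<epsilon>"
          using False m s \<Lambda>0 by (intro add_mono mult_mono A \<Lambda>) auto
        finally show ?thesis
          by (simp only: norm_mult norm_divide) simp
      qed
    qed
    then show ?thesis by simp
  qed
  define G where "G s = of_real (exp (s\<^sup>2 * \<sigma> / 4)) * f s" for s
  have G': "(G has_vector_derivative of_real (exp (s\<^sup>2 * \<sigma> / 4)) * (D s + of_real (s * \<sigma> / 2) * f s)) (at s)" for s
  proof -
    have "((\<lambda>s. exp (s\<^sup>2 * \<sigma> / 4)) has_real_derivative exp (s\<^sup>2 * \<sigma> / 4) * (s * \<sigma> / 2)) (at s)"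
      by (auto intro!: derivative_eq_intros)
    from has_vector_derivative_mult[OF has_vector_derivative_of_real[OF this] deriv[of s]]
    show ?thesis
      unfolding G_def by (rule has_vector_derivative_eq_rhs) (simp add: algebra_simps)
  qed
  \<comment> \<open>On [0, 1] the integrating factor is at most exp(\<sigma> / 4), and this cancels
    against the same factor in \<open>G 1\<close>.\<close>
  have "norm (G 1 - G 0) \<le> exp (\<sigma> / 4) * (real n * \<Lambda> * \<epsilon>) * norm (1 - 0 :: real)"
  proof (rule differentiable_bound[where S="{0..1}"])
    fix s :: real assume s: "s \<in> {0..1}"
    let ?d = "of_real (exp (s\<^sup>2 * \<sigma> / 4)) * (D s + of_real (s * \<sigma> / 2) * f s)"
    show "(G has_derivative (\<lambda>r. r *\<^sub>R ?d)) (at s within {0..1})"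
      using G'[of s] by (auto simp: has_vector_derivative_def intro: has_derivative_at_withinI)
    have "cmod ?d \<le> exp (\<sigma> / 4) * (real n * \<Lambda> * \<epsilon>)"
      unfolding norm_mult
    proof (intro mult_mono D_approx)
      have "s\<^sup>2 * \<sigma> \<le> 1 * \<sigma>"
        using s by (intro mult_right_mono power_le_one) (auto simp: \<sigma>_def sum_nonneg)
      then show "cmod (of_real (exp (s\<^sup>2 * \<sigma> / 4))) \<le> exp (\<sigma> / 4)" by simp
    qed (use s in auto)
    then show "onorm (\<lambda>r. r *\<^sub>R ?d) \<le> exp (\<sigma> / 4) * (real n * \<Lambda> * \<epsilon>)"
      using \<Lambda>0 \<epsilon>0 by (intro onorm_bound) (auto simp: mult.commute[of _ "norm _"] intro!: mult_right_mono)
  qed auto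
  moreover have "G 0 = 1"
    by (simp add: G_def f_def linear_stat_def prob_space)
  moreover have "G 1 = of_real (exp (\<sigma> / 4)) * f 1"
    by (simp add: G_def)
  ultimately have "cmod (of_real (exp (\<sigma> / 4)) * f 1 - 1) \<le> exp (\<sigma> / 4) * (real n * \<Lambda> * \<epsilon>)"
    by simp
  moreover have "of_real (exp (\<sigma> / 4)) * f 1 - 1 = of_real (exp (\<sigma> / 4)) * (f 1 - of_real (exp (- \<sigma> / 4)))"
    by (simp add: right_diff_distrib flip: of_real_mult exp_add)
  ultimately have "exp (\<sigma> / 4) * cmod (f 1 - of_real (exp (- \<sigma> / 4))) \<le> exp (\<sigma> / 4) * (real n * \<Lambda> * \<epsilon>)"
    by (simp only: norm_mult norm_of_real abs_exp_cancel)
  then have "cmod (f 1 - of_real (exp (- \<sigma> / 4))) \<le> real n * \<Lambda> * \<epsilon>"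
    by simp
  then show ?thesis
    by (simp add: f_def \<sigma>_def \<epsilon>_def)
qed

end


subsection \<open>Zeros of power series on the disk\<close>

text \<open>A test function sees only finitely many atoms, so its integral is a finite sum; S may be
  any finite set containing those atoms, which lets later proofs choose it freely.\<close>

lemma integral_multiplicity_measure:
  fixes \<phi> :: "complex \<Rightarrow> real"
  assumes \<phi>: "continuous_on unit_disk \<phi>" and S: "finite S" "S \<subseteq> unit_disk"
    and supp: "\<And>z. z \<in> unit_disk \<Longrightarrow> z \<notin> S \<Longrightarrow> real (m z) * \<phi> z = 0"
  shows "integral\<^sup>L (multiplicity_measure m) \<phi> = (\<Sum>z\<in>S. real (m z) * \<phi> z)"
proof -
  have meas: "\<phi> \<in> borel_measurable (restrict_space borel unit_disk)"
    using \<phi> by (rule borel_measurable_continuous_on_restrict)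
  have "integral\<^sup>L (multiplicity_measure m) \<phi> = integral\<^sup>L (density (count_space unit_disk) (\<lambda>z. of_nat (m z))) \<phi>"
    unfolding multiplicity_measure_def
    by (subst integral_distr) (use meas in \<open>auto simp: measurable_def space_restrict_space\<close>)
  also have "\<dots> = integral\<^sup>L (density (count_space unit_disk) (\<lambda>z. ennreal (real (m z)))) \<phi>"
    by (simp add: ennreal_of_nat_eq_real_of_nat)
  also have "\<dots> = (\<integral>z. real (m z) *\<^sub>R \<phi> z \<partial>count_space unit_disk)"
    by (rule integral_density) auto
  also have "\<dots> = (\<Sum>z | z \<in> unit_disk \<and> real (m z) *\<^sub>R \<phi> z \<noteq> 0. real (m z) *\<^sub>R \<phi> z)"
  proof (rule lebesgue_integral_count_space_finite_support)
    have "{z \<in> unit_disk. real (m z) *\<^sub>R \<phi> z \<noteq> 0} \<subseteq> S"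
      using supp by fastforce
    then show "finite {z \<in> unit_disk. real (m z) *\<^sub>R \<phi> z \<noteq> 0}"
      using S(1) by (rule finite_subset)
  qed
  also have "\<dots> = (\<Sum>z\<in>S. real (m z) * \<phi> z)"
  proof (rule sum.mono_neutral_cong_left[OF S(1)])
    show "{z \<in> unit_disk. real (m z) *\<^sub>R \<phi> z \<noteq> 0} \<subseteq> S"
      using supp by fastforce
  qed (use S in auto)
  finally show ?thesis .
qed

lemma finite_zeros_cball:
  fixes f :: "complex \<Rightarrow> complex"
  assumes f: "f holomorphic_on unit_disk" and f0: "f 0 \<noteq> 0" and "r < 1"
  shows "finite {z \<in> cball 0 r. f z = 0}"
proof (cases "f constant_on unit_disk")
  case True
  then obtain c where "\<And>z. z \<in> unit_disk \<Longrightarrow> f z = c"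
    by (auto simp: constant_on_def)
  then have "{z \<in> cball 0 r. f z = 0} = {}"
    using f0 \<open>r < 1\<close> by force
  then show ?thesis by (simp only: finite.emptyI)
next
  case False
  then show ?thesis
    using assms by (intro holomorphic_compact_finite_zeros[OF f]) auto
qed

text \<open>\<open>zorder\<close> is meaningful only where f is not locally zero. Local vanishing
  would put an open set into the finite zero set of \<open>finite_zeros_cball\<close>.\<close>

lemma zorder_nonneg_disk:
  assumes f: "f holomorphic_on unit_disk" and f0: "f 0 \<noteq> 0" and z: "z \<in> unit_disk"
  shows "zorder f z \<ge> 0"
proof -
  obtain r where "norm z < r" "r < 1" using z dense[of "norm z" 1] by auto
  have "\<exists>\<^sub>F w in at z. f w \<noteq> 0"
  proof (rule ccontr)
    assume "\<not> (\<exists>\<^sub>F w in at z. f w \<noteq> 0)"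
    then have "\<forall>\<^sub>F w in at z. f w = 0" by (simp add: not_frequently)
    then obtain T where T: "open T" "z \<in> T" "\<And>w. w \<in> T \<Longrightarrow> w \<noteq> z \<Longrightarrow> f w = 0"
      by (auto simp: eventually_at_topological)
    define S where "S = T \<inter> ball 0 r"
    have "open S" "z \<in> S" using T \<open>norm z < r\<close> by (auto simp: S_def)
    moreover have "S \<subseteq> insert z {z \<in> cball 0 r. f z = 0}"
      using T by (auto simp: S_def)
    then have "finite S" using finite_zeros_cball[OF f f0 \<open>r < 1\<close>] finite_subset finite_insert by metis
    ultimately show False
      using finite_imp_not_open by blast
  qed
  moreover have "f analytic_on {z}"
    using f z analytic_at by blast
  ultimately show ?thesis
    by (intro zorder_ge_0)
qed

lemma integral_zero_measure:
  fixes \<phi> :: "complex \<Rightarrow> real"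
  assumes f: "f holomorphic_on unit_disk" and f0: "f 0 \<noteq> 0"
    and \<phi>: "continuous_on unit_disk \<phi>" and S: "finite S" "S \<subseteq> {z \<in> unit_disk. f z = 0}"
    and supp: "\<And>z. z \<in> unit_disk \<Longrightarrow> f z = 0 \<Longrightarrow> z \<notin> S \<Longrightarrow> \<phi> z = 0"
  shows "integral\<^sup>L (zero_measure f) \<phi> = (\<Sum>z\<in>S. real_of_int (zorder f z) * \<phi> z)"
proof -
  have "integral\<^sup>L (zero_measure f) \<phi> = (\<Sum>z\<in>S. real (if f holomorphic_on unit_disk \<and> f z = 0 then nat (zorder f z) else 0) * \<phi> z)"
    unfolding zero_measure_def using S supp by (intro integral_multiplicity_measure \<phi>) auto
  also have "\<dots> = (\<Sum>z\<in>S. real_of_int (zorder f z) * \<phi> z)"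
    using S(2) zorder_nonneg_disk[OF f f0] by (intro sum.cong refl) (auto simp: f subset_iff)
  finally show ?thesis .
qed

text \<open>Rouche's theorem on the circle of radius \<delta>, inside the open ball of radius R; the
  zeros of g between the two radii have winding number 0 and drop out.\<close>

lemma hurwitz_zero_count:
  fixes f g :: "complex \<Rightarrow> complex"
  assumes f: "f holomorphic_on ball p R" and g: "g holomorphic_on ball p R" and \<delta>: "0 < \<delta>" "\<delta> < R"
    and fin: "finite {z \<in> ball p R. g z = 0}" and zf: "{z \<in> ball p R. f z = 0} = {p}"
    and less: "\<And>z. z \<in> sphere p \<delta> \<Longrightarrow> cmod (g z - f z) < cmod (f z)"
  shows "(\<Sum>z | z \<in> ball p \<delta> \<and> g z = 0. zorder g z) = zorder f p"
proof -
  let ?\<gamma> = "circlepath p \<delta>"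
  have out: "winding_number ?\<gamma> z = 0" if "z \<notin> cball p \<delta>" for z
    using that \<delta> by (intro winding_number_zero_outside[OF _ convex_cball]) auto
  have eq: "(\<lambda>z. f z + (g z - f z)) = g" by auto
  have "(\<Sum>z\<in>{z \<in> ball p R. f z + (g z - f z) = 0}. winding_number ?\<gamma> z * zorder (\<lambda>z. f z + (g z - f z)) z)
      = (\<Sum>z\<in>{z \<in> ball p R. f z = 0}. winding_number ?\<gamma> z * zorder f z)"
  proof (rule Rouche_theorem)
    show "\<forall>z. z \<notin> ball p R \<longrightarrow> winding_number ?\<gamma> z = 0"
      using out \<delta> by auto
    show "finite {z \<in> ball p R. f z + (g z - f z) = 0}" using fin by simp
    show "finite {z \<in> ball p R. f z = 0}" using zf by simp
    show "path_image ?\<gamma> \<subseteq> ball p R" using \<delta> by auto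
    show "\<forall>z\<in>path_image ?\<gamma>. cmod (g z - f z) < cmod (f z)" using less \<delta> by auto
  qed (use f g in \<open>auto intro!: holomorphic_intros\<close>)
  then have "(\<Sum>z\<in>{z \<in> ball p R. g z = 0}. winding_number ?\<gamma> z * zorder g z) = winding_number ?\<gamma> p * zorder f p"
    unfolding zf eq by simp
  also have "winding_number ?\<gamma> p = 1"
    using \<delta> by (simp add: winding_number_circlepath)
  also have "(\<Sum>z\<in>{z \<in> ball p R. g z = 0}. winding_number ?\<gamma> z * zorder g z)
     = (\<Sum>z | z \<in> ball p \<delta> \<and> g z = 0. of_int (zorder g z))"
  proof (rule sum.mono_neutral_cong_right[OF fin])
    show "{z \<in> ball p \<delta>. g z = 0} \<subseteq> {z \<in> ball p R. g z = 0}" using \<delta> by auto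
    show "\<forall>z\<in>{z \<in> ball p R. g z = 0} - {z \<in> ball p \<delta>. g z = 0}. winding_number ?\<gamma> z * of_int (zorder g z) = 0"
    proof
      fix z assume z: "z \<in> {z \<in> ball p R. g z = 0} - {z \<in> ball p \<delta>. g z = 0}"
      then have "z \<notin> sphere p \<delta>" using less[of z] by auto
      with z have "z \<notin> cball p \<delta>" by auto
      then show "winding_number ?\<gamma> z * of_int (zorder g z) = 0" by (simp add: out)
    qed
    show "winding_number ?\<gamma> z * of_int (zorder g z) = of_int (zorder g z)" if "z \<in> {z \<in> ball p \<delta>. g z = 0}" for z
      using that by (simp add: winding_number_circlepath dist_norm norm_minus_commute)
  qed
  finally have "(of_int (\<Sum>z | z \<in> ball p \<delta> \<and> g z = 0. zorder g z) :: complex) = of_int (zorder f p)"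
    by simp
  then show ?thesis by (simp only: of_int_eq_iff)
qed

lemma test_function_supp:
  assumes "test_function \<phi>"
  obtains r where "0 \<le> r" "r < 1" "\<And>z. z \<in> unit_disk \<Longrightarrow> z \<notin> cball 0 r \<Longrightarrow> \<phi> z = 0"
proof -
  obtain K where K: "compact K" "K \<subseteq> unit_disk" "\<And>z. z \<in> unit_disk \<Longrightarrow> z \<notin> K \<Longrightarrow> \<phi> z = 0"
    using assms by (auto simp: test_function_def)
  show ?thesis
  proof (cases "K = {}")
    case True
    then show ?thesis using that[of 0] K by auto
  next
    case False
    obtain k where k: "k \<in> K" "\<And>z. z \<in> K \<Longrightarrow> norm z \<le> norm k"
      using continuous_attains_sup[OF K(1) False, of norm] by (auto intro: continuous_intros)
    show ?thesis
      using that[of "norm k"] K k by force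
  qed
qed

text \<open>Hurwitz' theorem with multiplicities: in a small ball around each zero of g in the
  support disk, f n eventually has the same total order, and it has no other zeros in that disk.
  Uniform continuity of \<phi> controls the displacement.\<close>

lemma integral_zero_measure_tendsto:
  assumes f: "\<And>n. f n holomorphic_on unit_disk" and g: "g holomorphic_on unit_disk"
    and f0: "\<And>n. f n 0 \<noteq> 0" and g0: "g 0 \<noteq> 0"
    and lim: "\<And>r. 0 \<le> r \<Longrightarrow> r < 1 \<Longrightarrow> uniform_limit (cball 0 r) f g sequentially"
    and \<phi>: "test_function \<phi>"
  shows "(\<lambda>n. integral\<^sup>L (zero_measure (f n)) \<phi>) \<longlonglongrightarrow> integral\<^sup>L (zero_measure g) \<phi>"
proof -
  obtain r where r: "0 \<le> r" "r < 1" and supp: "\<And>z. z \<in> unit_disk \<Longrightarrow> z \<notin> cball 0 r \<Longrightarrow> \<phi> z = 0"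
    using test_function_supp[OF \<phi>] by blast
  have \<phi>c: "continuous_on unit_disk \<phi>" using \<phi> by (simp add: test_function_def)
  \<comment> \<open>Room beyond the support disk, so that balls around zeros near its boundary stay
    in a compact part of the unit disk.\<close>
  define \<rho> where "\<rho> = (1 + r) / 2"
  have \<rho>: "r < \<rho>" "\<rho> < 1" "0 \<le> \<rho>" using r by (auto simp: \<rho>_def)
  define Z' where "Z' = {z \<in> cball 0 \<rho>. g z = 0}"
  define Z where "Z = {z \<in> cball 0 r. g z = 0}"
  have finZ': "finite Z'" unfolding Z'_def by (rule finite_zeros_cball[OF g g0 \<rho>(2)])
  have ZZ': "Z \<subseteq> Z'" using \<rho> by (auto simp: Z_def Z'_def)
  have finZ: "finite Z" using finite_subset[OF ZZ' finZ'] .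
  have "\<exists>d>0. \<forall>z\<in>Z'. \<forall>w\<in>Z'. z \<noteq> w \<longrightarrow> d \<le> dist z w"
  proof (cases "{(z, w) \<in> Z' \<times> Z'. z \<noteq> w} = {}")
    case True
    then show ?thesis by (intro exI[of _ 1]) auto
  next
    case False
    let ?D = "(\<lambda>(z, w). dist z w) ` {(z, w) \<in> Z' \<times> Z'. z \<noteq> w}"
    have fin: "finite ?D" using finZ' by (intro finite_imageI) (auto intro: finite_subset[of _ "Z' \<times> Z'"])
    have "Min ?D \<in> ?D" using fin False by (intro Min_in) auto
    then have "Min ?D > 0" by auto
    moreover have "Min ?D \<le> dist z w" if "z \<in> Z'" "w \<in> Z'" "z \<noteq> w" for z w
      using that fin by (intro Min_le) auto
    ultimately show ?thesis by blast
  qed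
  then obtain d where d: "d > 0" and sep: "\<And>z w. z \<in> Z' \<Longrightarrow> w \<in> Z' \<Longrightarrow> z \<noteq> w \<Longrightarrow> d \<le> dist z w" by blast
  have order_nonneg: "zorder g p \<ge> 0" if "p \<in> Z" for p
    using that r by (intro zorder_nonneg_disk g g0) (auto simp: Z_def)
  \<comment> \<open>The total order of the zeros, plus 1 to make it a positive divisor even if there
    are none.\<close>
  define C where "C = (\<Sum>p\<in>Z. real_of_int (zorder g p)) + 1"
  have C: "C > 0" unfolding C_def by (intro add_nonneg_pos sum_nonneg) (auto simp: order_nonneg)
  show ?thesis
  proof (rule LIMSEQ_I)
    fix e :: real assume e: "e > 0"
    have "uniformly_continuous_on (cball 0 \<rho>) \<phi>"
      using \<rho> by (intro compact_uniformly_continuous continuous_on_subset[OF \<phi>c]) auto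
    then obtain \<eta> where \<eta>: "\<eta> > 0" "\<And>z w. z \<in> cball 0 \<rho> \<Longrightarrow> w \<in> cball 0 \<rho> \<Longrightarrow> dist w z < \<eta> \<Longrightarrow> dist (\<phi> w) (\<phi> z) < e / C"
      unfolding uniformly_continuous_on_def using divide_pos_pos[OF e C] by metis
    \<comment> \<open>The three bounds separate the zeros, control the oscillation of \<phi>, and
      keep the balls of radius 2 \<delta> inside the disk of radius \<rho>.\<close>
    define \<delta> where "\<delta> = min (min (d / 4) (\<eta> / 2)) ((\<rho> - r) / 4)"
    have \<delta>: "\<delta> > 0" "4 * \<delta> \<le> d" "2 * \<delta> \<le> \<eta>" "4 * \<delta> \<le> \<rho> - r"
      using d \<eta> \<rho> by (auto simp: \<delta>_def min_def)
    have sub: "ball p (2 * \<delta>) \<subseteq> cball 0 \<rho>" if "p \<in> Z" for p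
    proof
      fix z assume "z \<in> ball p (2 * \<delta>)"
      then have "dist p z < 2 * \<delta>" by simp
      moreover have "norm p \<le> r" using that by (auto simp: Z_def)
      moreover have "norm z \<le> norm p + dist p z"
        by (metis dist_norm norm_minus_commute norm_triangle_sub)
      ultimately show "z \<in> cball 0 \<rho>" using \<delta> by auto
    qed
    have subD: "ball p (2 * \<delta>) \<subseteq> unit_disk" if "p \<in> Z" for p
      using sub[OF that] \<rho> by auto
    have zg: "{z \<in> ball p (2 * \<delta>). g z = 0} = {p}" if p: "p \<in> Z" for p
    proof -
      have "z = p" if "z \<in> ball p (2 * \<delta>)" "g z = 0" for z
      proof (rule ccontr)
        assume "z \<noteq> p"
        moreover have "z \<in> Z'" using that sub[OF p] by (auto simp: Z'_def)
        ultimately have "d \<le> dist p z" using sep[of p z] p ZZ' by auto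
        then show False using that \<delta> by auto
      qed
      then show ?thesis using p \<delta> by (auto simp: Z_def)
    qed
    \<comment> \<open>On this compact set |g| has a positive lower bound. The first part excludes
      stray zeros of f n; the second consists of the circles for Rouche's theorem.\<close>
    define K where "K = (cball 0 r - (\<Union>p\<in>Z. ball p \<delta>)) \<union> (\<Union>p\<in>Z. sphere p \<delta>)"
    have "compact K"
      unfolding K_def using finZ by (intro compact_Un compact_diff compact_cball open_UN compact_UN) auto
    have K\<rho>: "K \<subseteq> cball 0 \<rho>"
    proof -
      have "sphere p \<delta> \<subseteq> cball 0 \<rho>" if "p \<in> Z" for p
        using sub[OF that] \<delta> by (intro order_trans[OF _ sub[OF that]]) auto
      then show ?thesis using \<rho> by (auto simp: K_def)
    qed
    have gK: "g z \<noteq> 0" if "z \<in> K" for z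
    proof
      assume gz: "g z = 0"
      from that consider "z \<in> cball 0 r" "z \<notin> (\<Union>p\<in>Z. ball p \<delta>)" | p where "p \<in> Z" "z \<in> sphere p \<delta>"
        by (auto simp: K_def)
      then show False
      proof cases
        case 1
        then have "z \<in> Z" using gz by (auto simp: Z_def)
        with 1 \<delta> show False by auto
      next
        case 2
        then have "z \<in> {z \<in> ball p (2 * \<delta>). g z = 0}" using gz \<delta> by auto
        with zg[OF 2(1)] 2 \<delta> show False by auto
      qed
    qed
    have "\<exists>m>0. \<forall>z\<in>K. m \<le> cmod (g z)"
    proof (cases "K = {}")
      case True
      then show ?thesis by (intro exI[of _ 1]) auto
    next
      case False
      have "continuous_on K (\<lambda>z. cmod (g z))"
        using K\<rho> \<rho> by (intro continuous_intros continuous_on_subset[OF holomorphic_on_imp_continuous_on[OF g]]) auto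
      then obtain k where "k \<in> K" "\<And>z. z \<in> K \<Longrightarrow> cmod (g k) \<le> cmod (g z)"
        using continuous_attains_inf[OF \<open>compact K\<close> False] by blast
      then show ?thesis using gK[of k] by (intro exI[of _ "cmod (g k)"]) auto
    qed
    then obtain m where m: "m > 0" "\<And>z. z \<in> K \<Longrightarrow> m \<le> cmod (g z)" by blast
    have "\<forall>\<^sub>F n in sequentially. \<forall>z\<in>cball 0 \<rho>. dist (f n z) (g z) < m"
      using lim[OF \<rho>(3,2)] m(1) by (auto simp: uniform_limit_iff)
    then have "\<exists>n0. \<forall>n\<ge>n0. \<forall>z\<in>cball 0 \<rho>. cmod (f n z - g z) < m"
      by (simp add: eventually_sequentially dist_norm)
    then obtain n0 where n0: "\<And>n z. n \<ge> n0 \<Longrightarrow> z \<in> cball 0 \<rho> \<Longrightarrow> cmod (f n z - g z) < m"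
      by blast
    have "norm (integral\<^sup>L (zero_measure (f n)) \<phi> - integral\<^sup>L (zero_measure g) \<phi>) < e" if n: "n \<ge> n0" for n
    proof -
      define W where "W p = {z \<in> ball p \<delta>. f n z = 0}" for p
      have finf: "finite {z \<in> cball 0 \<rho>. f n z = 0}" by (rule finite_zeros_cball[OF f f0 \<rho>(2)])
      have WD: "W p \<subseteq> {z \<in> cball 0 \<rho>. f n z = 0}" if "p \<in> Z" for p
      proof -
        have "ball p \<delta> \<subseteq> ball p (2 * \<delta>)" using \<delta> by auto
        then show ?thesis using sub[OF that] unfolding W_def by blast
      qed
      have finW: "finite (W p)" if "p \<in> Z" for p
        using finite_subset[OF WD[OF that] finf] .
      have less: "cmod (f n z - g z) < cmod (g z)" if "z \<in> K" for z
        using n0[OF n, of z] m(2)[OF that] K\<rho> that by force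
      have count: "(\<Sum>z\<in>W p. zorder (f n) z) = zorder g p" if p: "p \<in> Z" for p
        unfolding W_def
      proof (rule hurwitz_zero_count[where R="2 * \<delta>"])
        show "g holomorphic_on ball p (2 * \<delta>)" "f n holomorphic_on ball p (2 * \<delta>)"
          using holomorphic_on_subset[OF g subD[OF p]] holomorphic_on_subset[OF f subD[OF p]] by auto
        show "finite {z \<in> ball p (2 * \<delta>). f n z = 0}"
          using sub[OF p] by (intro finite_subset[OF _ finf]) auto
        show "cmod (f n z - g z) < cmod (g z)" if "z \<in> sphere p \<delta>" for z
          using that p by (intro less) (auto simp: K_def)
      qed (use \<delta> zg[OF p] in auto)
      have disj: "W p \<inter> W q = {}" if "p \<in> Z" "q \<in> Z" "p \<noteq> q" for p q
      proof -
        have "d \<le> dist p q" using that ZZ' sep by auto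
        show ?thesis
        proof (rule ccontr)
          assume "W p \<inter> W q \<noteq> {}"
          then obtain z where "dist p z < \<delta>" "dist q z < \<delta>" by (auto simp: W_def)
          then have "dist p q < 2 * \<delta>" using dist_triangle2[of p q z] by simp
          then show False using \<open>d \<le> dist p q\<close> \<delta> by simp
        qed
      qed
      have "integral\<^sup>L (zero_measure (f n)) \<phi> = (\<Sum>z\<in>(\<Union>p\<in>Z. W p). real_of_int (zorder (f n) z) * \<phi> z)"
      proof (rule integral_zero_measure[OF f f0 \<phi>c])
        show "finite (\<Union>p\<in>Z. W p)" using finZ finW by auto
        show "(\<Union>p\<in>Z. W p) \<subseteq> {z \<in> unit_disk. f n z = 0}"
          using WD \<rho> by fastforce
        fix z assume z: "z \<in> unit_disk" "f n z = 0" "z \<notin> (\<Union>p\<in>Z. W p)"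
        show "\<phi> z = 0"
        proof (rule supp[OF z(1)])
          show "z \<notin> cball 0 r"
          proof
            assume "z \<in> cball 0 r"
            with z have "z \<in> K" by (auto simp: K_def W_def)
            from less[OF this] z show False by simp
          qed
        qed
      qed
      also have "\<dots> = (\<Sum>p\<in>Z. \<Sum>z\<in>W p. real_of_int (zorder (f n) z) * \<phi> z)"
        using finZ finW disj by (intro sum.UNION_disjoint) auto
      finally have 1: "integral\<^sup>L (zero_measure (f n)) \<phi> = (\<Sum>p\<in>Z. \<Sum>z\<in>W p. real_of_int (zorder (f n) z) * \<phi> z)" .
      have "integral\<^sup>L (zero_measure g) \<phi> = (\<Sum>p\<in>Z. real_of_int (zorder g p) * \<phi> p)"
        using finZ r by (intro integral_zero_measure[OF g g0 \<phi>c] supp) (auto simp: Z_def)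
      also have "\<dots> = (\<Sum>p\<in>Z. \<Sum>z\<in>W p. real_of_int (zorder (f n) z) * \<phi> p)"
        by (intro sum.cong refl) (simp add: sum_distrib_right[symmetric] count of_int_sum[symmetric] del: of_int_sum)
      finally have "integral\<^sup>L (zero_measure (f n)) \<phi> - integral\<^sup>L (zero_measure g) \<phi>
         = (\<Sum>p\<in>Z. \<Sum>z\<in>W p. real_of_int (zorder (f n) z) * (\<phi> z - \<phi> p))"
        using 1 by (simp add: right_diff_distrib sum_subtractf)
      also have "norm \<dots> \<le> (\<Sum>p\<in>Z. \<Sum>z\<in>W p. real_of_int (zorder (f n) z) * (e / C))"
      proof (intro sum_norm_le)
        fix p z assume p: "p \<in> Z" and z: "z \<in> W p"
        have ge: "zorder (f n) z \<ge> 0"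
          using z WD[OF p] \<rho> by (intro zorder_nonneg_disk f f0) auto
        have "dist (\<phi> z) (\<phi> p) < e / C"
          using p z WD[OF p] \<delta> ZZ' by (intro \<eta>(2)) (auto simp: Z'_def W_def dist_commute)
        then show "norm (real_of_int (zorder (f n) z) * (\<phi> z - \<phi> p)) \<le> real_of_int (zorder (f n) z) * (e / C)"
          unfolding real_norm_def abs_mult using ge
          by (intro mult_mono) (auto simp: dist_real_def)
      qed
      also have "\<dots> = (\<Sum>p\<in>Z. real_of_int (zorder g p)) * (e / C)"
        unfolding sum_distrib_right[symmetric]
        by (simp add: sum_distrib_right[symmetric] count of_int_sum[symmetric] del: of_int_sum)
      also have "\<dots> < C * (e / C)"
        using e C by (intro mult_strict_right_mono) (auto simp: C_def)
      also have "\<dots> = e" using C by simp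
      finally show ?thesis .
    qed
    then show "\<exists>no. \<forall>n\<ge>no. norm (integral\<^sup>L (zero_measure (f n)) \<phi> - integral\<^sup>L (zero_measure g) \<phi>) < e"
      by blast
  qed
qed

text \<open>\<open>phi\<close> reads its coefficients from index 1 on. After the shift the
  coefficient sequences are the points of the product space over all natural numbers.\<close>

definition disk_series :: "complex \<Rightarrow> (nat \<Rightarrow> complex) \<Rightarrow> complex \<Rightarrow> complex" where
  "disk_series a y = phi a (\<lambda>k. y (k - 1))"

lemma disk_series_eq: "disk_series a y z = a - (\<Sum>k. y k * z ^ Suc k)"
  by (simp add: disk_series_def phi_def)

lemma phi_eq_disk_series: "phi a c = disk_series a (\<lambda>k. c (Suc k))"
  by (simp add: fun_eq_iff disk_series_eq phi_def)

lemma disk_series_0 [simp]: "disk_series a y 0 = a"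
  by (simp add: disk_series_eq)

definition disk_summable :: "(nat \<Rightarrow> 'a::real_normed_vector) \<Rightarrow> bool" where
  "disk_summable y \<longleftrightarrow> (\<forall>r\<in>{0..<1}. summable (\<lambda>k. norm (y k) * r ^ k))"

text \<open>Only countably many conditions, for the sake of measurability.\<close>

lemma disk_summable_iff:
  "disk_summable y \<longleftrightarrow> (\<forall>j::nat. \<exists>B::nat. \<forall>k. norm (y k) * (1 - 1 / (real j + 2)) ^ k \<le> real B)"
proof
  assume y: "disk_summable y"
  show "\<forall>j::nat. \<exists>B::nat. \<forall>k. norm (y k) * (1 - 1 / (real j + 2)) ^ k \<le> real B"
  proof
    fix j :: nat
    let ?r = "1 - 1 / (real j + 2)"
    have r: "?r \<in> {0..<1}" by (simp add: field_simps)
    then have s: "summable (\<lambda>k. norm (y k) * ?r ^ k)" using y by (auto simp: disk_summable_def)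
    from real_nat_ceiling_ge[of "\<Sum>k. norm (y k) * ?r ^ k"]
    have "norm (y k) * ?r ^ k \<le> real (nat \<lceil>\<Sum>k. norm (y k) * ?r ^ k\<rceil>)" for k
      using sum_le_suminf[OF s, of "{k}"] r by force
    then show "\<exists>B::nat. \<forall>k. norm (y k) * ?r ^ k \<le> real B" by blast
  qed
next
  assume B: "\<forall>j::nat. \<exists>B::nat. \<forall>k. norm (y k) * (1 - 1 / (real j + 2)) ^ k \<le> real B"
  show "disk_summable y"
    unfolding disk_summable_def
  proof
    fix r :: real assume r: "r \<in> {0..<1}"
    \<comment> \<open>A radius q of the countable family strictly between r and 1: boundedness at q
      gives geometric domination with ratio r / q at r.\<close>
    obtain j :: nat where "1 / (1 - r) < real j" using reals_Archimedean2 by blast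
    define q where "q = 1 - 1 / (real j + 2)"
    have "1 / (1 - r) < real j + 2" using \<open>1 / (1 - r) < real j\<close> by simp
    then have q: "r < q" "0 < q" using r by (auto simp: q_def field_simps)
    obtain C :: nat where C: "\<And>k. norm (y k) * q ^ k \<le> C" using B[rule_format, of j] by (auto simp: q_def)
    show "summable (\<lambda>k. norm (y k) * r ^ k)"
    proof (rule summable_comparison_test')
      show "summable (\<lambda>k. C * (r / q) ^ k)" using r q by (intro summable_mult summable_geometric) auto
      show "norm (norm (y k) * r ^ k) \<le> C * (r / q) ^ k" for k
      proof -
        have "norm (y k) * r ^ k = (norm (y k) * q ^ k) * (r / q) ^ k"
          using q by (simp add: power_divide)
        also have "\<dots> \<le> C * (r / q) ^ k" using r q by (intro mult_right_mono C) auto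
        finally show ?thesis using r by simp
      qed
    qed
  qed
qed

lemma disk_summable_terms:
  fixes y :: "nat \<Rightarrow> complex"
  assumes "disk_summable y" "cmod z < 1"
  shows "summable (\<lambda>k. norm (y k * z ^ Suc k))"
proof -
  have "summable (\<lambda>k. norm (y k) * cmod z ^ k * cmod z)"
    using assms by (intro summable_mult2) (auto simp: disk_summable_def)
  then show ?thesis by (simp add: norm_mult norm_power mult_ac)
qed

lemma disk_series_holomorphic:
  assumes "disk_summable y"
  shows "disk_series a y holomorphic_on unit_disk"
proof -
  have "(\<lambda>z. \<Sum>k. y k * z ^ k) holomorphic_on unit_disk"
  proof (rule power_series_holomorphic)
    fix w :: complex assume w: "w \<in> ball 0 1"
    have "summable (\<lambda>k. norm (y k * w ^ k))"
      using assms w by (auto simp: disk_summable_def norm_mult norm_power)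
    then show "(\<lambda>k. y k * (w - 0) ^ k) sums (\<Sum>k. y k * w ^ k)"
      by (simp add: summable_norm_cancel summable_sums)
  qed
  then have "(\<lambda>z. a - z * (\<Sum>k. y k * z ^ k)) holomorphic_on unit_disk"
    by (intro holomorphic_intros)
  moreover have "disk_series a y z = a - z * (\<Sum>k. y k * z ^ k)" if z: "z \<in> unit_disk" for z
  proof -
    have "summable (\<lambda>k. norm (y k * z ^ k))"
      using assms z by (auto simp: disk_summable_def norm_mult norm_power)
    from suminf_mult[OF summable_norm_cancel[OF this], of z]
    show ?thesis by (simp add: disk_series_eq mult_ac)
  qed
  ultimately show ?thesis
    by (subst holomorphic_cong[OF refl]) auto
qed

text \<open>A series that diverges somewhere in the disk has the same junk value wherever it diverges,
  hence on an annulus; being holomorphic it would be the constant \<open>a\<close>.\<close>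

lemma zero_measure_not_disk_summable:
  fixes \<phi> :: "complex \<Rightarrow> real"
  assumes y: "\<not> disk_summable y" and a: "a \<noteq> 0" and \<phi>: "continuous_on unit_disk \<phi>"
  shows "integral\<^sup>L (zero_measure (disk_series a y)) \<phi> = 0"
proof -
  have "\<not> (disk_series a y holomorphic_on unit_disk \<and> disk_series a y z = 0)" if z: "z \<in> unit_disk" for z
  proof
    assume h: "disk_series a y holomorphic_on unit_disk \<and> disk_series a y z = 0"
    obtain r where r: "0 \<le> r" "r < 1" "\<not> summable (\<lambda>k. norm (y k) * r ^ k)"
      using y by (auto simp: disk_summable_def)
    have div: "\<not> summable (\<lambda>k. y k * w ^ Suc k)" if w: "r < cmod w" for w
    proof
      assume s: "summable (\<lambda>k. y k * w ^ Suc k)"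
      have w0: "w \<noteq> 0" using w r by auto
      from summable_mult[OF s, of "1 / w"] have "summable (\<lambda>k. y k * w ^ k)"
        using w0 by simp
      from powser_insidea[OF this, of "of_real r"] w r have "summable (\<lambda>k. norm (y k) * r ^ k)"
        by (simp add: norm_mult norm_power)
      with r show False by simp
    qed
    have const: "disk_series a y w = a - (THE s. False)" if "r < cmod w" for w
    proof -
      have "(\<lambda>s. (\<lambda>k. y k * w ^ Suc k) sums s) = (\<lambda>s. False)"
        using div[OF that] unfolding summable_def by blast
      then have "suminf (\<lambda>k. y k * w ^ Suc k) = (THE s. False)"
        unfolding suminf_def by (rule arg_cong)
      then show ?thesis by (simp add: disk_series_eq)
    qed
    define g where "g w = disk_series a y w - (a - (THE s. False))" for w
    have "g w = 0" if w: "w \<in> unit_disk" for w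
    proof (rule analytic_continuation_open[of "ball 0 1 - cball 0 r" "ball 0 1" g "\<lambda>_. 0" w])
      show "open (ball 0 1 - cball (0::complex) r)" by auto
      have "of_real ((1 + r) / 2) \<in> ball 0 1 - cball (0::complex) r"
        using r by (auto simp del: of_real_add of_real_divide)
      then show "ball 0 1 - cball (0::complex) r \<noteq> {}" by blast
      show "g holomorphic_on ball 0 1" unfolding g_def using h by (intro holomorphic_intros) auto
      show "g z = 0" if "z \<in> ball 0 1 - cball (0::complex) r" for z
        using that const[of z] by (auto simp: g_def)
    qed (use w in auto)
    from this[of z] this[of 0] z h a show False by (simp add: g_def)
  qed
  then show ?thesis
    unfolding zero_measure_def by (subst integral_multiplicity_measure[OF \<phi>, of "{}"]) auto
qed

lemma disk_summable_dominated:
  fixes x :: "nat \<Rightarrow> complex"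
  assumes sb: "disk_summable (b :: nat \<Rightarrow> real)" and "\<And>k. cmod (x k) \<le> b k"
  shows "disk_summable x"
  unfolding disk_summable_def
proof
  fix q :: real assume q: "q \<in> {0..<1}"
  show "summable (\<lambda>k. norm (x k) * q ^ k)"
  proof (rule summable_comparison_test')
    show "summable (\<lambda>k. norm (b k) * q ^ k)" using sb q by (auto simp: disk_summable_def)
    show "norm (norm (x k) * q ^ k) \<le> norm (b k) * q ^ k" for k
      using assms(2)[of k] q by (auto simp: abs_mult intro!: mult_right_mono)
  qed
qed

text \<open>The second formal derivative of the geometric series has coefficients (k+1)(k+2), which
  dominate (k+1)^2. These are the bounds that define \<open>seq_box\<close>.\<close>

lemma disk_summable_square: "disk_summable (\<lambda>k. M * (real k + 1)\<^sup>2)"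
  unfolding disk_summable_def
proof
  fix r :: real assume r: "r \<in> {0..<1}"
  have 1: "summable (\<lambda>n. diffs (\<lambda>_. 1) n * x ^ n)" if "norm x < 1" for x :: real
    by (rule termdiff_converges[OF that]) (simp add: summable_geometric)
  have 2: "summable (\<lambda>n. diffs (diffs (\<lambda>_. 1)) n * r ^ n)"
    by (rule termdiff_converges[where K=1]) (use r 1 in auto)
  show "summable (\<lambda>k. norm (M * (real k + 1)\<^sup>2) * r ^ k)"
  proof (rule summable_comparison_test')
    show "summable (\<lambda>k. \<bar>M\<bar> * (diffs (diffs (\<lambda>_. 1)) k * r ^ k))"
      using 2 by (rule summable_mult)
    show "norm (norm (M * (real k + 1)\<^sup>2) * r ^ k) \<le> \<bar>M\<bar> * (diffs (diffs (\<lambda>_. 1)) k * r ^ k)" for k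
    proof -
      have "(real k + 1)\<^sup>2 \<le> diffs (diffs (\<lambda>_. 1)) k"
        by (simp add: diffs_def power2_eq_square algebra_simps)
      then have "\<bar>M\<bar> * ((real k + 1)\<^sup>2 * r ^ k) \<le> \<bar>M\<bar> * (diffs (diffs (\<lambda>_. 1)) k * r ^ k)"
        using r by (intro mult_left_mono mult_right_mono) auto
      then show ?thesis using r by (simp add: abs_mult mult_ac)
    qed
  qed
qed

lemma disk_summable_bounded:
  fixes y :: "nat \<Rightarrow> complex"
  assumes y: "\<And>k. cmod (y k) \<le> B"
  shows "disk_summable y"
proof (rule disk_summable_dominated[OF disk_summable_square])
  fix k
  have "B \<ge> 0" using y[of 0] norm_ge_zero order_trans by blast
  then have "B * 1 \<le> B * (real k + 1)\<^sup>2" by (intro mult_left_mono) auto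
  then show "cmod (y k) \<le> B * (real k + 1)\<^sup>2" using y[of k] by simp
qed

text \<open>On the disk the difference is bounded by the sum of |y n k - y0 k| r^(k+1), which no
  longer depends on z; Tannery's theorem with majorant 2 b k r^(k+1) sends it to 0.\<close>

lemma disk_series_uniform_limit:
  fixes y :: "nat \<Rightarrow> nat \<Rightarrow> complex"
  assumes lim: "\<And>k. (\<lambda>n. y n k) \<longlonglongrightarrow> y0 k" and b: "\<And>n k. cmod (y n k) \<le> b k"
    and sb: "disk_summable (b :: nat \<Rightarrow> real)" and r: "0 \<le> r" "r < 1"
  shows "uniform_limit (cball 0 r) (\<lambda>n. disk_series a (y n)) (disk_series a y0) sequentially"
proof -
  have b0: "b k \<ge> 0" for k using b[of 0 k] norm_ge_zero order_trans by blast
  have y0: "cmod (y0 k) \<le> b k" for k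
    using tendsto_norm[OF lim[of k]] by (rule LIMSEQ_le_const2) (use b in blast)
  have sumb: "summable (\<lambda>k. b k * r ^ k)" using sb r b0 by (auto simp: disk_summable_def)
  define S where "S n = (\<Sum>k. cmod (y n k - y0 k) * r ^ Suc k)" for n
  have le: "cmod (y n k - y0 k) \<le> 2 * b k" for n k
    using norm_triangle_ineq4[of "y n k" "y0 k"] b[of n k] y0[of k] by simp
  have sum2: "summable (\<lambda>k. 2 * r * (b k * r ^ k))" using sumb by (intro summable_mult)
  have bound: "norm (cmod (y n k - y0 k) * r ^ Suc k) \<le> 2 * r * (b k * r ^ k)" for n k
  proof -
    have "cmod (y n k - y0 k) * r ^ Suc k \<le> (2 * b k) * r ^ Suc k"
      using le r by (intro mult_right_mono) auto
    then show ?thesis using r by (simp add: mult_ac)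
  qed
  have sumS: "summable (\<lambda>k. cmod (y n k - y0 k) * r ^ Suc k)" for n
    by (rule summable_comparison_test'[OF sum2]) (use bound in auto)
  have "(S \<longlongrightarrow> (\<Sum>k. 0)) sequentially"
    unfolding S_def
  proof (rule tannerys_theorem[THEN conjunct2, THEN conjunct2])
    show "(\<lambda>n. cmod (y n k - y0 k) * r ^ Suc k) \<longlonglongrightarrow> 0" for k
      using tendsto_mult_right[OF tendsto_norm[OF tendsto_diff[OF lim[of k] tendsto_const[of "y0 k"]]], of "r ^ Suc k"] by simp
    show "\<forall>\<^sub>F (k, n) in sequentially \<times>\<^sub>F sequentially. norm (cmod (y n k - y0 k) * r ^ Suc k) \<le> 2 * r * (b k * r ^ k)"
      using bound by (intro always_eventually) auto
  qed (use sum2 in auto)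
  then have S0: "S \<longlonglongrightarrow> 0" by simp
  have close: "cmod (disk_series a (y n) z - disk_series a y0 z) \<le> S n" if z: "z \<in> cball 0 r" for n z
  proof -
    have z1: "cmod z < 1" using z r by auto
    have s: "summable (\<lambda>k. norm (y n k * z ^ Suc k))" "summable (\<lambda>k. norm (y0 k * z ^ Suc k))"
      using disk_summable_terms[OF disk_summable_dominated[OF sb] z1] b y0 by auto
    have s': "summable (\<lambda>k. norm ((y n k - y0 k) * z ^ Suc k))"
    proof (rule summable_comparison_test'[OF sumS[of n]])
      show "norm (norm ((y n k - y0 k) * z ^ Suc k)) \<le> cmod (y n k - y0 k) * r ^ Suc k" for k
      proof -
        have "norm ((y n k - y0 k) * z ^ Suc k) \<le> cmod (y n k - y0 k) * r ^ Suc k"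
          unfolding norm_mult norm_power using z r by (intro mult_left_mono power_mono) auto
        then show ?thesis by simp
      qed
    qed
    have "disk_series a (y n) z - disk_series a y0 z = - (\<Sum>k. (y n k - y0 k) * z ^ Suc k)"
      using suminf_diff[OF summable_norm_cancel[OF s(1)] summable_norm_cancel[OF s(2)]]
      by (simp add: disk_series_eq algebra_simps)
    also have "cmod \<dots> \<le> (\<Sum>k. norm ((y n k - y0 k) * z ^ Suc k))"
      using summable_norm[OF s'] by simp
    also have "\<dots> \<le> S n"
      unfolding S_def
    proof (rule suminf_le[OF _ s' sumS])
      show "norm ((y n k - y0 k) * z ^ Suc k) \<le> cmod (y n k - y0 k) * r ^ Suc k" for k
        unfolding norm_mult norm_power using z r by (intro mult_left_mono power_mono) auto
    qed
    finally show ?thesis .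
  qed
  show ?thesis
  proof (rule uniform_limitI)
    fix e :: real assume "e > 0"
    then have "\<forall>\<^sub>F n in sequentially. S n < e"
      using order_tendstoD(2)[OF S0] by auto
    then show "\<forall>\<^sub>F n in sequentially. \<forall>z\<in>cball 0 r. dist (disk_series a (y n) z) (disk_series a y0 z) < e"
      by eventually_elim (metis close dist_norm le_less_trans)
  qed
qed

definition zero_stat :: "(complex \<Rightarrow> real) \<Rightarrow> complex \<Rightarrow> (nat \<Rightarrow> complex) \<Rightarrow> real" where
  "zero_stat \<phi> a y = integral\<^sup>L (zero_measure (disk_series a y)) \<phi>"

text \<open>Coordinatewise convergence alone would not do: a single coefficient 4^n at index n tends
  to 0 in each coordinate and creates n + 1 zeros near the circle of radius 1/4. The common majorant
  excludes this.\<close>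

lemma zero_stat_tendsto:
  fixes y :: "nat \<Rightarrow> nat \<Rightarrow> complex"
  assumes \<phi>: "test_function \<phi>" and a: "a \<noteq> 0"
    and lim: "\<And>k. (\<lambda>n. y n k) \<longlonglongrightarrow> y0 k" and b: "\<And>n k. cmod (y n k) \<le> b k"
    and sb: "disk_summable (b :: nat \<Rightarrow> real)"
  shows "(\<lambda>n. zero_stat \<phi> a (y n)) \<longlonglongrightarrow> zero_stat \<phi> a y0"
  unfolding zero_stat_def
proof (rule integral_zero_measure_tendsto)
  have "cmod (y0 k) \<le> b k" for k
    using tendsto_norm[OF lim[of k]] by (rule LIMSEQ_le_const2) (use b in blast)
  then show "disk_series a y0 holomorphic_on unit_disk"
    by (intro disk_series_holomorphic disk_summable_dominated[OF sb])
  show "disk_series a (y n) holomorphic_on unit_disk" for n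
    by (intro disk_series_holomorphic disk_summable_dominated[OF sb] b)
qed (use a \<phi> in \<open>auto intro!: disk_series_uniform_limit[OF lim b sb]\<close>)

definition truncate_seq :: "nat \<Rightarrow> (nat \<Rightarrow> complex) \<Rightarrow> nat \<Rightarrow> complex" where
  "truncate_seq m y k = (if k < m then y k else 0)"

text \<open>With finitely many coordinates left, every convergent sequence has a majorant, so the
  truncated functional is continuous on the whole product space.\<close>

lemma continuous_zero_stat_truncate:
  assumes \<phi>: "test_function \<phi>" and a: "a \<noteq> 0"
  shows "continuous_on UNIV (\<lambda>y. zero_stat \<phi> a (truncate_seq m y))"
proof -
  have "((\<lambda>y. zero_stat \<phi> a (truncate_seq m y)) \<circ> x) \<longlonglongrightarrow> zero_stat \<phi> a (truncate_seq m y)"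
    if x: "x \<longlonglongrightarrow> y" for x :: "nat \<Rightarrow> nat \<Rightarrow> complex" and y
  proof -
    have lim: "(\<lambda>n. x n k) \<longlonglongrightarrow> y k" for k
      using continuous_on_tendsto_compose[OF continuous_on_product_coordinates x, of k] by auto
    have "\<exists>B. \<forall>n. cmod (x n k) \<le> B" for k
      using convergent_imp_Bseq[OF convergentI[OF lim[of k]]] by (auto simp: Bseq_def)
    then obtain B where B: "\<And>n k. cmod (x n k) \<le> B k" by metis
    define b where "b k = (if k < m then B k else 0)" for k
    have "summable (\<lambda>k. norm (b k) * r ^ k)" for r
      by (rule summable_finite[of "{..<m}"]) (auto simp: b_def)
    then have sb: "disk_summable b" by (simp add: disk_summable_def)
    show ?thesis
      unfolding comp_def
    proof (rule zero_stat_tendsto[OF \<phi> a _ _ sb])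
      show "(\<lambda>n. truncate_seq m (x n) k) \<longlonglongrightarrow> truncate_seq m y k" for k
        using lim by (simp add: truncate_seq_def)
      show "cmod (truncate_seq m (x n) k) \<le> b k" for n k
        using B by (simp add: truncate_seq_def b_def)
    qed
  qed
  then show ?thesis
    by (auto simp: continuous_on_sequentially)
qed

text \<open>On the measurable set of series converging in the disk the functional is the limit of
  its continuous truncations; off this set it is 0 by
  \<open>zero_measure_not_disk_summable\<close>.\<close>

lemma borel_measurable_zero_stat:
  assumes \<phi>: "test_function \<phi>" and a: "a \<noteq> 0"
  shows "zero_stat \<phi> a \<in> borel_measurable borel"
proof -
  have [measurable]: "(\<lambda>y::nat \<Rightarrow> complex. y k) \<in> borel_measurable borel" for k
    by (intro borel_measurable_continuous_onI continuous_on_product_coordinates)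
  have [measurable]: "(\<lambda>y. zero_stat \<phi> a (truncate_seq m y)) \<in> borel_measurable borel" for m
    by (intro borel_measurable_continuous_onI continuous_zero_stat_truncate assms)
  have [measurable]: "Measurable.pred borel (disk_summable :: (nat \<Rightarrow> complex) \<Rightarrow> bool)"
    unfolding disk_summable_iff[abs_def] by measurable
  have "zero_stat \<phi> a = (\<lambda>y. if disk_summable y then lim (\<lambda>m. zero_stat \<phi> a (truncate_seq m y)) else 0)"
  proof
    fix y
    show "zero_stat \<phi> a y = (if disk_summable y then lim (\<lambda>m. zero_stat \<phi> a (truncate_seq m y)) else 0)"
    proof (cases "disk_summable y")
      case True
      then have sb: "disk_summable (\<lambda>k. cmod (y k))" by (simp add: disk_summable_def)
      have "(\<lambda>m. zero_stat \<phi> a (truncate_seq m y)) \<longlonglongrightarrow> zero_stat \<phi> a y"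
      proof (rule zero_stat_tendsto[OF \<phi> a _ _ sb])
        show "(\<lambda>m. truncate_seq m y k) \<longlonglongrightarrow> y k" for k
          by (rule tendsto_eventually) (auto simp: truncate_seq_def eventually_sequentially intro!: exI[of _ "Suc k"])
      qed (auto simp: truncate_seq_def)
      then show ?thesis using True by (simp add: limI)
    qed (use \<phi> in \<open>simp add: zero_stat_def zero_measure_not_disk_summable a test_function_def\<close>)
  qed
  also have "\<dots> \<in> borel_measurable borel" by measurable
  finally show ?thesis .
qed


subsection \<open>The eigenvalues as zeros of a power series\<close>

text \<open>Sylvester's identity, from two factorizations of the block matrix with rows (1, -A) and
  (B, 1) into block triangular matrices.\<close>

lemma det_one_plus_mult_commute:
  fixes A B :: "complex mat"
  assumes A: "A \<in> carrier_mat n m" and B: "B \<in> carrier_mat m n"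
  shows "det (1\<^sub>m n + A * B) = det (1\<^sub>m m + B * A)"
proof -
  let ?L = "four_block_mat (1\<^sub>m n) (0\<^sub>m n m) B (1\<^sub>m m)"
  let ?U = "four_block_mat (1\<^sub>m n) (- A) (0\<^sub>m m n) (1\<^sub>m m + B * A)"
  let ?U' = "four_block_mat (1\<^sub>m n + A * B) (- A) (0\<^sub>m m n) (1\<^sub>m m)"
  have c: "A * B \<in> carrier_mat n n" "B * A \<in> carrier_mat m m" "- A \<in> carrier_mat n m"
    using A B by auto
  have L: "?L \<in> carrier_mat (n + m) (n + m)" and U: "?U \<in> carrier_mat (n + m) (n + m)"
    and U': "?U' \<in> carrier_mat (n + m) (n + m)"
    using A B c by (auto intro!: four_block_carrier_mat)
  have BA: "B * - A = - (B * A)" "- A * B = - (A * B)"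
    using A B by auto
  have "?L * ?U = four_block_mat (1\<^sub>m n) (- A) B (1\<^sub>m m)"
    using A B c by (subst mult_four_block_mat[of _ n n _ m _ m _ _ n _ m])
      (auto simp: BA intro!: arg_cong[of _ _ "four_block_mat _ _ _"] eq_matI)
  moreover have "?U' * ?L = four_block_mat (1\<^sub>m n) (- A) B (1\<^sub>m m)"
    using A B c by (subst mult_four_block_mat[of _ n n _ m _ m _ _ n _ m])
      (auto simp: BA intro!: arg_cong[of _ _ "\<lambda>X. four_block_mat X _ _ _"] eq_matI)
  ultimately have "det ?L * det ?U = det ?U' * det ?L"
    by (metis det_mult L U U')
  moreover have "det ?L = 1"
    using B by (subst det_four_block_mat_upper_right_zero[of _ n _ m]) auto
  moreover have "det ?U = det (1\<^sub>m m + B * A)"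
    using A B c by (subst det_four_block_mat_lower_left_zero[of _ n _ m]) auto
  moreover have "det ?U' = det (1\<^sub>m n + A * B)"
    using A B c by (subst det_four_block_mat_lower_left_zero[of _ n _ m]) auto
  ultimately show ?thesis by simp
qed

definition outer_prod :: "nat \<Rightarrow> complex vec \<Rightarrow> complex vec \<Rightarrow> complex mat" where
  "outer_prod N y x = mat N N (\<lambda>(i, j). vec_index y i * cnj (vec_index x j))"

lemma outer_prod_carrier [simp]: "outer_prod N y x \<in> carrier_mat N N"
  by (simp add: outer_prod_def)

lemma outer_prod_self: "outer_prod N x x = outer_self N x"
  by (simp add: outer_prod_def outer_self_def)

lemma mult_outer_prod:
  assumes "M \<in> carrier_mat N N" "y \<in> carrier_vec N"
  shows "M * outer_prod N y x = outer_prod N (M *\<^sub>v y) x"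
  using assms by (intro eq_matI)
    (auto simp: outer_prod_def scalar_prod_def sum_distrib_right mult.assoc intro!: sum.cong)

lemma det_one_plus_outer_prod:
  assumes x: "x \<in> carrier_vec N" and y: "y \<in> carrier_vec N"
  shows "det (1\<^sub>m N + c \<cdot>\<^sub>m outer_prod N y x) = 1 + c * (y \<bullet>c x)"
proof -
  define A where "A = mat N 1 (\<lambda>(i, _). c * vec_index y i)"
  define B where "B = mat 1 N (\<lambda>(_, j). cnj (vec_index x j))"
  have AB: "A \<in> carrier_mat N 1" "B \<in> carrier_mat 1 N" by (auto simp: A_def B_def)
  have "c \<cdot>\<^sub>m outer_prod N y x = A * B"
    by (intro eq_matI) (auto simp: outer_prod_def A_def B_def scalar_prod_def)
  then have "det (1\<^sub>m N + c \<cdot>\<^sub>m outer_prod N y x) = det (1\<^sub>m 1 + B * A)"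
    using det_one_plus_mult_commute[OF AB] by simp
  also have "\<dots> = (1\<^sub>m 1 + B * A) $$ (0, 0)"
    using AB by (intro det_single) auto
  also have "\<dots> = 1 + c * (y \<bullet>c x)"
    using x y by (simp add: A_def B_def scalar_prod_def cscalar_prod_sum[of x N] sum_distrib_left lessThan_atLeast0 mult_ac)
  finally show ?thesis .
qed

lemma unitary_eigenvalue_norm:
  assumes V: "V \<in> unitary_mats N" and "eigenvalue V z"
  shows "cmod z = 1"
proof -
  obtain y where y: "y \<in> carrier_vec N" "y \<noteq> 0\<^sub>v N" "V *\<^sub>v y = z \<cdot>\<^sub>v y"
    using assms unitary_mats_carrier[OF V] by (auto simp: eigenvalue_def eigenvector_def)
  have "y \<bullet>c y = (z * cnj z) * (y \<bullet>c y)"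
    using unitary_cscalar_prod[OF V y(1) y(1)] y
    by (simp add: cscalar_prod_smult_left[of _ N] cscalar_prod_smult_right[of _ N] mult.commute)
  moreover have "y \<bullet>c y \<noteq> 0"
    using y by simp
  ultimately have "z * cnj z = 1" by (metis mult_cancel_right1)
  then have "of_real ((cmod z)\<^sup>2) = (1 :: complex)"
    by (simp only: complex_norm_square)
  then have "(cmod z)\<^sup>2 = 1" by (metis of_real_eq_1_iff)
  then show ?thesis by (simp add: power2_eq_1_iff) (metis norm_ge_zero not_one_le_zero neg_0_le_iff_le)
qed

lemma unitary_char_poly_nz:
  assumes V: "V \<in> unitary_mats N" and "cmod z < 1"
  shows "poly (char_poly V) z \<noteq> 0"
  using unitary_eigenvalue_norm[OF V, of z] assms(2)
  by (auto simp: eigenvalue_root_char_poly[OF unitary_mats_carrier[OF V], symmetric])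

lemma A_mat_carrier: "A_mat a N x \<in> carrier_mat N N"
  unfolding A_mat_def by (intro minus_carrier_mat smult_carrier_mat outer_self_carrier)

text \<open>If (z - V) y = V x, then z - V A is z - V times the matrix 1 + (1 - \<alpha>) y x*,
  whose determinant is 1 + (1 - \<alpha>) times the scalar product of y and x. As y is minus the
  inverse of 1 - z V* applied to x, the Neumann series in z V* gives minus that scalar product as
  the sum of cnj w_k z^k.\<close>

lemma char_poly_perturbation:
  fixes a :: complex
  assumes V: "V \<in> unitary_mats N" and x: "x \<in> unit_sphere N" and z: "cmod z < 1"
  defines "\<alpha> \<equiv> a * of_real (real N powr (-1/2))"
  shows "poly (char_poly (V * A_mat a N x)) z
     = poly (char_poly V) z * (1 - (1 - \<alpha>) * (\<Sum>k. cnj (pmoment k (V, x)) * z ^ k))"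
proof -
  let ?M = "- char_matrix V z"
  have c: "V \<in> carrier_mat N N" "x \<in> carrier_vec N" "x \<bullet>c x = 1" "mat_adjoint V \<in> carrier_mat N N"
    using V x by (auto simp: unitary_mats_carrier unit_sphere_def intro!: mat_adjoint_carrier)
  have M: "?M \<in> carrier_mat N N" using c by simp
  have detM: "det ?M = poly (char_poly V) z"
    using char_poly_matrix[OF c(1)] by simp
  with unitary_char_poly_nz[OF V z] have "det ?M \<noteq> 0" by simp
  from det_non_zero_imp_unit[OF M this, of "()"]
  obtain B where B: "B \<in> carrier_mat N N" "?M * B = 1\<^sub>m N"
    by (auto simp: Units_def ring_mat_def)
  define y where "y = B *\<^sub>v (V *\<^sub>v x)"
  have y: "y \<in> carrier_vec N" using B c by (auto simp: y_def)
  have My: "?M *\<^sub>v y = V *\<^sub>v x"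
  proof -
    have "?M *\<^sub>v y = (?M * B) *\<^sub>v (V *\<^sub>v x)"
      unfolding y_def using M B(1) mult_mat_vec_carrier[OF c(1,2)] by (rule assoc_mult_mat_vec[symmetric])
    then show ?thesis
      using mult_mat_vec_carrier[OF c(1,2)] by (simp only: B(2) one_mult_mat_vec)
  qed
  have Mv: "?M *\<^sub>v w = z \<cdot>\<^sub>v w - V *\<^sub>v w" if "w \<in> carrier_vec N" for w
    using c that by (intro eq_vecI) (auto simp: char_matrix_def scalar_prod_def algebra_simps sum.distrib sum_distrib_left sum_negf
       if_distrib[of "\<lambda>x. x * _"] if_distrib[of "\<lambda>x. _ * x"] cong: if_cong)
  have VA: "- char_matrix (V * A_mat a N x) z = ?M * (1\<^sub>m N + (1 - \<alpha>) \<cdot>\<^sub>m outer_prod N y x)"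
  proof -
    have "?M * ((1 - \<alpha>) \<cdot>\<^sub>m outer_prod N y x) = (1 - \<alpha>) \<cdot>\<^sub>m (V * outer_self N x)"
      using M y c by (simp add: mult_smult_distrib[of _ N N _ N] mult_outer_prod My outer_prod_self[symmetric])
    then have "?M * (1\<^sub>m N + (1 - \<alpha>) \<cdot>\<^sub>m outer_prod N y x) = ?M + (1 - \<alpha>) \<cdot>\<^sub>m (V * outer_self N x)"
      using M by (simp add: mult_add_distrib_mat[of _ N N _ N])
    moreover have "V * A_mat a N x = V - (1 - \<alpha>) \<cdot>\<^sub>m (V * outer_self N x)"
      using c by (simp add: A_mat_def \<alpha>_def mult_minus_distrib_mat[of _ N N _ N] mult_smult_distrib[of _ N N _ N])
    moreover have "V * outer_self N x \<in> carrier_mat N N" using c by auto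
    ultimately show ?thesis
      using c by (auto simp: char_matrix_def intro!: eq_matI)
  qed
  have "poly (char_poly (V * A_mat a N x)) z = det (- char_matrix (V * A_mat a N x) z)"
    using c A_mat_carrier[of a N x] by (intro char_poly_matrix) auto
  also have "\<dots> = det ?M * (1 + (1 - \<alpha>) * (y \<bullet>c x))"
    unfolding VA using M c y by (subst det_mult[of _ N]) (auto simp: det_one_plus_outer_prod)
  finally have eq: "poly (char_poly (V * A_mat a N x)) z = poly (char_poly V) z * (1 + (1 - \<alpha>) * (y \<bullet>c x))"
    by (simp only: detM)
  \<comment> \<open>The equation V y = z y - V x is paired with V w; by unitarity this is a
    recursion from w to V w. Iterated from w = x it yields the Neumann series, with a remainder of
    order |z|^n.\<close>
  have step: "y \<bullet>c w = - (x \<bullet>c w) + z * (y \<bullet>c (V *\<^sub>v w))" if w: "w \<in> carrier_vec N" for w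
  proof -
    have "y \<bullet>c w = (V *\<^sub>v y) \<bullet>c (V *\<^sub>v w)"
      by (simp add: unitary_cscalar_prod[OF V y w])
    also have "V *\<^sub>v y = z \<cdot>\<^sub>v y - V *\<^sub>v x"
    proof (rule eq_vecI)
      fix i assume "i < dim_vec (z \<cdot>\<^sub>v y - V *\<^sub>v x)"
      then have i: "i < N" using c by simp
      have "vec_index (z \<cdot>\<^sub>v y - V *\<^sub>v y) i = vec_index (V *\<^sub>v x) i"
        using My Mv[OF y] by simp
      then show "vec_index (V *\<^sub>v y) i = vec_index (z \<cdot>\<^sub>v y - V *\<^sub>v x) i"
        using i c y by (simp add: algebra_simps del: index_mult_mat_vec)
    qed (use c in simp)
    also have "\<dots> = z \<cdot>\<^sub>v y + (-1) \<cdot>\<^sub>v (V *\<^sub>v x)"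
      using c y by (intro eq_vecI) auto
    also have "\<dots> \<bullet>c (V *\<^sub>v w) = z * (y \<bullet>c (V *\<^sub>v w)) - ((V *\<^sub>v x) \<bullet>c (V *\<^sub>v w))"
      using c y w by (simp add: cscalar_prod_add_left[of _ N] cscalar_prod_smult_left[of _ N] mult_mat_vec_carrier[of _ N N])
    finally show ?thesis
      using c w by (simp add: unitary_cscalar_prod[OF V])
  qed
  have iter: "y \<bullet>c x = - (\<Sum>k<n. cnj (pmoment k (V, x)) * z ^ k) + z ^ n * (y \<bullet>c krylov V x n)" for n
  proof (induction n)
    case (Suc n)
    have "cnj (pmoment n (V, x)) = x \<bullet>c krylov V x n"
      using c by (simp add: pmoment_def power_form_def cnj_cscalar_prod[of _ N])
    then show ?case
      using Suc c by (simp add: step krylov_Suc algebra_simps)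
  qed simp
  have "(\<lambda>n. z ^ n * (y \<bullet>c krylov V x n)) \<longlonglongrightarrow> 0"
  proof (rule Lim_null_comparison[OF always_eventually])
    show "\<forall>n. norm (z ^ n * (y \<bullet>c krylov V x n)) \<le> cmod z ^ n * (sqrt (Re (y \<bullet>c y)) * 1)"
    proof
      fix n
      have "cmod (y \<bullet>c krylov V x n) \<le> sqrt (Re (y \<bullet>c y)) * 1"
        using cscalar_prod_Cauchy_Schwarz[OF y, of "krylov V x n"] c V by (simp add: krylov_isometry)
      then show "norm (z ^ n * (y \<bullet>c krylov V x n)) \<le> cmod z ^ n * (sqrt (Re (y \<bullet>c y)) * 1)"
        unfolding norm_mult norm_power by (intro mult_left_mono) auto
    qed
    show "(\<lambda>n. cmod z ^ n * (sqrt (Re (y \<bullet>c y)) * 1)) \<longlonglongrightarrow> 0"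
      using z by (intro tendsto_mult_left_zero LIMSEQ_power_zero) simp
  qed
  then have "(\<lambda>n. z ^ n * (y \<bullet>c krylov V x n) - y \<bullet>c x) \<longlonglongrightarrow> 0 - y \<bullet>c x"
    by (intro tendsto_intros)
  moreover have "z ^ n * (y \<bullet>c krylov V x n) - y \<bullet>c x = (\<Sum>k<n. cnj (pmoment k (V, x)) * z ^ k)" for n
    using iter[of n] by (simp add: algebra_simps)
  ultimately have "(\<lambda>k. cnj (pmoment k (V, x)) * z ^ k) sums (- (y \<bullet>c x))"
    by (simp add: sums_def)
  then have "(\<Sum>k. cnj (pmoment k (V, x)) * z ^ k) = - (y \<bullet>c x)"
    by (rule sums_unique[symmetric])
  then show ?thesis by (simp add: eq)
qed

lemma multiplicity_measure_cong:
  assumes "\<And>z. z \<in> unit_disk \<Longrightarrow> m z = m' z"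
  shows "multiplicity_measure m = multiplicity_measure m'"
proof -
  have "density (count_space unit_disk) (\<lambda>z. of_nat (m z)) = density (count_space unit_disk) (\<lambda>z. of_nat (m' z))"
    using assms by (intro density_cong) (auto intro!: AE_I2)
  then show ?thesis by (simp add: multiplicity_measure_def)
qed

text \<open>The factor found in \<open>char_poly_perturbation\<close> is multiplied by sqrt N; its
  constant term \<alpha> sqrt N is then a. Conjugates appear because the resolvent expands in powers
  of V*. Entry k belongs to z^(k+1).\<close>

definition scaled_moment :: "complex \<Rightarrow> nat \<Rightarrow> complex mat \<times> complex vec \<Rightarrow> nat \<Rightarrow> complex" where
  "scaled_moment a N p k = (1 - a * of_real (real N powr (-1/2))) * of_real (sqrt N) * cnj (pmoment (Suc k) p)"

lemma char_poly_eq_disk_series: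
  assumes V: "V \<in> unitary_mats N" and x: "x \<in> unit_sphere N" and N: "N \<ge> 1" and z: "cmod z < 1"
  shows "poly (char_poly (V * A_mat a N x)) z
     = poly (char_poly V) z * (disk_series a (scaled_moment a N (V, x)) z / of_real (sqrt N))"
proof -
  define \<alpha> where "\<alpha> = a * of_real (real N powr (-1/2))"
  have sN: "of_real (sqrt N) \<noteq> (0::complex)" using N by simp
  have "real N powr (-1/2) = inverse (sqrt N)"
    using N by (simp add: powr_half_sqrt powr_minus)
  then have a: "a = \<alpha> * of_real (sqrt N)"
    using N by (simp add: \<alpha>_def)
  let ?t = "\<lambda>k. cnj (pmoment k (V, x)) * z ^ k"
  have "summable (\<lambda>k. norm (?t k))"
  proof (rule summable_comparison_test')
    show "summable (\<lambda>k. cmod z ^ k)" using z by (intro summable_geometric) auto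
    show "norm (norm (?t k)) \<le> cmod z ^ k" for k
      using pmoment_le_1[of "(V, x)" N k] V x by (auto simp: norm_mult norm_power intro!: mult_left_le_one_le)
  qed
  then have st: "summable ?t" by (rule summable_norm_cancel)
  have t0: "?t 0 = 1" using pmoment_0[of "(V, x)" N] V x by simp
  have "(\<Sum>k. ?t k) = 1 + (\<Sum>k. ?t (Suc k))"
    using suminf_split_head[OF st] t0 by simp
  moreover have "disk_series a (scaled_moment a N (V, x)) z = a - (1 - \<alpha>) * of_real (sqrt N) * (\<Sum>k. ?t (Suc k))"
  proof -
    have "(\<Sum>k. scaled_moment a N (V, x) k * z ^ Suc k) = (\<Sum>k. (1 - \<alpha>) * of_real (sqrt N) * ?t (Suc k))"
      by (simp only: scaled_moment_def \<alpha>_def mult.assoc)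
    also have "\<dots> = (1 - \<alpha>) * of_real (sqrt N) * (\<Sum>k. ?t (Suc k))"
      by (rule suminf_mult) (rule iffD2[OF summable_Suc_iff[of ?t] st])
    finally show ?thesis by (simp only: disk_series_eq)
  qed
  ultimately have "1 - (1 - \<alpha>) * (\<Sum>k. ?t k) = disk_series a (scaled_moment a N (V, x)) z / of_real (sqrt N)"
    using sN by (simp add: a field_simps)
  then show ?thesis
    using char_poly_perturbation[OF V x z, of a] by (simp add: \<alpha>_def)
qed

text \<open>The two functions differ by a holomorphic factor without zeros in the disk, so the
  polynomial order agrees with \<open>zorder\<close> and multiplicities are preserved.\<close>

lemma eigenvalue_measure_eq_zero_measure:
  assumes V: "V \<in> unitary_mats N" and x: "x \<in> unit_sphere N" and N: "N \<ge> 1"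
  shows "eigenvalue_measure (V * A_mat a N x) = zero_measure (disk_series a (scaled_moment a N (V, x)))"
  unfolding eigenvalue_measure_def zero_measure_def
proof (rule multiplicity_measure_cong)
  fix z :: complex assume z: "z \<in> unit_disk"
  define p where "p = char_poly (V * A_mat a N x)"
  define d where "d = char_poly V"
  define F where "F = disk_series a (scaled_moment a N (V, x))"
  have c: "V * A_mat a N x \<in> carrier_mat N N"
    using unitary_mats_carrier[OF V] A_mat_carrier by (rule mult_carrier_mat)
  have p0: "p \<noteq> 0"
    using degree_monic_char_poly[OF c] by (auto simp: p_def)
  have eq: "poly p w = poly d w * (F w / of_real (sqrt N))" if "cmod w < 1" for w
    unfolding p_def d_def F_def by (rule char_poly_eq_disk_series[OF V x N that])
  have d0: "poly d w \<noteq> 0" if "cmod w < 1" for w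
    unfolding d_def by (rule unitary_char_poly_nz[OF V that])
  have sN: "of_real (sqrt N) \<noteq> (0::complex)" using N by simp
  have "cmod (scaled_moment a N (V, x) k) \<le> cmod (1 - a * of_real (real N powr (-1/2))) * sqrt N" for k
    using pmoment_le_1[of "(V, x)" N "Suc k"] V x
    by (simp add: scaled_moment_def norm_mult mult_left_le)
  then have holo: "F holomorphic_on unit_disk"
    unfolding F_def by (intro disk_series_holomorphic disk_summable_bounded)
  have "Polynomial.order z p = (if F holomorphic_on unit_disk \<and> F z = 0 then nat (zorder F z) else 0)"
  proof (cases "F z = 0")
    case False
    then have "poly p z \<noteq> 0" using eq[of z] d0[of z] z sN by simp
    then show ?thesis using False by (simp add: order_0I)
  next
    case True
    define n where "n = Polynomial.order z p"
    obtain q where q: "p = [:- z, 1:] ^ n * q" "\<not> [:- z, 1:] dvd q"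
      using order_decomp[OF p0, of z] by (auto simp: n_def)
    have qz: "poly q z \<noteq> 0" using q(2) by (simp add: poly_eq_0_iff_dvd)
    have "zorder F z = int n"
    proof (rule zorder_eqI[where S="ball 0 1" and g="\<lambda>w. of_real (sqrt N) * poly q w / poly d w"])
      show "(\<lambda>w. of_real (sqrt N) * poly q w / poly d w) holomorphic_on ball 0 1"
        using d0 by (intro holomorphic_intros) auto
      show "of_real (sqrt N) * poly q z / poly d z \<noteq> 0"
        using qz d0[of z] z sN by simp
      fix w :: complex assume w: "w \<in> ball 0 1"
      have "poly p w = (w - z) ^ n * poly q w"
        by (simp add: q(1))
      then show "F w = of_real (sqrt N) * poly q w / poly d w * (w - z) powi int n"
        using eq[of w] d0[of w] w sN by (simp add: field_simps)
    qed (use z in auto)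
    then show ?thesis using True holo by (simp add: n_def)
  qed
  then show "Polynomial.order z (char_poly (V * A_mat a N x)) =
     (if disk_series a (scaled_moment a N (V, x)) holomorphic_on unit_disk \<and> disk_series a (scaled_moment a N (V, x)) z = 0
      then nat (zorder (disk_series a (scaled_moment a N (V, x))) z) else 0)"
    by (simp only: p_def F_def)
qed


subsection \<open>Weak convergence on the space of sequences\<close>

text \<open>The growth (k+1)^2 is slow enough for \<open>disk_summable_square\<close> and fast
  enough for a union bound: coordinate tails C (k+1)^2 / t^2 at t = M (k+1)^2 are summable in
  k.\<close>

definition seq_box :: "real \<Rightarrow> (nat \<Rightarrow> complex) set" where
  "seq_box M = {y. \<forall>k. cmod (y k) \<le> M * (real k + 1)\<^sup>2}"

lemma compact_seq_box: "compact (seq_box M)"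
proof -
  have "compactin (product_topology (\<lambda>_. euclidean) UNIV) (PiE UNIV (\<lambda>k::nat. cball (0::complex) (M * (real k + 1)\<^sup>2)))"
    by (subst compactin_PiE) auto
  moreover have "PiE UNIV (\<lambda>k::nat. cball (0::complex) (M * (real k + 1)\<^sup>2)) = seq_box M"
    by (auto simp: seq_box_def PiE_def Pi_def)
  ultimately show ?thesis
    by (simp add: euclidean_product_topology)
qed

lemma closed_seq_box: "closed (seq_box M)"
  by (intro compact_imp_closed compact_seq_box)

lemma tendsto_coordinate:
  fixes x :: "nat \<Rightarrow> nat \<Rightarrow> complex"
  assumes "x \<longlonglongrightarrow> y"
  shows "(\<lambda>n. x n k) \<longlonglongrightarrow> y k"
  using continuous_on_tendsto_compose[OF continuous_on_product_coordinates assms, of k] by auto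

text \<open>The map \<open>t \<mapsto> l sin (t/l)\<close> in each coordinate takes values in a compact box, is close to the
  identity on small boxes, and turns polynomials into trigonometric polynomials.\<close>

definition sin_clip :: "real \<Rightarrow> (nat \<Rightarrow> complex) \<Rightarrow> nat \<Rightarrow> complex" where
  "sin_clip L y k = (let l = L * (real k + 1)\<^sup>2
     in Complex (l * sin (Re (y k) / l)) (l * sin (Im (y k) / l)))"

text \<open>From |sin x| \<le> |x|; hence clipping never leaves a box.\<close>

lemma cmod_sin_clip_le:
  assumes "L > 0"
  shows "cmod (sin_clip L y k) \<le> cmod (y k)"
proof -
  define l where "l = L * (real k + 1)\<^sup>2"
  have l: "l > 0" using assms by (simp add: l_def)
  have "\<bar>l * sin (t / l)\<bar> \<le> \<bar>t\<bar>" for t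
    using abs_sin_x_le_abs_x[of "t / l"] l by (simp add: abs_mult field_simps)
  then have "(l * sin (t / l))\<^sup>2 \<le> t\<^sup>2" for t
    by (metis abs_le_square_iff)
  then show ?thesis
    by (simp add: sin_clip_def Let_def cmod_def l_def[symmetric] add_mono)
qed

lemma sin_clip_in_box:
  assumes "L > 0"
  shows "sin_clip L y \<in> seq_box (2 * L)"
proof -
  have "cmod (sin_clip L y k) \<le> 2 * L * (real k + 1)\<^sup>2" for k
  proof -
    define l where "l = L * (real k + 1)\<^sup>2"
    have l: "l > 0" using assms by (simp add: l_def)
    have "cmod (sin_clip L y k) \<le> \<bar>l * sin (Re (y k) / l)\<bar> + \<bar>l * sin (Im (y k) / l)\<bar>"
      using cmod_le[of "sin_clip L y k"] by (simp add: sin_clip_def Let_def l_def)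
    also have "\<dots> \<le> l * 1 + l * 1"
      unfolding abs_mult using l by (intro add_mono mult_mono) auto
    finally show ?thesis by (simp add: l_def mult_ac)
  qed
  then show ?thesis by (simp add: seq_box_def)
qed

text \<open>Here l sin(t/l) = t sinc(t/l) with t/l tending to 0. The argument moves together with
  the clipping level, as the compactness argument in \<open>sin_clip_uniform\<close>
  requires.\<close>

lemma sin_clip_tendsto:
  assumes y: "(\<lambda>n. y n k) \<longlonglongrightarrow> y0 k"
  shows "(\<lambda>n. sin_clip (real (Suc n)) (y n) k) \<longlonglongrightarrow> y0 k"
proof -
  have real: "(\<lambda>n. (real (Suc n) * c) * sin (t n / (real (Suc n) * c))) \<longlonglongrightarrow> t0"
    if t: "t \<longlonglongrightarrow> t0" and c: "c > 0" for t t0 c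
  proof -
    define h where "h n = t n / (real (Suc n) * c)" for n
    have inf: "filterlim (\<lambda>n. real (Suc n) * c) at_infinity sequentially"
    proof (rule filterlim_at_top_imp_at_infinity)
      have "filterlim (\<lambda>n. real (Suc n)) at_top sequentially"
        by (rule filterlim_compose[OF filterlim_real_sequentially filterlim_Suc])
      from filterlim_tendsto_pos_mult_at_top[OF tendsto_const c this]
      show "filterlim (\<lambda>n. real (Suc n) * c) at_top sequentially"
        by (simp add: mult.commute)
    qed
    have h: "h \<longlonglongrightarrow> 0"
      unfolding h_def by (rule tendsto_divide_0[OF t inf])
    have "(\<lambda>n. sinc (h n)) \<longlonglongrightarrow> 1"
      using isCont_tendsto_compose[OF isCont_sinc h] by simp
    then have "(\<lambda>n. t n * sinc (h n)) \<longlonglongrightarrow> t0 * 1"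
      by (intro tendsto_mult t)
    moreover have "t n * sinc (h n) = (real (Suc n) * c) * sin (t n / (real (Suc n) * c))" for n
    proof -
      have "t n * sinc (t n / l) = l * sin (t n / l)" if "l \<noteq> 0" for l
        using that by simp
      moreover have "real (Suc n) * c \<noteq> 0" using c by simp
      ultimately show ?thesis unfolding h_def by blast
    qed
    ultimately show ?thesis by simp
  qed
  have c: "(real k + 1)\<^sup>2 > 0" by simp
  show ?thesis
    unfolding sin_clip_def Let_def
    using tendsto_Complex[OF real[OF tendsto_Re[OF y] c] real[OF tendsto_Im[OF y] c]] by simp
qed

section \<open>Trigonometric polynomials and polynomials in the coordinates\<close>

definition lin_form :: "nat \<Rightarrow> (nat \<Rightarrow> complex) \<Rightarrow> (nat \<Rightarrow> complex) \<Rightarrow> real" where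
  "lin_form m \<theta> y = (\<Sum>k<m. Re (cnj (\<theta> k) * y k))"

lemma lin_form_add:
  "\<exists>m'' \<theta>''. \<forall>y. lin_form m \<theta> y + lin_form m' \<theta>' y = lin_form m'' \<theta>'' y"
proof -
  have *: "lin_form n \<eta> y = (\<Sum>k<n'. Re (cnj (if k < n then \<eta> k else 0) * y k))" if "n \<le> n'" for n n' \<eta> y
    unfolding lin_form_def using that by (intro sum.mono_neutral_cong_left) auto
  let ?\<eta> = "\<lambda>k. (if k < m then \<theta> k else 0) + (if k < m' then \<theta>' k else 0)"
  have "lin_form m \<theta> y + lin_form m' \<theta>' y = lin_form (max m m') ?\<eta> y" for y
  proof -
    have "lin_form m \<theta> y + lin_form m' \<theta>' y = (\<Sum>k<max m m'. Re (cnj (if k < m then \<theta> k else 0) * y k)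
       + Re (cnj (if k < m' then \<theta>' k else 0) * y k))"
      by (simp only: *[of m "max m m'"] *[of m' "max m m'"] max.cobounded1 max.cobounded2 sum.distrib)
    also have "\<dots> = lin_form (max m m') ?\<eta> y"
      unfolding lin_form_def by (intro sum.cong refl) (simp add: algebra_simps)
    finally show ?thesis .
  qed
  then show ?thesis by blast
qed

text \<open>Only multiples of characters and sums are generators, so convergence of characteristic
  functions extends to this class at once; closure under products is derived from
  \<open>lin_form_add\<close>.\<close>

inductive trig_poly :: "((nat \<Rightarrow> complex) \<Rightarrow> complex) \<Rightarrow> bool" where
  base: "trig_poly (\<lambda>y. c * iexp (lin_form m \<theta> y))"
| add: "trig_poly f \<Longrightarrow> trig_poly g \<Longrightarrow> trig_poly (\<lambda>y. f y + g y)"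

lemma trig_poly_mult_base: "trig_poly f \<Longrightarrow> trig_poly (\<lambda>y. c * iexp (lin_form m \<theta> y) * f y)"
proof (induction rule: trig_poly.induct)
  case (base c' m' \<theta>')
  obtain n \<eta> where "\<And>y. lin_form m \<theta> y + lin_form m' \<theta>' y = lin_form n \<eta> y"
    using lin_form_add by metis
  then have "c * iexp (lin_form m \<theta> y) * (c' * iexp (lin_form m' \<theta>' y)) = (c * c') * iexp (lin_form n \<eta> y)" for y
    by (simp add: distrib_left exp_add flip: of_real_add) (metis (no_types) distrib_left exp_add mult.assoc mult.left_commute of_real_add)
  then show ?case by (simp only: trig_poly.base)
next
  case (add f g)
  from trig_poly.add[OF add.IH] show ?case by (simp add: algebra_simps)
qed

lemma trig_poly_mult: "trig_poly f \<Longrightarrow> trig_poly g \<Longrightarrow> trig_poly (\<lambda>y. f y * g y)"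
proof (induction rule: trig_poly.induct)
  case (base c m \<theta>)
  then show ?case by (rule trig_poly_mult_base)
next
  case (add f h)
  from trig_poly.add[OF add.IH(1)[OF add.prems] add.IH(2)[OF add.prems]] show ?case by (simp add: algebra_simps)
qed

lemma trig_poly_const: "trig_poly (\<lambda>_. c)"
  using trig_poly.base[of c 0] by (simp add: lin_form_def)

text \<open>The algebra for the Stone--Weierstrass theorem; real and imaginary parts of the
  coordinates separate points.\<close>

inductive coord_poly :: "((nat \<Rightarrow> complex) \<Rightarrow> real) \<Rightarrow> bool" where
  const: "coord_poly (\<lambda>_. c)"
| re: "coord_poly (\<lambda>y. Re (y k))"
| im: "coord_poly (\<lambda>y. Im (y k))"
| add: "coord_poly f \<Longrightarrow> coord_poly g \<Longrightarrow> coord_poly (\<lambda>y. f y + g y)"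
| mult: "coord_poly f \<Longrightarrow> coord_poly g \<Longrightarrow> coord_poly (\<lambda>y. f y * g y)"

lemma continuous_coord_poly: "coord_poly f \<Longrightarrow> continuous_on S f"
  by (induction rule: coord_poly.induct)
    (auto intro!: continuous_intros continuous_on_subset[OF continuous_on_product_coordinates])

text \<open>Euler's formula: the sine combines the characters with coefficients \<theta> and -
  \<theta>.\<close>

lemma trig_poly_sin:
  assumes "\<And>y. lin_form m \<theta> y = h y / l" "l \<noteq> 0"
  shows "trig_poly (\<lambda>y. of_real (l * sin (h y / l)))"
proof -
  have "lin_form m (\<lambda>k. - \<theta> k) y = - (h y / l)" for y
    unfolding assms(1)[symmetric] lin_form_def
    by (simp only: sum_negf[symmetric] complex_cnj_minus mult_minus_left uminus_complex.sel)
  then have "of_real (l * sin (h y / l)) = (of_real l / (2 * \<i>)) * iexp (lin_form m \<theta> y) + (- of_real l / (2 * \<i>)) * iexp (lin_form m (\<lambda>k. - \<theta> k) y)" for y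
    by (simp only: assms(1) of_real_mult sin_of_real[symmetric] sin_exp_eq) (simp add: field_simps)
  then show ?thesis
    by (simp only: trig_poly.intros)
qed

lemma trig_poly_sin_clip:
  assumes p: "coord_poly p" and L: "L > 0"
  shows "trig_poly (\<lambda>y. of_real (p (sin_clip L y)))"
  using p
proof (induction rule: coord_poly.induct)
  case (const c)
  then show ?case by (rule trig_poly_const)
next
  case (re k)
  define l where "l = L * (real k + 1)\<^sup>2"
  have l: "l \<noteq> 0" using L by (simp add: l_def)
  have "lin_form (Suc k) (\<lambda>j. if j = k then of_real (1 / l) else 0) y = Re (y k) / l" for y
    by (simp add: lin_form_def if_distrib if_distribR cong: if_cong)
  from trig_poly_sin[OF this l] show ?case
    by (simp add: sin_clip_def Let_def l_def)
next
  case (im k)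
  define l where "l = L * (real k + 1)\<^sup>2"
  have l: "l \<noteq> 0" using L by (simp add: l_def)
  have "lin_form (Suc k) (\<lambda>j. if j = k then \<i> * of_real (1 / l) else 0) y = Im (y k) / l" for y
    by (simp add: lin_form_def if_distrib if_distribR cong: if_cong)
  from trig_poly_sin[OF this l] show ?case
    by (simp add: sin_clip_def Let_def l_def)
next
  case (add f g)
  from trig_poly.add[OF add.IH] show ?case by simp
next
  case (mult f g)
  from trig_poly_mult[OF mult.IH] show ?case by simp
qed

text \<open>Weaker than continuity on the product space: the sequences must stay in one box, which
  provides the majorant for \<open>zero_stat_tendsto\<close>.\<close>

definition box_continuous :: "((nat \<Rightarrow> complex) \<Rightarrow> real) \<Rightarrow> bool" where
  "box_continuous H \<longleftrightarrow> (\<forall>M y y0. (\<forall>n. y n \<in> seq_box M) \<longrightarrow> (\<forall>k. (\<lambda>n. y n k) \<longlonglongrightarrow> y0 k)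
     \<longrightarrow> (\<lambda>n. H (y n)) \<longlonglongrightarrow> H y0)"

lemma box_continuousD:
  "box_continuous H \<Longrightarrow> (\<And>n. y n \<in> seq_box M) \<Longrightarrow> (\<And>k. (\<lambda>n. y n k) \<longlonglongrightarrow> y0 k)
    \<Longrightarrow> (\<lambda>n. H (y n)) \<longlonglongrightarrow> H y0"
  unfolding box_continuous_def by blast

lemma continuous_on_seq_box:
  fixes H :: "(nat \<Rightarrow> complex) \<Rightarrow> real"
  assumes H: "box_continuous H"
  shows "continuous_on (seq_box M) H"
proof -
  have "(H \<circ> x) \<longlonglongrightarrow> H y" if "\<And>n. x n \<in> seq_box M" "x \<longlonglongrightarrow> y" for x y
    unfolding comp_def using that by (intro box_continuousD[OF H] tendsto_coordinate) auto
  then show ?thesis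
    by (auto simp: continuous_on_sequentially)
qed

text \<open>Otherwise there are bad points y n of the box for the levels n + 1. Along a convergent
  subsequence these points and their clipped versions have the same limit and stay in the box, so
  continuity contradicts the gap e.\<close>

lemma sin_clip_uniform:
  fixes H :: "(nat \<Rightarrow> complex) \<Rightarrow> real"
  assumes H: "box_continuous H"
    and e: "e > 0"
  shows "\<exists>L>0. \<forall>y\<in>seq_box M. \<bar>H (sin_clip L y) - H y\<bar> \<le> e"
proof (rule ccontr)
  assume neg: "\<not> ?thesis"
  have "\<exists>y\<in>seq_box M. e < \<bar>H (sin_clip (real (Suc n)) y) - H y\<bar>" for n
  proof (rule ccontr)
    assume "\<not> ?thesis"
    then have "real (Suc n) > 0 \<and> (\<forall>y\<in>seq_box M. \<bar>H (sin_clip (real (Suc n)) y) - H y\<bar> \<le> e)"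
      by (auto simp: not_less)
    with neg show False by blast
  qed
  then obtain y where y: "\<And>n. y n \<in> seq_box M" and far: "\<And>n. e < \<bar>H (sin_clip (real (Suc n)) (y n)) - H (y n)\<bar>"
    by metis
  have "seq_compact (seq_box M)"
    using compact_seq_box by (simp add: compact_eq_seq_compact_metric)
  then obtain y0 r where r: "strict_mono r" "(y \<circ> r) \<longlonglongrightarrow> y0"
    unfolding seq_compact_def using y by blast
  have coord: "(\<lambda>n. y (r n) k) \<longlonglongrightarrow> y0 k" for k
    using tendsto_coordinate[OF r(2), of k] by (simp add: comp_def)
  \<comment> \<open>\<open>sin_clip_tendsto\<close> couples the level to the index of the sequence.
    Filling the gaps of the subsequence with the limit gives a full sequence, from which the
    subsequence is taken again.\<close>
  define z where "z m k = (if m \<in> range r then y m k else y0 k)" for m k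
  have zr: "z (r n) = y (r n)" for n by (auto simp: z_def)
  have "(\<lambda>n. sin_clip (real (Suc (r n))) (y (r n)) k) \<longlonglongrightarrow> y0 k" for k
  proof -
    have "(\<lambda>m. z m k) \<longlonglongrightarrow> y0 k"
    proof (rule LIMSEQ_I)
      fix d :: real assume d: "d > 0"
      from LIMSEQ_D[OF coord[of k] d] obtain n0 where n0: "\<And>n. n \<ge> n0 \<Longrightarrow> norm (y (r n) k - y0 k) < d" by blast
      have "norm (z m k - y0 k) < d" if m: "m \<ge> r n0" for m
      proof (cases "m \<in> range r")
        case True
        then obtain n where n: "m = r n" by blast
        with m have "n \<ge> n0" using r(1) by (simp add: strict_mono_less_eq)
        then show ?thesis using n0 n zr by simp
      qed (use d in \<open>simp add: z_def\<close>)
      then show "\<exists>no. \<forall>m\<ge>no. norm (z m k - y0 k) < d" by blast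
    qed
    from LIMSEQ_subseq_LIMSEQ[OF sin_clip_tendsto[of z k y0, OF this] r(1)] show ?thesis
      by (simp add: comp_def zr)
  qed
  moreover have "sin_clip (real (Suc (r n))) (y (r n)) \<in> seq_box M" for n
    using y[of "r n"] cmod_sin_clip_le[of "real (Suc (r n))" "y (r n)"] unfolding seq_box_def
    by (auto intro: order_trans)
  ultimately have "(\<lambda>n. H (sin_clip (real (Suc (r n))) (y (r n)))) \<longlonglongrightarrow> H y0"
    by (intro box_continuousD[OF H])
  moreover have "(\<lambda>n. H (y (r n))) \<longlonglongrightarrow> H y0"
    using y coord by (intro box_continuousD[OF H])
  ultimately have "(\<lambda>n. \<bar>H (sin_clip (real (Suc (r n))) (y (r n))) - H (y (r n))\<bar>) \<longlonglongrightarrow> \<bar>H y0 - H y0\<bar>"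
    by (intro tendsto_intros)
  then have "e \<le> \<bar>H y0 - H y0\<bar>"
    by (rule LIMSEQ_le_const) (use far in \<open>auto intro: less_imp_le\<close>)
  with e show False by simp
qed

lemma measurable_coordinate [measurable]: "(\<lambda>y::nat \<Rightarrow> complex. y k) \<in> borel_measurable borel"
  by (intro borel_measurable_continuous_onI continuous_on_product_coordinates)

lemma measurable_lin_form [measurable]: "lin_form m \<theta> \<in> borel_measurable borel"
  unfolding lin_form_def by measurable

lemma measurable_iexp_lin_form [measurable]: "(\<lambda>y. iexp (lin_form m \<theta> y)) \<in> borel_measurable borel"
  by (rule measurable_compose[OF measurable_lin_form measurable_iexp])

lemma integrable_iexp_lin_form:
  assumes "prob_space \<mu>" "sets \<mu> = sets (borel :: (nat \<Rightarrow> complex) measure)"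
  shows "integrable \<mu> (\<lambda>y. iexp (lin_form m \<theta> y))"
proof -
  interpret prob_space \<mu> by fact
  have "(\<lambda>y. iexp (lin_form m \<theta> y)) \<in> borel_measurable \<mu>"
    unfolding measurable_cong_sets[OF assms(2) refl] by (rule measurable_iexp_lin_form)
  then show ?thesis
    by (intro integrable_const_bound[of _ 1]) (auto intro!: AE_I2)
qed

lemma trig_poly_integrable:
  assumes "prob_space \<mu>" "sets \<mu> = sets (borel :: (nat \<Rightarrow> complex) measure)"
  shows "trig_poly f \<Longrightarrow> integrable \<mu> f"
  by (induction rule: trig_poly.induct) (auto intro: integrable_iexp_lin_form[OF assms])

lemma trig_poly_integral_tendsto:
  fixes \<mu> :: "nat \<Rightarrow> (nat \<Rightarrow> complex) measure"
  assumes \<mu>: "\<And>n. prob_space (\<mu> n)" "\<And>n. sets (\<mu> n) = sets borel"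
    and \<mu>0: "prob_space \<mu>0" "sets \<mu>0 = sets borel"
    and char: "\<And>m \<theta>. (\<lambda>n. \<integral>y. iexp (lin_form m \<theta> y) \<partial>\<mu> n) \<longlonglongrightarrow> (\<integral>y. iexp (lin_form m \<theta> y) \<partial>\<mu>0)"
  shows "trig_poly f \<Longrightarrow> (\<lambda>n. \<integral>y. f y \<partial>\<mu> n) \<longlonglongrightarrow> (\<integral>y. f y \<partial>\<mu>0)"
proof (induction rule: trig_poly.induct)
  case (base c m \<theta>)
  show ?case
    using tendsto_mult_left[OF char[of m \<theta>], of c] by simp
next
  case (add f g)
  have "integrable (\<mu> n) f" "integrable (\<mu> n) g" "integrable \<mu>0 f" "integrable \<mu>0 g" for n
    by (rule trig_poly_integrable[OF \<mu>] trig_poly_integrable[OF \<mu>0], rule add.hyps)+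
  then show ?case
    using tendsto_add[OF add.IH] by simp
qed

lemma seq_box_tail:
  fixes \<mu> :: "(nat \<Rightarrow> complex) measure"
  assumes \<mu>: "prob_space \<mu>" "sets \<mu> = sets borel" and M: "M > 0"
    and tail: "\<And>k t. t > 0 \<Longrightarrow> measure \<mu> {y. cmod (y k) > t} \<le> C * (real k + 1)\<^sup>2 / t\<^sup>2"
  shows "measure \<mu> (- seq_box M) \<le> C / M\<^sup>2 * (\<Sum>k. 1 / (real k + 1)\<^sup>2)"
proof -
  interpret prob_space \<mu> by fact
  have sp: "space \<mu> = UNIV" using sets_eq_imp_space_eq[OF \<mu>(2)] by simp
  let ?A = "\<lambda>k. {y. cmod (y k) > M * (real k + 1)\<^sup>2}"
  have A: "?A k \<in> sets \<mu>" for k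
    unfolding \<mu>(2) by measurable
  have box_eq: "- seq_box M = (\<Union>k. ?A k)"
    by (simp add: seq_box_def set_eq_iff not_le)
  have b: "measure \<mu> (?A k) \<le> C / M\<^sup>2 * (1 / (real k + 1)\<^sup>2)" for k
  proof -
    have "measure \<mu> (?A k) \<le> C * (real k + 1)\<^sup>2 / (M * (real k + 1)\<^sup>2)\<^sup>2"
      using M by (intro tail) auto
    also have "\<dots> = C / M\<^sup>2 * (1 / (real k + 1)\<^sup>2)"
    proof -
      have "C * q / (M * q)\<^sup>2 = C / M\<^sup>2 * (1 / q)" if "q \<noteq> 0" for q :: real
        using that by (simp add: power_mult_distrib power2_eq_square)
      then show ?thesis by simp
    qed
    finally show ?thesis .
  qed
  have s: "summable (\<lambda>k. 1 / (real k + 1)\<^sup>2)"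
    using inverse_power_summable[of 2, where 'a=real] summable_Suc_iff[of "\<lambda>k. inverse (real k ^ 2)"]
    by (simp add: inverse_eq_divide add.commute)
  then have s': "summable (\<lambda>k. C / M\<^sup>2 * (1 / (real k + 1)\<^sup>2))"
    by (rule summable_mult)
  have s'': "summable (\<lambda>k. measure \<mu> (?A k))"
    by (rule summable_comparison_test'[OF s']) (use b in auto)
  have "measure \<mu> (\<Union>k. ?A k) \<le> (\<Sum>k. measure \<mu> (?A k))"
    using A s'' by (intro finite_measure_subadditive_countably) auto
  also have "\<dots> \<le> (\<Sum>k. C / M\<^sup>2 * (1 / (real k + 1)\<^sup>2))"
    by (rule suminf_le[OF b s'' s'])
  also have "\<dots> = C / M\<^sup>2 * (\<Sum>k. 1 / (real k + 1)\<^sup>2)"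
    by (rule suminf_mult[OF s])
  finally show ?thesis
    by (simp add: box_eq)
qed

text \<open>H is replaced by its composition with clipping, close on the box M, and then by a
  polynomial in the clipped coordinates, close everywhere because clipped points lie in the box 2 L.
  The result is a trigonometric polynomial. Clipping keeps the approximant bounded off the box,
  where the mass is small.\<close>

theorem integral_tendsto_of_char_tendsto:
  fixes \<mu> :: "nat \<Rightarrow> (nat \<Rightarrow> complex) measure" and H :: "(nat \<Rightarrow> complex) \<Rightarrow> real"
  assumes \<mu>: "\<And>n. prob_space (\<mu> n)" "\<And>n. sets (\<mu> n) = sets borel"
    and \<mu>0: "prob_space \<mu>0" "sets \<mu>0 = sets borel"
    and tail: "\<And>n k t. t > 0 \<Longrightarrow> measure (\<mu> n) {y. cmod (y k) > t} \<le> C * (real k + 1)\<^sup>2 / t\<^sup>2"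
    and tail0: "\<And>k t. t > 0 \<Longrightarrow> measure \<mu>0 {y. cmod (y k) > t} \<le> C * (real k + 1)\<^sup>2 / t\<^sup>2"
    and char: "\<And>m \<theta>. (\<lambda>n. \<integral>y. iexp (lin_form m \<theta> y) \<partial>\<mu> n) \<longlonglongrightarrow> (\<integral>y. iexp (lin_form m \<theta> y) \<partial>\<mu>0)"
    and Hm: "H \<in> borel_measurable borel" and Hb: "\<And>y. \<bar>H y\<bar> \<le> 1"
    and H: "box_continuous H"
  shows "(\<lambda>n. \<integral>y. H y \<partial>\<mu> n) \<longlonglongrightarrow> (\<integral>y. H y \<partial>\<mu>0)"
proof (rule LIMSEQ_I)
  fix e0 :: real assume e0: "e0 > 0"
  \<comment> \<open>The approximation costs 4 e for each of the two measures, the convergence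
    another e.\<close>
  define e where "e = e0 / 10"
  have e: "e > 0" using e0 by (simp add: e_def)
  define K where "K = \<bar>C\<bar> * (\<Sum>k. 1 / (real k + 1)\<^sup>2)"
  have "\<exists>M>0. C / M\<^sup>2 * (\<Sum>k. 1 / (real k + 1)\<^sup>2) \<le> e"
  proof -
    let ?S = "\<Sum>k. 1 / (real k + 1)\<^sup>2"
    define M where "M = sqrt (\<bar>C * ?S\<bar> / e) + 1"
    have M: "M > 0" using e by (simp add: M_def add_nonneg_pos)
    have "\<bar>C * ?S\<bar> / e = (sqrt (\<bar>C * ?S\<bar> / e))\<^sup>2" using e by simp
    also have "\<dots> \<le> M\<^sup>2" using e by (intro power_mono) (auto simp: M_def)
    finally have "C * ?S \<le> e * M\<^sup>2" using e by (simp add: field_simps)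
    then have "C / M\<^sup>2 * ?S \<le> e" using M by (simp add: field_simps)
    then show ?thesis using M by blast
  qed
  then obtain M where M: "M > 0" "C / M\<^sup>2 * (\<Sum>k. 1 / (real k + 1)\<^sup>2) \<le> e" by blast
  obtain L where L: "L > 0" "\<And>y. y \<in> seq_box M \<Longrightarrow> \<bar>H (sin_clip L y) - H y\<bar> \<le> e"
    using sin_clip_uniform[where M=M, OF H e] by blast
  have "\<exists>p. coord_poly p \<and> (\<forall>y\<in>seq_box (2 * L). \<bar>H y - p y\<bar> < e)"
  proof (rule Stone_Weierstrass_HOL[OF compact_seq_box])
    show "coord_poly (\<lambda>y. c)" for c by (rule coord_poly.const)
    show "\<exists>f. coord_poly f \<and> f x \<noteq> f y" if "x \<in> seq_box (2 * L) \<and> y \<in> seq_box (2 * L) \<and> x \<noteq> y" for x y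
    proof -
      from that obtain k where "x k \<noteq> y k" by auto
      then have "Re (x k) \<noteq> Re (y k) \<or> Im (x k) \<noteq> Im (y k)" by (simp add: complex_eq_iff)
      then show ?thesis using coord_poly.re[of k] coord_poly.im[of k] by blast
    qed
    show "continuous_on (seq_box (2 * L)) H" by (rule continuous_on_seq_box[OF H])
  qed (use e in \<open>auto intro: coord_poly.intros continuous_coord_poly\<close>)
  then obtain p where p: "coord_poly p" "\<And>y. y \<in> seq_box (2 * L) \<Longrightarrow> \<bar>H y - p y\<bar> < e" by blast
  have tp: "trig_poly (\<lambda>y. of_real (p (sin_clip L y)))"
    by (rule trig_poly_sin_clip[OF p(1) L(1)])
  have approx: "\<bar>(\<integral>y. H y \<partial>\<nu>) - (\<integral>y. p (sin_clip L y) \<partial>\<nu>)\<bar> \<le> 4 * e"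
    if \<nu>: "prob_space \<nu>" "sets \<nu> = sets borel" and t: "\<And>k t. t > 0 \<Longrightarrow> measure \<nu> {y. cmod (y k) > t} \<le> C * (real k + 1)\<^sup>2 / t\<^sup>2" for \<nu>
  proof -
    interpret prob_space \<nu> by fact
    have sp: "space \<nu> = UNIV" using sets_eq_imp_space_eq[OF \<nu>(2)] by simp
    have meas: "borel_measurable \<nu> = (borel_measurable borel :: ((nat \<Rightarrow> complex) \<Rightarrow> real) set)"
      by (rule measurable_cong_sets[OF \<nu>(2) refl])
    have Hi: "integrable \<nu> H"
      using Hm Hb by (intro integrable_const_bound[of _ 1]) (auto simp: meas intro!: AE_I2)
    have pi: "integrable \<nu> (\<lambda>y. p (sin_clip L y))"
      using integrable_Re[OF trig_poly_integrable[OF \<nu> tp]] by simp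
    have box: "- seq_box M \<in> sets \<nu>" using closed_seq_box[of M] by (simp add: \<nu>(2) borel_closed)
    have le: "\<bar>H y - p (sin_clip L y)\<bar> \<le> 2 * e + 2 * indicator (- seq_box M) y" for y
    proof (cases "y \<in> seq_box M")
      case True
      then show ?thesis using L(2)[OF True] p(2)[OF sin_clip_in_box[OF L(1), of y]] by simp
    next
      case False
      have "\<bar>H y - p (sin_clip L y)\<bar> \<le> \<bar>H y - H (sin_clip L y)\<bar> + \<bar>H (sin_clip L y) - p (sin_clip L y)\<bar>" by simp
      also have "\<dots> \<le> 2 + e"
        using Hb[of y] Hb[of "sin_clip L y"] p(2)[OF sin_clip_in_box[OF L(1), of y]] by linarith
      finally show ?thesis using False e by simp
    qed
    have "\<bar>(\<integral>y. H y \<partial>\<nu>) - (\<integral>y. p (sin_clip L y) \<partial>\<nu>)\<bar> = \<bar>\<integral>y. H y - p (sin_clip L y) \<partial>\<nu>\<bar>"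
      using Hi pi by simp
    also have "\<dots> \<le> (\<integral>y. \<bar>H y - p (sin_clip L y)\<bar> \<partial>\<nu>)"
      by (rule integral_abs_bound)
    also have "\<dots> \<le> (\<integral>y. 2 * e + 2 * indicator (- seq_box M) y \<partial>\<nu>)"
      using Hi pi box le by (intro integral_mono) (auto intro!: integrable_real_mult_indicator)
    also have "\<dots> = 2 * e + 2 * measure \<nu> (- seq_box M)"
    proof -
      have "integrable \<nu> (indicator (- seq_box M) :: _ \<Rightarrow> real)"
        using box by (intro integrable_real_indicator) (auto simp: emeasure_eq_measure)
      then have "(\<integral>y. 2 * e + 2 * indicator (- seq_box M) y \<partial>\<nu>) = (\<integral>y. 2 * e \<partial>\<nu>) + 2 * (\<integral>y. indicator (- seq_box M) y \<partial>\<nu>)"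
        by (subst Bochner_Integration.integral_add) auto
      then show ?thesis
        by (simp add: prob_space[unfolded sp] sp)
    qed
    also have "\<dots> \<le> 2 * e + 2 * e"
      using seq_box_tail[OF \<nu> M(1) t] M(2) by simp
    finally show ?thesis by simp
  qed
  have "(\<lambda>n. \<integral>y. p (sin_clip L y) \<partial>\<mu> n) \<longlonglongrightarrow> (\<integral>y. p (sin_clip L y) \<partial>\<mu>0)"
    using tendsto_Re[OF trig_poly_integral_tendsto[OF \<mu> \<mu>0 char tp]] by simp
  from LIMSEQ_D[OF this e] obtain n0 where
    n0: "\<And>n. n \<ge> n0 \<Longrightarrow> \<bar>(\<integral>y. p (sin_clip L y) \<partial>\<mu> n) - (\<integral>y. p (sin_clip L y) \<partial>\<mu>0)\<bar> < e"
    by auto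
  have "norm ((\<integral>y. H y \<partial>\<mu> n) - (\<integral>y. H y \<partial>\<mu>0)) < e0" if "n \<ge> n0" for n
    unfolding real_norm_def using n0[OF that] approx[OF \<mu> tail, of n] approx[OF \<mu>0 tail0] e0 e_def by linarith
  then show "\<exists>no. \<forall>n\<ge>no. norm ((\<integral>y. H y \<partial>\<mu> n) - (\<integral>y. H y \<partial>\<mu>0)) < e0" by blast
qed


subsection \<open>Gaussian sequences\<close>

text \<open>The standard normal characteristic function at u / sqrt 2, as the variance is
  1/2.\<close>

lemma (in prob_space) iexp_normal:
  assumes X: "distributed M lborel X (\<lambda>x. ennreal (normal_density 0 (1 / sqrt 2) x))"
  shows "expectation (\<lambda>\<omega>. iexp (u * X \<omega>)) = of_real (exp (- u\<^sup>2 / 4))"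
proof -
  define Z where "Z \<omega> = (X \<omega> - 0) / (1 / sqrt 2)" for \<omega>
  have Z: "distributed M lborel Z (\<lambda>x. ennreal (std_normal_density x))"
    using X unfolding Z_def by (subst normal_standard_normal_convert[symmetric]) auto
  have Zm: "Z \<in> M \<rightarrow>\<^sub>M lborel" using Z by (rule distributed_measurable)
  have m: "(\<lambda>x::real. iexp (u / sqrt 2 * x)) \<in> borel_measurable borel"
    by (intro borel_measurable_continuous_onI continuous_intros)
  have "expectation (\<lambda>\<omega>. iexp (u * X \<omega>)) = expectation (\<lambda>\<omega>. iexp (u / sqrt 2 * Z \<omega>))"
    by (simp add: Z_def)
  also have "\<dots> = (\<integral>x. iexp (u / sqrt 2 * x) \<partial>distr M lborel Z)"
    using Zm m by (subst integral_distr) auto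
  also have "\<dots> = char std_normal_distribution (u / sqrt 2)"
    by (simp add: char_def distributed_distr_eq_density[OF Z])
  also have "\<dots> = of_real (exp (- u\<^sup>2 / 4))"
    by (simp add: char_std_normal_distribution power_divide)
  finally show ?thesis .
qed

lemma (in prob_space) normal_tail:
  assumes X: "distributed M lborel X (\<lambda>x. ennreal (normal_density 0 (1 / sqrt 2) x))" and t: "t > 0"
  shows "prob {\<omega> \<in> space M. t \<le> \<bar>X \<omega>\<bar>} \<le> 1 / (2 * t\<^sup>2)"
proof -
  have s: "1 / sqrt 2 > 0" by simp
  have Xm: "random_variable borel X" using distributed_measurable[OF X] by simp
  have "integrable lborel (\<lambda>x. normal_density 0 (1 / sqrt 2) x * x\<^sup>2)"
    using integrable_normal_moment[OF s, of 0 2] by simp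
  then have i: "integrable M (\<lambda>\<omega>. (X \<omega>)\<^sup>2)"
    by (subst distributed_integrable[OF X, symmetric]) auto
  have e: "expectation X = 0" by (rule normal_distributed_expectation[OF s X])
  have "variance X = (1 / sqrt 2)\<^sup>2" by (rule normal_distributed_variance[OF s X])
  then have v: "variance X = 1 / 2" by (simp add: power_divide)
  have "prob {\<omega> \<in> space M. t \<le> \<bar>X \<omega> - expectation X\<bar>} \<le> 1 / 2 / t\<^sup>2"
    using Chebyshev_inequality[OF Xm i t] unfolding v .
  then show ?thesis by (simp add: e)
qed

text \<open>If |X| > t, one of the two parts is at least t / sqrt 2 in modulus, and Chebyshev's
  inequality with variance 1/2 gives 1 / t^2 for each.\<close>

lemma (in prob_space) std_complex_gaussian_tail:
  assumes X: "std_complex_gaussian M X" and t: "t > 0"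
  shows "prob {\<omega> \<in> space M. t < cmod (X \<omega>)} \<le> 2 / t\<^sup>2"
proof -
  note d = X[unfolded std_complex_gaussian_def, THEN conjunct2, THEN conjunct1]
    X[unfolded std_complex_gaussian_def, THEN conjunct2, THEN conjunct2, THEN conjunct1]
  have [measurable]: "X \<in> borel_measurable M" using X by (simp add: std_complex_gaussian_def)
  let ?s = "t / sqrt 2"
  have s: "?s > 0" using t by simp
  let ?A = "{\<omega> \<in> space M. ?s \<le> \<bar>Re (X \<omega>)\<bar>}" and ?B = "{\<omega> \<in> space M. ?s \<le> \<bar>Im (X \<omega>)\<bar>}"
  have "{\<omega> \<in> space M. t < cmod (X \<omega>)} \<subseteq> ?A \<union> ?B"
  proof
    fix \<omega> assume w: "\<omega> \<in> {\<omega> \<in> space M. t < cmod (X \<omega>)}"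
    show "\<omega> \<in> ?A \<union> ?B"
    proof (rule ccontr)
      assume "\<omega> \<notin> ?A \<union> ?B"
      with w have lt: "\<bar>Re (X \<omega>)\<bar> < ?s" "\<bar>Im (X \<omega>)\<bar> < ?s" by auto
      have "\<bar>Re (X \<omega>)\<bar>\<^sup>2 \<le> ?s\<^sup>2" "\<bar>Im (X \<omega>)\<bar>\<^sup>2 \<le> ?s\<^sup>2"
        using lt by (intro power_mono; simp)+
      then have "(cmod (X \<omega>))\<^sup>2 \<le> t\<^sup>2"
        by (simp add: cmod_power2 power_divide)
      then have "cmod (X \<omega>) \<le> t" using t by (simp add: power2_le_iff_abs_le)
      with w show False by simp
    qed
  qed
  then have "prob {\<omega> \<in> space M. t < cmod (X \<omega>)} \<le> prob (?A \<union> ?B)"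
    by (intro finite_measure_mono) auto
  also have "\<dots> \<le> prob ?A + prob ?B"
    by (intro measure_Un_le) auto
  also have "\<dots> \<le> 1 / (2 * ?s\<^sup>2) + 1 / (2 * ?s\<^sup>2)"
    by (intro add_mono normal_tail d s)
  also have "\<dots> = 2 / t\<^sup>2" using t by (simp add: power_divide)
  finally show ?thesis .
qed

lemma (in prob_space) integrable_iexp:
  "f \<in> borel_measurable M \<Longrightarrow> integrable M (\<lambda>\<omega>. iexp (f \<omega>))"
  using measurable_compose[OF _ measurable_iexp, of f M]
  by (intro integrable_const_bound[of _ 1]) (auto intro!: AE_I2)

lemma (in prob_space) iexp_std_complex_gaussian:
  assumes X: "std_complex_gaussian M X"
  shows "expectation (\<lambda>\<omega>. iexp (Re (cnj w * X \<omega>))) = of_real (exp (- (cmod w)\<^sup>2 / 4))"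
proof -
  have [measurable]: "X \<in> borel_measurable M" using X by (simp add: std_complex_gaussian_def)
  note d = X[unfolded std_complex_gaussian_def, THEN conjunct2, THEN conjunct1]
    X[unfolded std_complex_gaussian_def, THEN conjunct2, THEN conjunct2, THEN conjunct1]
  have "indep_var borel (\<lambda>\<omega>. Re (X \<omega>)) borel (\<lambda>\<omega>. Im (X \<omega>))"
    using X by (simp add: std_complex_gaussian_def)
  from indep_var_compose[OF this, of "\<lambda>x. iexp (Re w * x)" borel "\<lambda>x. iexp (Im w * x)" borel]
  have ind: "indep_var borel (\<lambda>\<omega>. iexp (Re w * Re (X \<omega>))) borel (\<lambda>\<omega>. iexp (Im w * Im (X \<omega>)))"
    by (simp add: comp_def)
  have "iexp (Re (cnj w * X \<omega>)) = iexp (Re w * Re (X \<omega>)) * iexp (Im w * Im (X \<omega>))" for \<omega>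
    by (simp add: exp_add[symmetric] distrib_left)
  then have "expectation (\<lambda>\<omega>. iexp (Re (cnj w * X \<omega>))) = expectation (\<lambda>\<omega>. iexp (Re w * Re (X \<omega>)) * iexp (Im w * Im (X \<omega>)))"
    by simp
  also have "\<dots> = expectation (\<lambda>\<omega>. iexp (Re w * Re (X \<omega>))) * expectation (\<lambda>\<omega>. iexp (Im w * Im (X \<omega>)))"
    by (intro indep_var_lebesgue_integral[OF ind] integrable_iexp) measurable
  also have "\<dots> = of_real (exp (- (Re w)\<^sup>2 / 4)) * of_real (exp (- (Im w)\<^sup>2 / 4))"
    unfolding iexp_normal[OF d(1)] iexp_normal[OF d(2)] ..
  also have "\<dots> = of_real (exp (- (cmod w)\<^sup>2 / 4))"
    by (simp add: cmod_power2 add_divide_distrib diff_divide_distrib flip: of_real_mult exp_add)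
  finally show ?thesis .
qed

text \<open>The same value as the limit in \<open>char_stat_convergence\<close>; this is where the
  limiting coefficients are identified as standard complex Gaussians.\<close>

lemma (in prob_space) iexp_lin_form_gaussian:
  assumes ind: "indep_vars (\<lambda>_. borel) c {1..}" and c: "\<And>k. k \<ge> 1 \<Longrightarrow> std_complex_gaussian M (c k)"
  shows "expectation (\<lambda>\<omega>. iexp (lin_form m \<theta> (\<lambda>k. c (Suc k) \<omega>))) = of_real (exp (- (\<Sum>k<m. (cmod (\<theta> k))\<^sup>2) / 4))"
proof -
  \<comment> \<open>The variables are indexed from 1 and the coefficients from 0, hence i -
    1.\<close>
  let ?f = "\<lambda>i z. iexp (Re (cnj (\<theta> (i - 1)) * z))"
  have fm: "(\<lambda>z::complex. ?f i z) \<in> borel_measurable borel" for i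
    by (intro borel_measurable_continuous_onI continuous_intros)
  have "indep_vars (\<lambda>_. borel) c {Suc 0..m}" using indep_vars_subset[OF ind] by auto
  from indep_vars_compose2[OF this, of ?f "\<lambda>_. borel"]
  have ind': "indep_vars (\<lambda>_. borel) (\<lambda>i \<omega>. ?f i (c i \<omega>)) {Suc 0..m}" using fm by simp
  have cm: "c i \<in> borel_measurable M" if "i \<in> {Suc 0..m}" for i
    using c[of i] that by (simp add: std_complex_gaussian_def)
  have "iexp (lin_form m \<theta> (\<lambda>k. c (Suc k) \<omega>)) = (\<Prod>i\<in>{Suc 0..m}. ?f i (c i \<omega>))" for \<omega>
  proof -
    have "lin_form m \<theta> (\<lambda>k. c (Suc k) \<omega>) = (\<Sum>i\<in>{Suc 0..m}. Re (cnj (\<theta> (i - 1)) * c i \<omega>))"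
      by (simp add: lin_form_def sum.atLeast1_atMost_eq)
    then show ?thesis
      by (simp only: of_real_sum sum_distrib_left) (rule exp_sum, simp)
  qed
  then have "expectation (\<lambda>\<omega>. iexp (lin_form m \<theta> (\<lambda>k. c (Suc k) \<omega>))) = expectation (\<lambda>\<omega>. \<Prod>i\<in>{Suc 0..m}. ?f i (c i \<omega>))"
    by simp
  also have "\<dots> = (\<Prod>i\<in>{Suc 0..m}. expectation (\<lambda>\<omega>. ?f i (c i \<omega>)))"
  proof (rule indep_vars_lebesgue_integral[OF _ ind'])
    show "integrable M (\<lambda>\<omega>. ?f i (c i \<omega>))" if "i \<in> {Suc 0..m}" for i
    proof (rule integrable_iexp)
      have [measurable]: "c i \<in> borel_measurable M" by (rule cm[OF that])
      show "(\<lambda>\<omega>. Re (cnj (\<theta> (i - 1)) * c i \<omega>)) \<in> borel_measurable M" by measurable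
    qed
  qed simp
  also have "\<dots> = (\<Prod>i\<in>{Suc 0..m}. of_real (exp (- (cmod (\<theta> (i - 1)))\<^sup>2 / 4)))"
    using c by (intro prod.cong refl iexp_std_complex_gaussian) auto
  also have "\<dots> = (\<Prod>k<m. of_real (exp (- (cmod (\<theta> k))\<^sup>2 / 4)))"
    by (simp add: prod.atLeast1_atMost_eq)
  also have "\<dots> = of_real (exp (\<Sum>k<m. - (cmod (\<theta> k))\<^sup>2 / 4))"
    by (simp add: exp_sum)
  also have "(\<Sum>k<m. - (cmod (\<theta> k))\<^sup>2 / 4) = - (\<Sum>k<m. (cmod (\<theta> k))\<^sup>2) / 4"
    by (simp add: sum_divide_distrib sum_negf)
  finally show ?thesis .
qed


subsection \<open>Convergence of the point processes\<close>

lemma box_continuous_zero_stat: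
  assumes \<phi>: "test_function \<phi>" and a: "a \<noteq> 0" and g: "\<And>x. isCont g x"
  shows "box_continuous (\<lambda>y. g (zero_stat \<phi> a y))"
  unfolding box_continuous_def
proof (intro allI impI)
  fix M and y :: "nat \<Rightarrow> nat \<Rightarrow> complex" and y0
  assume y: "\<forall>n. y n \<in> seq_box M" and lim: "\<forall>k. (\<lambda>n. y n k) \<longlonglongrightarrow> y0 k"
  have "(\<lambda>n. zero_stat \<phi> a (y n)) \<longlonglongrightarrow> zero_stat \<phi> a y0"
    using y lim by (intro zero_stat_tendsto[OF \<phi> a _ _ disk_summable_square[of M]]) (auto simp: seq_box_def)
  then show "(\<lambda>n. g (zero_stat \<phi> a (y n))) \<longlonglongrightarrow> g (zero_stat \<phi> a y0)"
    by (rule isCont_tendsto_compose[OF g])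
qed

lemma independent_rvs_distr_pair:
  assumes M: "prob_space M" and ind: "independent_rvs M S X T Y"
  shows "distr M (S \<Otimes>\<^sub>M T) (\<lambda>\<omega>. (X \<omega>, Y \<omega>)) = distr M S X \<Otimes>\<^sub>M distr M T Y"
proof -
  interpret prob_space M by fact
  have XY [measurable]: "X \<in> M \<rightarrow>\<^sub>M S" "Y \<in> M \<rightarrow>\<^sub>M T"
    and i: "indep_set (sets (vimage_algebra (space M) X S)) (sets (vimage_algebra (space M) Y T))"
    using ind by (auto simp: independent_rvs_def)
  interpret X: prob_space "distr M S X" by (rule prob_space_distr) fact
  interpret Y: prob_space "distr M T Y" by (rule prob_space_distr) fact
  show ?thesis
  proof (rule pair_measure_eqI[symmetric])
    fix A B assume A: "A \<in> sets (distr M S X)" and B: "B \<in> sets (distr M T Y)"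
    have "prob ((X -` A \<inter> space M) \<inter> (Y -` B \<inter> space M)) = prob (X -` A \<inter> space M) * prob (Y -` B \<inter> space M)"
      using A B by (intro indep_setD[OF i] in_vimage_algebra) auto
    moreover have "(\<lambda>\<omega>. (X \<omega>, Y \<omega>)) -` (A \<times> B) \<inter> space M = (X -` A \<inter> space M) \<inter> (Y -` B \<inter> space M)"
      by auto
    ultimately show "emeasure (distr M S X) A * emeasure (distr M T Y) B
      = emeasure (distr M (S \<Otimes>\<^sub>M T) (\<lambda>\<omega>. (X \<omega>, Y \<omega>))) (A \<times> B)"
      using A B by (simp add: emeasure_distr emeasure_eq_measure ennreal_mult)
  qed (auto intro: X.sigma_finite_measure_axioms Y.sigma_finite_measure_axioms)
qed

lemma admissible_measurable:
  assumes U: "haar_distributed M N U" and v: "admissible_vector M N U v"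
  shows "(\<lambda>\<omega>. (U \<omega>, v \<omega>)) \<in> M \<rightarrow>\<^sub>M pair_space N"
proof -
  have "v \<in> M \<rightarrow>\<^sub>M sphere_space N"
  proof (cases "\<exists>x\<in>unit_sphere N. \<forall>\<omega>\<in>space M. v \<omega> = x")
    case True
    then obtain x where "x \<in> unit_sphere N" "\<And>\<omega>. \<omega> \<in> space M \<Longrightarrow> v \<omega> = x" by blast
    then show ?thesis by (subst measurable_cong[where g="\<lambda>_. x"]) auto
  next
    case False
    then show ?thesis using v by (auto simp: admissible_vector_def independent_rvs_def)
  qed
  then show ?thesis
    using U unfolding pair_space_def haar_distributed_def by (intro measurable_Pair) auto
qed

text \<open>In both cases the joint law is built from the Haar measure in a way that commutes with
  left multiplication: as its image under V \<mapsto> (V, x), or as its product with the law of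
  v.\<close>

lemma admissible_invariant_pair:
  assumes M: "prob_space M" and U: "haar_distributed M N U" and v: "admissible_vector M N U v"
  shows "invariant_pair N (distr M (pair_space N) (\<lambda>\<omega>. (U \<omega>, v \<omega>)))"
proof -
  interpret prob_space M by fact
  let ?\<nu> = "distr M (pair_space N) (\<lambda>\<omega>. (U \<omega>, v \<omega>))"
  note UV = admissible_measurable[OF U v]
  interpret D: prob_space ?\<nu> by (rule prob_space_distr[OF UV])
  have Um: "U \<in> M \<rightarrow>\<^sub>M unitary_space N" using U by (simp add: haar_distributed_def)
  let ?\<mu> = "distr M (unitary_space N) U"
  have haar: "distr ?\<mu> (unitary_space N) (\<lambda>V. W * V) = ?\<mu>" if "W \<in> unitary_mats N" for W
    using U that by (simp add: haar_distributed_def haar_unitary_def)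
  show ?thesis
  proof unfold_locales
    fix W assume W: "W \<in> unitary_mats N"
    note mW = measurable_unitary_mult[OF W]
    note pW = measurable_pair_unitary_mult[OF W]
    show "distr ?\<nu> (pair_space N) (\<lambda>p. (W * fst p, snd p)) = ?\<nu>"
    proof (cases "\<exists>x\<in>unit_sphere N. \<forall>\<omega>\<in>space M. v \<omega> = x")
      case True
      then obtain x where x: "x \<in> unit_sphere N" "\<And>\<omega>. \<omega> \<in> space M \<Longrightarrow> v \<omega> = x" by blast
      have mx: "(\<lambda>V. (V, x)) \<in> unitary_space N \<rightarrow>\<^sub>M pair_space N"
        unfolding pair_space_def using x(1) by (intro measurable_Pair) auto
      have \<nu>: "?\<nu> = distr ?\<mu> (pair_space N) (\<lambda>V. (V, x))"
        using x by (subst distr_distr[OF mx Um]) (auto intro!: distr_cong simp: comp_def)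
      have "distr ?\<nu> (pair_space N) (\<lambda>p. (W * fst p, snd p)) = distr ?\<mu> (pair_space N) (\<lambda>V. (W * V, x))"
        unfolding \<nu> using mx pW by (subst distr_distr) (auto simp: comp_def)
      also have "\<dots> = distr (distr ?\<mu> (unitary_space N) (\<lambda>V. W * V)) (pair_space N) (\<lambda>V. (V, x))"
        using mx mW by (subst distr_distr[of _ "unitary_space N"]) (auto simp: comp_def)
      also have "\<dots> = ?\<nu>" by (simp only: haar[OF W] \<nu>)
      finally show ?thesis .
    next
      case False
      then have ind: "independent_rvs M (unitary_space N) U (sphere_space N) v"
        using v by (auto simp: admissible_vector_def)
      let ?\<sigma> = "distr M (sphere_space N) v"
      have vm: "v \<in> M \<rightarrow>\<^sub>M sphere_space N" using ind by (simp add: independent_rvs_def)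
      interpret S: prob_space ?\<sigma> by (rule prob_space_distr[OF vm])
      have \<nu>: "?\<nu> = ?\<mu> \<Otimes>\<^sub>M ?\<sigma>"
        unfolding pair_space_def by (rule independent_rvs_distr_pair[OF M ind])
      have \<sigma>: "distr ?\<sigma> (sphere_space N) (\<lambda>x. x) = ?\<sigma>"
        by (rule distr_id2) simp
      have "distr ?\<mu> (unitary_space N) (\<lambda>V. W * V) \<Otimes>\<^sub>M distr ?\<sigma> (sphere_space N) (\<lambda>x. x)
        = distr (?\<mu> \<Otimes>\<^sub>M ?\<sigma>) (unitary_space N \<Otimes>\<^sub>M sphere_space N) (\<lambda>(V, x). (W * V, x))"
        using mW by (intro pair_measure_distr) (auto simp: \<sigma> intro: S.sigma_finite_measure_axioms)
      then have "?\<nu> = distr ?\<nu> (pair_space N) (\<lambda>(V, x). (W * V, x))"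
        by (simp only: haar[OF W] \<sigma> \<nu>[unfolded pair_space_def] pair_space_def)
      then show ?thesis by (simp add: case_prod_unfold)
    qed
  qed simp
qed

section \<open>Tails and characteristic functions of the random coefficients\<close>

context invariant_pair
begin

lemma measurable_scaled_moment: "scaled_moment a N \<in> \<nu> \<rightarrow>\<^sub>M borel"
proof (rule measurable_coordinatewise_then_product)
  fix k
  have [measurable]: "cnj \<in> borel_measurable borel"
    by (intro borel_measurable_continuous_onI continuous_intros)
  have [measurable]: "pmoment (Suc k) \<in> borel_measurable \<nu>"
    using bounded_rv_pmoment by (simp add: bounded_rv_def)
  show "(\<lambda>p. scaled_moment a N p k) \<in> borel_measurable \<nu>"
    unfolding scaled_moment_def by measurable
qed

lemma shift_factor_bound: "cmod (1 - a * of_real (real N powr (-1/2))) \<le> 1 + cmod a"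
proof -
  have "real N powr (-1/2) \<le> 1 powr (-1/2)"
    using N_pos by (intro powr_mono2') auto
  then have "cmod a * \<bar>real N powr (-1/2)\<bar> \<le> cmod a * 1"
    by (intro mult_left_mono) auto
  then show ?thesis
    by (intro order_trans[OF norm_triangle_ineq4]) (simp add: norm_mult)
qed

text \<open>Markov's inequality for the square: the factor N in it cancels the 1/N of the second
  moment bound, which makes the tail uniform in N.\<close>

lemma scaled_moment_tail:
  assumes t: "t > 0"
  shows "prob {p \<in> space \<nu>. t < cmod (scaled_moment a N p k)} \<le> 2 * (1 + cmod a)\<^sup>2 * (real k + 1)\<^sup>2 / t\<^sup>2"
proof -
  let ?c = "1 + cmod a"
  define u where "u p = ?c\<^sup>2 * real N * (cmod (pmoment (Suc k) p))\<^sup>2" for p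
  have u: "integrable \<nu> u"
    unfolding u_def by (intro integrable_mult_right integrable_pmoment_square)
  have le: "(cmod (scaled_moment a N p k))\<^sup>2 \<le> u p" for p
  proof -
    have "(cmod (scaled_moment a N p k))\<^sup>2 = (cmod (1 - a * of_real (real N powr (-1/2))))\<^sup>2 * real N * (cmod (pmoment (Suc k) p))\<^sup>2"
      by (simp only: scaled_moment_def norm_mult power_mult_distrib complex_mod_cnj norm_of_real power2_abs real_sqrt_pow2 of_nat_0_le_iff)
    also have "\<dots> \<le> u p"
      unfolding u_def by (intro mult_right_mono power_mono shift_factor_bound) auto
    finally show ?thesis .
  qed
  have um: "u \<in> borel_measurable \<nu>" using u by simp
  have "prob {p \<in> space \<nu>. t < cmod (scaled_moment a N p k)} \<le> prob {p \<in> space \<nu>. u p \<ge> t\<^sup>2}"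
  proof (rule finite_measure_mono)
    show "{p \<in> space \<nu>. t < cmod (scaled_moment a N p k)} \<subseteq> {p \<in> space \<nu>. u p \<ge> t\<^sup>2}"
    proof clarsimp
      fix A x assume "t < cmod (scaled_moment a N (A, x) k)"
      then have "t\<^sup>2 \<le> (cmod (scaled_moment a N (A, x) k))\<^sup>2" using t by (intro power_mono) auto
      then show "t\<^sup>2 \<le> u (A, x)" using le order_trans by blast
    qed
    show "{p \<in> space \<nu>. u p \<ge> t\<^sup>2} \<in> events" using um by measurable
  qed
  also have "\<dots> \<le> (\<integral>p. u p \<partial>\<nu>) / t\<^sup>2"
    using t by (intro integral_Markov_inequality_measure[OF u, of "{}"]) (auto simp: u_def)
  also have "(\<integral>p. u p \<partial>\<nu>) = ?c\<^sup>2 * (real N * (\<integral>p. (cmod (pmoment (Suc k) p))\<^sup>2 \<partial>\<nu>))"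
    by (simp add: u_def integrable_pmoment_square)
  also have "\<dots> / t\<^sup>2 \<le> ?c\<^sup>2 * (2 * (real (Suc k))\<^sup>2) / t\<^sup>2"
    using t by (intro divide_right_mono mult_left_mono pmoment_square_bound) auto
  finally show ?thesis by (simp add: add.commute mult_ac)
qed

text \<open>The entries contain conjugated moments, so the coefficients are conjugated too and
  absorb the factor 1 - \<alpha>; the shift by one leaves the coefficient 0 at index 0 that
  \<open>char_stat_convergence\<close> asks for.\<close>

lemma lin_form_scaled_moment:
  "lin_form m \<theta> (scaled_moment a N p) = linear_stat N (Suc m)
     (\<lambda>j. case j of 0 \<Rightarrow> 0 | Suc k \<Rightarrow> cnj (\<theta> k) * (1 - a * of_real (real N powr (-1/2)))) p"
proof -
  let ?c = "1 - a * of_real (real N powr (-1/2))"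
  have "Re (cnj (\<theta> k) * scaled_moment a N p k) = sqrt N * Re (cnj (cnj (\<theta> k) * ?c) * pmoment (Suc k) p)" for k
  proof -
    have "cnj (\<theta> k) * scaled_moment a N p k = of_real (sqrt N) * cnj (cnj (cnj (\<theta> k) * ?c) * pmoment (Suc k) p)"
      by (simp only: scaled_moment_def complex_cnj_mult complex_cnj_cnj mult_ac)
    moreover have "Re (of_real s * cnj z) = s * Re z" for s z
      by simp
    ultimately show ?thesis by (simp only:)
  qed
  then show ?thesis
    unfolding lin_form_def linear_stat_def by (subst sum.lessThan_Suc_shift) (simp add: sum_distrib_left)
qed

lemma char_scaled_moment:
  fixes a :: complex
  assumes \<Lambda>: "\<And>k. k < m \<Longrightarrow> cmod (\<theta> k) \<le> \<Lambda>" and \<Lambda>0: "\<Lambda> \<ge> 0"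
  defines "L \<equiv> \<Lambda> * (1 + cmod a)" and "n \<equiv> real (Suc m)"
  shows "cmod ((\<integral>p. iexp (lin_form m \<theta> (scaled_moment a N p)) \<partial>\<nu>)
      - of_real (exp (- (\<Sum>k<m. (cmod (\<theta> k))\<^sup>2) * (cmod (1 - a * of_real (real N powr (-1/2))))\<^sup>2 / 4)))
    \<le> n * L * ((2 * L * n ^ 4 + 2 * n ^ 3) / sqrt N)"
proof -
  let ?c = "1 - a * of_real (real N powr (-1/2))"
  let ?\<theta> = "\<lambda>j. case j of 0 \<Rightarrow> 0 | Suc k \<Rightarrow> cnj (\<theta> k) * ?c"
  have L0: "L \<ge> 0" using \<Lambda>0 by (simp add: L_def)
  have bound: "cmod (?\<theta> j) \<le> L" if "j < Suc m" for j
  proof (cases j)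
    case (Suc k)
    then show ?thesis
      unfolding Suc nat.case norm_mult complex_mod_cnj L_def using that Suc \<Lambda>0
      by (intro mult_mono \<Lambda> shift_factor_bound) auto
  qed (use \<Lambda>0 in \<open>simp add: L_def\<close>)
  have "cmod ((\<integral>p. char_stat (Suc m) ?\<theta> p \<partial>\<nu>) - of_real (exp (- (\<Sum>j<Suc m. (cmod (?\<theta> j))\<^sup>2) / 4)))
     \<le> n * L * ((2 * L * n ^ 4 + 2 * n ^ 3) / sqrt N)"
    unfolding n_def by (rule char_stat_convergence[OF bound _ L0]) simp_all
  moreover have "(\<Sum>j<Suc m. (cmod (?\<theta> j))\<^sup>2) = (\<Sum>k<m. (cmod (\<theta> k))\<^sup>2) * (cmod ?c)\<^sup>2"
    by (subst sum.lessThan_Suc_shift) (simp add: norm_mult power_mult_distrib sum_distrib_right)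
  ultimately show ?thesis
    by (simp only: lin_form_scaled_moment minus_mult_left)
qed

end

text \<open>The matrix models exist only from N = 1 on, so convergence is proved for the shifted
  sequence.\<close>

lemma weak_conv_m_Suc:
  assumes "weak_conv_m (\<lambda>n. \<mu> (Suc n)) \<mu>0"
  shows "weak_conv_m \<mu> \<mu>0"
  unfolding weak_conv_m_def weak_conv_def
proof (intro allI impI)
  fix x assume "isCont (cdf \<mu>0) x"
  then have "(\<lambda>n. cdf (\<mu> (Suc n)) x) \<longlonglongrightarrow> cdf \<mu>0 x"
    using assms unfolding weak_conv_m_def weak_conv_def by blast
  then show "(\<lambda>n. cdf (\<mu> n) x) \<longlonglongrightarrow> cdf \<mu>0 x"
    by (rule LIMSEQ_imp_Suc)
qed

text \<open>The error of \<open>char_scaled_moment\<close> is a constant independent of n times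
  (n+1)^(-1/2), and the perturbing factor 1 - a (n+1)^(-1/2) tends to 1.\<close>

lemma lin_form_iexp_scaled_moment_tendsto:
  assumes "\<And>n. invariant_pair (Suc n) (\<nu> n)"
  shows "(\<lambda>n. \<integral>p. iexp (lin_form m \<theta> (scaled_moment a (Suc n) p)) \<partial>\<nu> n)
     \<longlonglongrightarrow> of_real (exp (- (\<Sum>k<m. (cmod (\<theta> k))\<^sup>2) / 4))"
proof -
  define \<Lambda> where "\<Lambda> = (\<Sum>k<m. cmod (\<theta> k))"
  define L where "L = \<Lambda> * (1 + cmod a)"
  define r where "r n = real (Suc n) powr (-1/2)" for n
  define c where "c n = 1 - a * of_real (r n)" for n
  let ?S = "\<Sum>k<m. (cmod (\<theta> k))\<^sup>2"
  let ?E = "\<lambda>n. \<integral>p. iexp (lin_form m \<theta> (scaled_moment a (Suc n) p)) \<partial>\<nu> n"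
  let ?G = "\<lambda>n. of_real (exp (- ?S * (cmod (c n))\<^sup>2 / 4)) :: complex"
  define B where "B = real (Suc m) * L * (2 * L * real (Suc m) ^ 4 + 2 * real (Suc m) ^ 3)"
  have r0: "r \<longlonglongrightarrow> 0"
    unfolding r_def
    by (rule tendsto_neg_powr[OF _ filterlim_compose[OF filterlim_real_sequentially filterlim_Suc]]) simp
  have bound: "norm (?E n - ?G n) \<le> B * r n" for n
  proof -
    have "\<Lambda> \<ge> 0" unfolding \<Lambda>_def by (intro sum_nonneg) auto
    moreover have "cmod (\<theta> k) \<le> \<Lambda>" if "k < m" for k
      unfolding \<Lambda>_def using that by (intro member_le_sum) auto
    ultimately have "norm (?E n - ?G n) \<le> real (Suc m) * L * ((2 * L * real (Suc m) ^ 4 + 2 * real (Suc m) ^ 3) / sqrt (real (Suc n)))"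
      unfolding c_def L_def r_def by (intro invariant_pair.char_scaled_moment[OF assms])
    also have "\<dots> = B * r n"
    proof -
      have "r n = inverse (sqrt (real (Suc n)))"
        by (simp add: r_def powr_half_sqrt powr_minus del: of_nat_Suc)
      then show ?thesis
        by (simp only: B_def divide_inverse mult.assoc)
    qed
    finally show ?thesis .
  qed
  have "(\<lambda>n. ?E n - ?G n) \<longlonglongrightarrow> 0"
  proof (rule Lim_null_comparison)
    show "\<forall>\<^sub>F n in sequentially. norm (?E n - ?G n) \<le> B * r n"
      by (intro always_eventually allI bound)
    show "(\<lambda>n. B * r n) \<longlonglongrightarrow> 0"
      by (rule tendsto_mult_right_zero[OF r0])
  qed
  moreover have "?G \<longlonglongrightarrow> of_real (exp (- ?S * (cmod (1 - a * of_real 0))\<^sup>2 / 4))"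
    unfolding c_def by (intro tendsto_intros r0) simp
  ultimately have "(\<lambda>n. (?E n - ?G n) + ?G n) \<longlonglongrightarrow> 0 + of_real (exp (- ?S * (cmod (1 - a * of_real 0))\<^sup>2 / 4))"
    by (rule tendsto_add)
  then show ?thesis by simp
qed

theorem theorem2:
  fixes a :: complex
    and P :: "nat \<Rightarrow> 'w measure"
    and U :: "nat \<Rightarrow> 'w \<Rightarrow> complex mat"
    and v :: "nat \<Rightarrow> 'w \<Rightarrow> complex vec"
    and Q :: "'q measure"
    and c :: "nat \<Rightarrow> 'q \<Rightarrow> complex"
  assumes "a \<noteq> 0"
    and "\<And>N. N \<ge> 1 \<Longrightarrow> prob_space (P N)"
    and "\<And>N. N \<ge> 1 \<Longrightarrow> haar_distributed (P N) N (U N)"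
    and "\<And>N. N \<ge> 1 \<Longrightarrow> admissible_vector (P N) N (U N) (v N)"
    and "prob_space Q"
    and "prob_space.indep_vars Q (\<lambda>_. borel) c {1..}"
    and "\<And>k. k \<ge> 1 \<Longrightarrow> std_complex_gaussian Q (c k)"
  shows "converges_vaguely
           P (\<lambda>N \<omega>. eigenvalue_measure (U N \<omega> * A_mat a N (v N \<omega>)))
           Q (\<lambda>\<omega>. zero_measure (phi a (\<lambda>k. c k \<omega>)))"
  unfolding converges_vaguely_def
proof (intro allI impI)
  fix \<phi> :: "complex \<Rightarrow> real" assume \<phi>: "test_function \<phi>"
  define X where "X N \<omega> = integral\<^sup>L (eigenvalue_measure (U N \<omega> * A_mat a N (v N \<omega>))) \<phi>" for N \<omega>
  define Y where "Y \<omega> = integral\<^sup>L (zero_measure (phi a (\<lambda>k. c k \<omega>))) \<phi>" for \<omega>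
  define UV where "UV N \<omega> = (U N \<omega>, v N \<omega>)" for N \<omega>
  define \<nu> where "\<nu> N = distr (P N) (pair_space N) (UV N)" for N
  define \<mu> where "\<mu> n = distr (\<nu> (Suc n)) borel (scaled_moment a (Suc n))" for n
  define G where "G \<omega> k = c (Suc k) \<omega>" for \<omega> k
  define \<mu>0 where "\<mu>0 = distr Q borel G"
  interpret Q: prob_space Q by fact
  have P: "prob_space (P (Suc n))" for n using assms(2) by simp
  have UVm: "UV N \<in> P N \<rightarrow>\<^sub>M pair_space N" if "N \<ge> 1" for N
    unfolding UV_def using assms(3,4)[OF that] by (rule admissible_measurable)
  have inv: "invariant_pair N (\<nu> N)" if "N \<ge> 1" for N
    unfolding \<nu>_def UV_def using assms(2-4)[OF that] by (rule admissible_invariant_pair)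
  have inv': "invariant_pair (Suc n) (\<nu> (Suc n))" for n by (rule inv) simp
  have zs [measurable]: "zero_stat \<phi> a \<in> borel_measurable borel"
    by (rule borel_measurable_zero_stat[OF \<phi> assms(1)])
  \<comment> \<open>Together with \<open>Y_eq\<close> below: both sides are the same functional
    \<open>zero_stat \<phi> a\<close> of random coefficient sequences.\<close>
  have X_eq: "X N \<omega> = zero_stat \<phi> a (scaled_moment a N (UV N \<omega>))" if "N \<ge> 1" "\<omega> \<in> space (P N)" for N \<omega>
    using measurable_space[OF UVm[OF that(1)] that(2)] that(1)
    by (simp add: X_def UV_def zero_stat_def eigenvalue_measure_eq_zero_measure)
  have smm: "scaled_moment a N \<in> pair_space N \<rightarrow>\<^sub>M borel" if "N \<ge> 1" for N
    using invariant_pair.measurable_scaled_moment[OF inv[OF that], of a] by (simp add: \<nu>_def)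
  have Xm: "X N \<in> borel_measurable (P N)" if "N \<ge> 1" for N
  proof -
    have "(\<lambda>\<omega>. zero_stat \<phi> a (scaled_moment a N (UV N \<omega>))) \<in> borel_measurable (P N)"
      using measurable_compose[OF measurable_compose[OF UVm[OF that] smm[OF that]] zs] .
    then show ?thesis
      using X_eq[OF that] by (subst measurable_cong[where g="\<lambda>\<omega>. zero_stat \<phi> a (scaled_moment a N (UV N \<omega>))"])
  qed
  have cm: "c (Suc k) \<in> borel_measurable Q" for k
    using assms(7)[of "Suc k"] by (simp add: std_complex_gaussian_def)
  have Gm: "G \<in> Q \<rightarrow>\<^sub>M borel"
    by (rule measurable_coordinatewise_then_product) (simp add: G_def cm)
  have Y_eq: "Y \<omega> = zero_stat \<phi> a (G \<omega>)" for \<omega>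
    by (simp add: Y_def zero_stat_def phi_eq_disk_series G_def[abs_def])
  have Ym: "Y \<in> borel_measurable Q"
    unfolding Y_eq[abs_def] by (rule measurable_compose[OF Gm zs])
  have \<mu>p: "prob_space (\<mu> n)" "sets (\<mu> n) = sets borel" for n
  proof -
    interpret invariant_pair "Suc n" "\<nu> (Suc n)" by (rule inv')
    show "prob_space (\<mu> n)" "sets (\<mu> n) = sets borel"
      unfolding \<mu>_def by (auto intro: prob_space_distr measurable_scaled_moment)
  qed
  have \<mu>0p: "prob_space \<mu>0" "sets \<mu>0 = sets borel"
    unfolding \<mu>0_def by (auto intro: Q.prob_space_distr Gm)
  \<comment> \<open>The constant of \<open>scaled_moment_tail\<close>; being at least 2, it also
    covers the Gaussian tail.\<close>
  define C where "C = 2 * (1 + cmod a)\<^sup>2"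
  have coordm: "{y::nat \<Rightarrow> complex. cmod (y k) > t} \<in> sets borel" for k t
    by measurable
  have tail: "measure (\<mu> n) {y. cmod (y k) > t} \<le> C * (real k + 1)\<^sup>2 / t\<^sup>2" if "t > 0" for n k t
  proof -
    interpret invariant_pair "Suc n" "\<nu> (Suc n)" by (rule inv')
    have "measure (\<mu> n) {y. cmod (y k) > t} = prob {p \<in> space (\<nu> (Suc n)). t < cmod (scaled_moment a (Suc n) p k)}"
      unfolding \<mu>_def by (subst measure_distr[OF measurable_scaled_moment coordm]) (auto intro!: arg_cong[of _ _ prob])
    then show ?thesis
      using scaled_moment_tail[OF that, of a k] by (simp add: C_def)
  qed
  have tail0: "measure \<mu>0 {y. cmod (y k) > t} \<le> C * (real k + 1)\<^sup>2 / t\<^sup>2" if "t > 0" for k t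
  proof -
    have "measure \<mu>0 {y. cmod (y k) > t} = Q.prob {\<omega> \<in> space Q. t < cmod (c (Suc k) \<omega>)}"
      unfolding \<mu>0_def by (subst measure_distr[OF Gm coordm]) (auto simp: G_def intro!: arg_cong[of _ _ Q.prob])
    also have "\<dots> \<le> 2 / t\<^sup>2"
      using assms(7)[of "Suc k"] that by (intro Q.std_complex_gaussian_tail) auto
    also have "\<dots> \<le> C * (real k + 1)\<^sup>2 / t\<^sup>2"
    proof (rule divide_right_mono)
      have "2 * 1 * 1 \<le> 2 * (1 + cmod a)\<^sup>2 * (real k + 1)\<^sup>2"
        by (intro mult_mono) (auto intro!: one_le_power)
      then show "2 \<le> C * (real k + 1)\<^sup>2" by (simp add: C_def)
    qed simp
    finally show ?thesis .
  qed
  have char: "(\<lambda>n. \<integral>y. iexp (lin_form m \<theta> y) \<partial>\<mu> n) \<longlonglongrightarrow> (\<integral>y. iexp (lin_form m \<theta> y) \<partial>\<mu>0)" for m \<theta>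
  proof -
    have "(\<integral>y. iexp (lin_form m \<theta> y) \<partial>\<mu> n) = (\<integral>p. iexp (lin_form m \<theta> (scaled_moment a (Suc n) p)) \<partial>\<nu> (Suc n))" for n
      unfolding \<mu>_def
      by (rule integral_distr[OF invariant_pair.measurable_scaled_moment[OF inv'] measurable_iexp_lin_form])
    moreover have "(\<integral>y. iexp (lin_form m \<theta> y) \<partial>\<mu>0) = (\<integral>\<omega>. iexp (lin_form m \<theta> (G \<omega>)) \<partial>Q)"
      unfolding \<mu>0_def by (rule integral_distr[OF Gm measurable_iexp_lin_form])
    moreover have "\<dots> = of_real (exp (- (\<Sum>k<m. (cmod (\<theta> k))\<^sup>2) / 4))"
      unfolding G_def[abs_def] by (rule Q.iexp_lin_form_gaussian[OF assms(6,7)])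
    ultimately show ?thesis
      using lin_form_iexp_scaled_moment_tendsto[OF inv'] by simp
  qed
  have "weak_conv_m (\<lambda>n. distr (P (Suc n)) borel (X (Suc n))) (distr Q borel Y)"
  proof (rule integral_bdd_continuous_conv_imp_weak_conv)
    show "real_distribution (distr (P (Suc n)) borel (X (Suc n)))" for n
      using prob_space.real_distribution_distr[OF P Xm[of "Suc n"]] by simp
    show "real_distribution (distr Q borel Y)"
      by (rule Q.real_distribution_distr[OF Ym])
    \<comment> \<open>Composed with \<open>zero_stat\<close>, a continuous function bounded by 1 is
      a bounded box continuous functional, to which \<open>integral_tendsto_of_char_tendsto\<close>
      applies.\<close>
    fix f :: "real \<Rightarrow> real" assume f: "\<And>x. isCont f x" and fb: "\<And>x. \<bar>f x\<bar> \<le> 1"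
    have fm: "f \<in> borel_measurable borel"
      using f by (intro borel_measurable_continuous_onI continuous_at_imp_continuous_on) auto
    let ?H = "\<lambda>y. f (zero_stat \<phi> a y)"
    have Hm: "?H \<in> borel_measurable borel"
      by (rule measurable_compose[OF zs fm])
    have "(\<lambda>n. \<integral>y. ?H y \<partial>\<mu> n) \<longlonglongrightarrow> (\<integral>y. ?H y \<partial>\<mu>0)"
      by (rule integral_tendsto_of_char_tendsto[OF \<mu>p \<mu>0p tail tail0 char Hm fb box_continuous_zero_stat[OF \<phi> assms(1) f]])
    moreover have "integral\<^sup>L (distr (P (Suc n)) borel (X (Suc n))) f = (\<integral>y. ?H y \<partial>\<mu> n)" for n
    proof -
      have "integral\<^sup>L (distr (P (Suc n)) borel (X (Suc n))) f = (\<integral>\<omega>. f (X (Suc n) \<omega>) \<partial>P (Suc n))"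
        by (rule integral_distr[OF Xm fm]) simp
      also have "\<dots> = (\<integral>\<omega>. ?H (scaled_moment a (Suc n) (UV (Suc n) \<omega>)) \<partial>P (Suc n))"
        by (intro Bochner_Integration.integral_cong refl) (simp add: X_eq)
      also have "\<dots> = (\<integral>p. ?H (scaled_moment a (Suc n) p) \<partial>\<nu> (Suc n))"
        unfolding \<nu>_def using measurable_compose[OF smm Hm, of "Suc n"] UVm[of "Suc n"]
        by (subst integral_distr) auto
      also have "\<dots> = (\<integral>y. ?H y \<partial>\<mu> n)"
        unfolding \<mu>_def by (rule integral_distr[OF invariant_pair.measurable_scaled_moment[OF inv'] Hm, symmetric])
      finally show ?thesis .
    qed
    moreover have "integral\<^sup>L (distr Q borel Y) f = (\<integral>y. ?H y \<partial>\<mu>0)"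
    proof -
      have "integral\<^sup>L (distr Q borel Y) f = (\<integral>\<omega>. ?H (G \<omega>) \<partial>Q)"
        by (subst integral_distr[OF Ym fm]) (simp add: Y_eq)
      also have "\<dots> = (\<integral>y. ?H y \<partial>\<mu>0)"
        unfolding \<mu>0_def by (rule integral_distr[OF Gm Hm, symmetric])
      finally show ?thesis .
    qed
    ultimately show "(\<lambda>n. integral\<^sup>L (distr (P (Suc n)) borel (X (Suc n))) f) \<longlonglongrightarrow> integral\<^sup>L (distr Q borel Y) f"
      by simp
  qed
  then have "weak_conv_m (\<lambda>N. distr (P N) borel (X N)) (distr Q borel Y)"
    by (rule weak_conv_m_Suc)
  moreover have "\<forall>\<^sub>F N in sequentially. X N \<in> borel_measurable (P N)"
    using Xm by (auto simp: eventually_sequentially)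
  ultimately show "converges_in_distribution P (\<lambda>N \<omega>. integral\<^sup>L (eigenvalue_measure (U N \<omega> * A_mat a N (v N \<omega>))) \<phi>)
      Q (\<lambda>\<omega>. integral\<^sup>L (zero_measure (phi a (\<lambda>k. c k \<omega>))) \<phi>)"
    using Ym unfolding converges_in_distribution_def X_def[abs_def] Y_def[abs_def] by blast
qed

end
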